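(* Let $\mathcal{P}$ be a primitive integral Apollonian 3-circle packing and let $\mathcal{K}\subset\mathbb{Z}$ be the set of curvatures of circles in $\mathcal{P}$. An integer $n$ is admissible for $\mathcal{P}$ if and only if there exists $\kappa\in\mathcal{K}$ with $n\equiv\kappa \pmod 8$.
   Context: An Apollonian 3-circle packing is constructed as follows. Start with three mutually tangent circles in the plane (one of them may enclose the other two). In each of the two curvilinear triangular gaps formed by them there is a unique way to inscribe three new circles so that, among these six circles, each circle is tangent to four of the others and disjoint from the remaining one. Iterate: every curvilinear triangular gap bounded by three mutually tangent circles of the configuration is filled in the same way by three circles, ad infinitum; the resulting collection of circles is the packing $\mathcal{P}$. The curvature of a circle is the reciprocal of its radius, taken negative for the circle enclosing all others. $\mathcal{P}$ is integral if all curvatures are integers, and primitive if the gcd of all curvatures is $1$. An integer $n$ is called admissible (for $\mathcal{P}$) if for every positive integer $q$ there exists $\kappa\in\mathcal{K}$ with $n\equiv\kappa\pmod q$. *)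

theory Defs
  imports "HOL-Analysis.Analysis" "HOL-Number_Theory.Cong"
begin

text \<open>Oriented generalized circles in the plane (identified with the complex numbers).
  Each is represented by the closed region it bounds on its "inner" side:
  \<^item> Circ c r   : circle of centre c, radius r > 0, bounding the closed disc (curvature 1/r);
  \<^item> Outer c r  : circle of centre c, radius r > 0, enclosing the others, bounding the
                 closed exterior region (curvature -1/r);
  \<^item> Line u d   : straight line (a degenerate circle, curvature 0) with unit normal u,
                 bounding the closed half plane where Re (cnj u * z) >= d.\<close>

datatype gcircle = Circ complex real | Outer complex real | Line complex real

fun valid_gc :: "gcircle \<Rightarrow> bool" where
  "valid_gc (Circ c r) = (r > 0)"
| "valid_gc (Outer c r) = (r > 0)"
| "valid_gc (Line u d) = (norm u = 1)"

fun is_line :: "gcircle \<Rightarrow> bool" where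
  "is_line (Line u d) = True"
| "is_line _ = False"

fun region :: "gcircle \<Rightarrow> complex set" where
  "region (Circ c r) = cball c r"
| "region (Outer c r) = {z. dist z c \<ge> r}"
| "region (Line u d) = {z. Re (cnj u * z) \<ge> d}"

fun curv :: "gcircle \<Rightarrow> real" where
  "curv (Circ c r) = 1 / r"
| "curv (Outer c r) = - (1 / r)"
| "curv (Line u d) = 0"

text \<open>Two circles of a packing are tangent if their inner regions have disjoint interiors
  and touch in exactly one point (two parallel lines are tangent at infinity).\<close>
definition tangent :: "gcircle \<Rightarrow> gcircle \<Rightarrow> bool" where
  "tangent X Y \<longleftrightarrow> X \<noteq> Y \<and> interior (region X) \<inter> interior (region Y) = {} \<and>
     ((\<exists>z. region X \<inter> region Y = {z}) \<or>
      (is_line X \<and> is_line Y \<and> region X \<inter> region Y = {}))"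

text \<open>Two circles are disjoint if they do not meet at all (not even at infinity).\<close>
definition disjoint_gc :: "gcircle \<Rightarrow> gcircle \<Rightarrow> bool" where
  "disjoint_gc X Y \<longleftrightarrow> region X \<inter> region Y = {} \<and> \<not> (is_line X \<and> is_line Y)"

definition mutually_tangent :: "gcircle \<Rightarrow> gcircle \<Rightarrow> gcircle \<Rightarrow> bool" where
  "mutually_tangent A B C \<longleftrightarrow> tangent A B \<and> tangent B C \<and> tangent A C"

definition is_gap :: "gcircle set \<Rightarrow> gcircle \<Rightarrow> gcircle \<Rightarrow> gcircle \<Rightarrow> complex set \<Rightarrow> bool" where
  "is_gap Cs A B C G \<longleftrightarrow> A \<in> Cs \<and> B \<in> Cs \<and> C \<in> Cs \<and> mutually_tangent A B C \<and>
     (\<exists>z. z \<notin> region A \<union> region B \<union> region C \<and>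
          G = connected_component_set (- (region A \<union> region B \<union> region C)) z) \<and>
     (\<forall>X\<in>Cs. interior (region X) \<inter> G = {})"

definition fills :: "complex set \<Rightarrow> gcircle \<Rightarrow> gcircle \<Rightarrow> gcircle \<Rightarrow>
    gcircle \<Rightarrow> gcircle \<Rightarrow> gcircle \<Rightarrow> bool" where
  "fills G A B C E1 E2 E3 \<longleftrightarrow>
     (let S = {A, B, C, E1, E2, E3} in
       card S = 6 \<and>
       (\<forall>E\<in>{E1, E2, E3}. valid_gc E \<and> interior (region E) \<subseteq> G) \<and>
       (\<forall>X\<in>S. card {Y\<in>S - {X}. tangent X Y} = 4 \<and> card {Y\<in>S - {X}. disjoint_gc X Y} = 1))"

definition initial_triple :: "gcircle \<Rightarrow> gcircle \<Rightarrow> gcircle \<Rightarrow> bool" where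
  "initial_triple A B C \<longleftrightarrow> (\<forall>X\<in>{A, B, C}. valid_gc X \<and> \<not> is_line X) \<and> mutually_tangent A B C"

fun stage :: "gcircle \<Rightarrow> gcircle \<Rightarrow> gcircle \<Rightarrow> nat \<Rightarrow> gcircle set" where
  "stage A B C 0 = {A, B, C}"
| "stage A B C (Suc m) = stage A B C m \<union>
     {E. \<exists>P Q R G E1 E2 E3. is_gap (stage A B C m) P Q R G \<and> fills G P Q R E1 E2 E3 \<and>
         E \<in> {E1, E2, E3}}"

definition packing :: "gcircle \<Rightarrow> gcircle \<Rightarrow> gcircle \<Rightarrow> gcircle set" where
  "packing A B C = (\<Union>m. stage A B C m)"

definition curvatures :: "gcircle \<Rightarrow> gcircle \<Rightarrow> gcircle \<Rightarrow> int set" where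
  "curvatures A B C = {k. \<exists>X\<in>packing A B C. curv X = of_int k}"

definition integral_packing :: "gcircle \<Rightarrow> gcircle \<Rightarrow> gcircle \<Rightarrow> bool" where
  "integral_packing A B C \<longleftrightarrow> (\<forall>X\<in>packing A B C. curv X \<in> \<int>)"

definition primitive_packing :: "gcircle \<Rightarrow> gcircle \<Rightarrow> gcircle \<Rightarrow> bool" where
  "primitive_packing A B C \<longleftrightarrow> Gcd (curvatures A B C) = 1"

definition admissible :: "int set \<Rightarrow> int \<Rightarrow> bool" where
  "admissible K n \<longleftrightarrow> (\<forall>q::int. q > 0 \<longrightarrow> (\<exists>\<kappa>\<in>K. [n = \<kappa>] (mod q)))"

end

(* A circle with its inner side is a unit vector of a Lorentz space of signature (3,1); its curvature
   is a linear coordinate, and tangency means product -1. Three mutually tangent circles P, Q, R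
   together with a normal M of their span form a basis, and the octahedron inscribed on one side
   consists of P, Q, R and 2W - P, 2W - Q, 2W - R with W = P + Q + R + 2M. Hence curvatures of triples
   are integer points (a,b,c,m) of the cone 2m^2 = ab + bc + ca, and the packing is closed under
   m -> -m and a -> a + 2(b+c) + 4m, m -> -m - (b+c). The composition of these two moves is unipotent,
   with powers a -> a + 4mk + 2(b+c)k^2, m -> m + k(b+c). Modulo an odd prime, finitely many such
   powers bring a coordinate to any prescribed residue by a pigeonhole argument on a conic; a Hensel
   step passes to prime powers, which for the prime 2 starts from the residue modulo 8. The Chinese
   remainder theorem, applied to the exponents of the moves, combines the prime powers. *)

theory Submission
  imports Defs "HOL-Computational_Algebra.Primes"
begin

section \<open>Moves on integer points of the cone\<close>

text \<open>Two obstacles lie outside the algebra of the moves. The packing is defined by connected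
  components of complements and by tangency counts, so every stage has to be identified with an
  algebraic growth step on vectors. The invariant that carries the induction is a dichotomy: each
  side of each tangent triple either has its octahedron present already or contains no further
  circle of the stage. Strict inequalities away from an octahedron show that a circle, at the stage
  where it appears, is tangent only to members of its own octahedron, so the new triples are faces
  of octahedra.

  The modulus 8 comes from the exponent 2^(e+1), which shifts b by 2^(e+3) * (m + 2^e * (a + c)).
  The parity of m can be adjusted beforehand so that the second factor is odd; hence all binary
  digits from the fourth on are free.

  Primitivity speaks of all curvatures, whereas residues are moved within one triple. The bridge: a
  prime dividing the three curvatures of one triple also divides m, and so spreads from octahedron
  to octahedron through the whole packing.\<close>

type_synonym state = "int \<times> int \<times> int \<times> int"

datatype move = UA int | UB int | UC int

fun step :: "move \<Rightarrow> state \<Rightarrow> state" where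
  "step (UA k) (a, b, c, m) = (a + 4*m*k + 2*(b + c)*k\<^sup>2, b, c, m + k*(b + c))"
| "step (UB k) (a, b, c, m) = (a, b + 4*m*k + 2*(a + c)*k\<^sup>2, c, m + k*(a + c))"
| "step (UC k) (a, b, c, m) = (a, b, c + 4*m*k + 2*(a + b)*k\<^sup>2, m + k*(a + b))"

fun scale :: "int \<Rightarrow> move \<Rightarrow> move" where
  "scale e (UA k) = UA (e * k)"
| "scale e (UB k) = UB (e * k)"
| "scale e (UC k) = UC (e * k)"

fun cong_state :: "int \<Rightarrow> state \<Rightarrow> state \<Rightarrow> bool" where
  "cong_state q (a, b, c, m) (a', b', c', m') \<longleftrightarrow>
     [a = a'] (mod q) \<and> [b = b'] (mod q) \<and> [c = c'] (mod q) \<and> [m = m'] (mod q)"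

fun cone :: "state \<Rightarrow> bool" where
  "cone (a, b, c, m) \<longleftrightarrow> 2 * m\<^sup>2 = a*b + b*c + c*a"

fun primitive_at :: "int \<Rightarrow> state \<Rightarrow> bool" where
  "primitive_at p (a, b, c, m) \<longleftrightarrow> \<not> (p dvd a \<and> p dvd b \<and> p dvd c)"

text \<open>The coordinate to be steered: \<open>UA\<close> and \<open>UC\<close> fix it and serve
  to adjust \<open>m\<close>, while \<open>UB k\<close> changes it by a quadratic polynomial in
  \<open>k\<close>.\<close>

abbreviation snd4 :: "state \<Rightarrow> int" where
  "snd4 s \<equiv> fst (snd s)"

abbreviation act :: "move list \<Rightarrow> state \<Rightarrow> state" where
  "act \<equiv> fold step"

section \<open>Moves modulo q and coprime moduli\<close>

lemma cong_state_refl: "cong_state q s s"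
  by (cases s) auto

lemma cong_state_snd4: "cong_state q s t \<Longrightarrow> [snd4 s = snd4 t] (mod q)"
  by (cases s; cases t) auto

lemma cong_state_step:
  assumes "[e = f] (mod q)" "cong_state q s t"
  shows "cong_state q (step (scale e x) s) (step (scale f x) t)"
proof -
  have "[e * k = f * k] (mod q)" for k
    using cong_mult[OF assms(1) cong_refl[of k]] .
  then show ?thesis using assms
    by (cases s; cases t; cases x)
      (auto intro!: cong_add cong_mult cong_pow)
qed

lemma cong_state_act_1:
  assumes "[e = 1] (mod q)"
  shows "cong_state q s t \<Longrightarrow> cong_state q (act (map (scale e) w) s) (act w t)"
proof (induction w arbitrary: s t)
  case (Cons x w)
  have "scale 1 x = x" by (cases x) auto
  then show ?case using Cons.IH[OF cong_state_step[OF assms Cons.prems, of x]] by simp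
qed simp

lemma cong_state_act_0:
  assumes "[e = 0] (mod q)"
  shows "cong_state q s t \<Longrightarrow> cong_state q (act (map (scale e) w) s) t"
proof (induction w arbitrary: s t)
  case (Cons x w)
  have "step (scale 0 x) t = t" by (cases t; cases x) auto
  then show ?case using Cons.IH[OF cong_state_step[OF assms Cons.prems, of x]] by simp
qed simp

text \<open>Exponents enter a move polynomially, so scaling them by a number that is 1 modulo one
  factor and 0 modulo the other keeps the word modulo the first and turns it into the identity
  modulo the second. The two scaled words are then concatenated.\<close>

lemma reach_coprime:
  assumes "coprime q r"
    and "[snd4 (act v s) = n] (mod q)" and "[snd4 (act w s) = n] (mod r)"
  shows "\<exists>u. [snd4 (act u s) = n] (mod (q * r))"
proof -
  obtain e where e: "[e = 1] (mod q)" "[e = 0] (mod r)"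
    using binary_chinese_remainder_int[OF assms(1)] by blast
  obtain f where f: "[f = 0] (mod q)" "[f = 1] (mod r)"
    using binary_chinese_remainder_int[OF assms(1)] by blast
  let ?u = "map (scale e) v @ map (scale f) w"
  have "cong_state q (act ?u s) (act v s)"
    using cong_state_act_0[OF f(1) cong_state_act_1[OF e(1) cong_state_refl]] by simp
  moreover have "cong_state r (act ?u s) (act w s)"
    using cong_state_act_1[OF f(2) cong_state_act_0[OF e(2) cong_state_refl]] by simp
  ultimately have "[snd4 (act ?u s) = n] (mod q)" "[snd4 (act ?u s) = n] (mod r)"
    using assms(2,3) cong_state_snd4 cong_trans by blast+
  then show ?thesis using assms(1) coprime_cong_mult by blast
qed

section \<open>Invariance of the cone and of primitivity\<close>

lemma cone_step:
  assumes "cone s"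
  shows "cone (step x s)"
proof -
  obtain a b c m where s: "s = (a, b, c, m)" by (cases s)
  then have h: "2 * m\<^sup>2 = a*b + b*c + c*a" using assms by simp
  show ?thesis
  proof (cases x)
    case (UA k)
    have "2 * (m + k*(b + c))\<^sup>2 = (a + 4*m*k + 2*(b + c)*k\<^sup>2)*b + b*c + c*(a + 4*m*k + 2*(b + c)*k\<^sup>2)"
      using h by algebra
    then show ?thesis using s UA by simp
  next
    case (UB k)
    have "2 * (m + k*(a + c))\<^sup>2 = a*(b + 4*m*k + 2*(a + c)*k\<^sup>2) + (b + 4*m*k + 2*(a + c)*k\<^sup>2)*c + c*a"
      using h by algebra
    then show ?thesis using s UB by simp
  next
    case (UC k)
    have "2 * (m + k*(a + b))\<^sup>2 = a*b + b*(c + 4*m*k + 2*(a + b)*k\<^sup>2) + (c + 4*m*k + 2*(a + b)*k\<^sup>2)*a"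
      using h by algebra
    then show ?thesis using s UC by simp
  qed
qed

lemma cone_act: "cone s \<Longrightarrow> cone (act w s)"
  by (induction w arbitrary: s) (simp_all del: split_paired_All add: cone_step)

text \<open>The right-hand side is divisible by p^2. For odd p the factor 2 is harmless; for p = 2
  one factor cancels and another is left.\<close>

lemma cone_dvd:
  fixes p :: int
  assumes "prime p" "2 * m\<^sup>2 = a*b + b*c + c*a" "p dvd a" "p dvd b" "p dvd c"
  shows "p dvd m"
proof -
  obtain x y z where "a = p*x" "b = p*y" "c = p*z" using assms(3-5) by (meson dvdE)
  then have eq: "2 * m\<^sup>2 = p * (p * (x*y + y*z + z*x))"
    using assms(2) by (simp add: algebra_simps)
  show ?thesis
  proof (cases "p = 2")
    case True
    then have "m\<^sup>2 = p * (x*y + y*z + z*x)" using eq by simp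
    then show ?thesis using assms(1) prime_dvd_power by (metis dvd_triv_left)
  next
    case False
    then have "\<not> p dvd 2" using assms(1) by (metis primes_dvd_imp_eq two_is_prime_nat prime_int_numeral_eq)
    moreover have "p dvd 2 * m\<^sup>2" using eq by simp
    ultimately show ?thesis using assms(1) by (metis prime_dvd_mult_iff prime_dvd_power)
  qed
qed

text \<open>A move can be undone, and undoing it involves the new fourth entry too; that this entry
  is divisible by \<open>p\<close> is supplied by \<open>cone_dvd\<close>.\<close>

lemma primitive_at_step:
  assumes "prime p" "cone s" "primitive_at p s"
  shows "primitive_at p (step x s)"
proof -
  obtain a b c m where s: "s = (a, b, c, m)" by (cases s)
  obtain a' b' c' m' where s': "step x s = (a', b', c', m')" by (cases "step x s")
  show ?thesis
  proof (rule ccontr)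
    assume "\<not> ?thesis"
    then have d: "p dvd a'" "p dvd b'" "p dvd c'" using s' by auto
    have m': "p dvd m'"
      using cone_dvd[OF assms(1) _ d] cone_step[OF assms(2), of x] s' by auto
    have "p dvd a \<and> p dvd b \<and> p dvd c"
    proof (cases x)
      case (UA k)
      then have e: "b = b'" "c = c'" "m = m' - k*(b' + c')" "a = a' - (4*m*k + 2*(b' + c')*k\<^sup>2)"
        using s s' by auto
      have "p dvd m" unfolding e using d m' by auto
      then show ?thesis unfolding e(1,2,4) using d by auto
    next
      case (UB k)
      then have e: "a = a'" "c = c'" "m = m' - k*(a' + c')" "b = b' - (4*m*k + 2*(a' + c')*k\<^sup>2)"
        using s s' by auto
      have "p dvd m" unfolding e using d m' by auto
      then show ?thesis unfolding e(1,2,4) using d by auto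
    next
      case (UC k)
      then have e: "a = a'" "b = b'" "m = m' - k*(a' + b')" "c = c' - (4*m*k + 2*(a' + b')*k\<^sup>2)"
        using s s' by auto
      have "p dvd m" unfolding e using d m' by auto
      then show ?thesis unfolding e(1,2,4) using d by auto
    qed
    then show False using assms(3) s by simp
  qed
qed

lemma primitive_at_act:
  "prime p \<Longrightarrow> cone s \<Longrightarrow> primitive_at p s \<Longrightarrow> primitive_at p (act w s)"
  by (induction w arbitrary: s) (simp_all del: split_paired_All add: cone_step primitive_at_step)


section \<open>Prescribing a residue modulo an odd prime\<close>

lemma odd_prime_not_dvd_2:
  fixes p :: int
  assumes "prime p" "odd p"
  shows "\<not> p dvd 2"
proof
  assume "p dvd 2"
  then have "p \<le> 2" by (simp add: zdvd_imp_le)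
  then show False using assms prime_gt_1_int[of p] by (cases "p = 2") auto
qed

lemma prime_linear_solvable:
  fixes p u t :: int
  assumes "prime p" "\<not> p dvd u"
  shows "\<exists>x. p dvd u * x - t"
proof -
  have "coprime u p" using assms prime_imp_coprime coprime_commute by blast
  then obtain x where "[u * x = 1] (mod p)" using cong_solve_coprime_int by blast
  then have "[u * x * t = 1 * t] (mod p)" by (rule cong_mult[OF _ cong_refl])
  then have "p dvd u * (x * t) - t" by (simp add: cong_iff_dvd_diff mult.assoc)
  then show ?thesis by blast
qed

text \<open>Equal squares mean x = y or x = -y modulo p, and on this half system of residues the
  second option leaves only x = y = 0. So the quadratic takes (p+1)/2 distinct values.\<close>

lemma inj_on_square_mod:
  fixes p u t :: int
  assumes "prime p" "\<not> p dvd u"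
  shows "inj_on (\<lambda>x. (u * x\<^sup>2 + t) mod p) {0..(p - 1) div 2}"
proof (rule inj_onI)
  fix x y assume x: "x \<in> {0..(p - 1) div 2}" and y: "y \<in> {0..(p - 1) div 2}"
    and "(u * x\<^sup>2 + t) mod p = (u * y\<^sup>2 + t) mod p"
  then have "p dvd (u * x\<^sup>2 + t) - (u * y\<^sup>2 + t)" by (simp add: mod_eq_dvd_iff)
  also have "(u * x\<^sup>2 + t) - (u * y\<^sup>2 + t) = u * ((x - y) * (x + y))" by algebra
  finally have "p dvd x - y \<or> p dvd x + y"
    using assms by (simp add: prime_dvd_mult_iff)
  moreover have "p > 1" using assms(1) prime_gt_1_int by blast
  moreover have "\<bar>x - y\<bar> < p" "\<bar>x + y\<bar> < p" using x y \<open>p > 1\<close> by auto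
  ultimately have "x - y = 0 \<or> x + y = 0"
    using dvd_imp_le_int[of "x - y" p] dvd_imp_le_int[of "x + y" p] by linarith
  then show "x = y" using x y by auto
qed

text \<open>Two sets of (p+1)/2 residues each cannot be disjoint among p residues.\<close>

lemma conic_solvable:
  fixes p u v t :: int
  assumes p: "prime p" "odd p" and uv: "\<not> p dvd u" "\<not> p dvd v"
  shows "\<exists>x y. p dvd u * x\<^sup>2 - v * y\<^sup>2 - t"
proof -
  let ?H = "{0..(p - 1) div 2}"
  let ?f = "\<lambda>x. (u * x\<^sup>2 + 0) mod p" and ?g = "\<lambda>y. (v * y\<^sup>2 + t) mod p"
  have p1: "p > 1" using p(1) prime_gt_1_int by blast
  have "?f ` ?H \<inter> ?g ` ?H \<noteq> {}"
  proof
    assume "?f ` ?H \<inter> ?g ` ?H = {}"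
    then have "card (?f ` ?H \<union> ?g ` ?H) = card (?f ` ?H) + card (?g ` ?H)"
      by (intro card_Un_disjoint) auto
    also have "\<dots> = card ?H + card ?H"
      using card_image[OF inj_on_square_mod[OF p(1) uv(1), of 0]]
        card_image[OF inj_on_square_mod[OF p(1) uv(2), of t]] by simp
    also have "\<dots> = nat (p + 1)"
    proof -
      obtain r where "p = 2 * r + 1" using p(2) by (elim oddE)
      then show ?thesis using p1 by simp
    qed
    finally have "card (?f ` ?H \<union> ?g ` ?H) = nat (p + 1)" .
    moreover have "card (?f ` ?H \<union> ?g ` ?H) \<le> card {0..<p}"
      using p1 by (intro card_mono) auto
    ultimately show False using p1 by simp
  qed
  then obtain x y where "(u * x\<^sup>2 + 0) mod p = (v * y\<^sup>2 + t) mod p" by blast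
  then have "p dvd u * x\<^sup>2 - v * y\<^sup>2 - t" by (simp add: mod_eq_dvd_iff algebra_simps)
  then show ?thesis by blast
qed

text \<open>After \<open>UA j\<close>, the discriminant of the quadratic equation in \<open>k\<close> that makes the second
  coordinate after \<open>UB k\<close> equal to \<open>n\<close> is, up to a unit, an affine function of the square of
  \<open>Y = 2(b+c)j + 2m\<close>; the conic lemma makes it a square for a suitable \<open>j\<close>.\<close>

lemma reach_mod_prime_aux:
  assumes p: "prime p" "odd p" and cone: "cone (a, b, c, m)"
    and "\<not> p dvd c" "\<not> p dvd c + n" "\<not> p dvd b + c"
  shows "\<exists>w a' b' m'. act w (a, b, c, m) = (a', b', c, m') \<and> p dvd b' - n"
proof -
  note p2 = odd_prime_not_dvd_2[OF p]
  note mult = prime_dvd_mult_iff[OF p(1)]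
  \<comment> \<open>Origin of the conic: multiply the equation for \<open>k\<close> by 2(a1+c) and
    complete the square with X = 2(a1+c)k + 2m1; the cone relation gives X^2 = 2(a1(c+n) + cn).
    Multiply by b+c and replace 2(b+c)a1 by Y^2 - 2bc, where Y = 2m1.\<close>
  obtain X Y where XY: "p dvd (b + c) * X\<^sup>2 - (c + n) * Y\<^sup>2 - 2*c\<^sup>2*(n - b)"
    using conic_solvable[OF p assms(6,5)] by blast
  have "\<not> p dvd 2 * (b + c)" using p2 assms(6) mult by blast
  then obtain j where j: "p dvd 2*(b + c)*j - (Y - 2*m)" using prime_linear_solvable[OF p(1)] by blast
  define a1 where "a1 = a + 4*m*j + 2*(b + c)*j\<^sup>2"
  define m1 where "m1 = m + j*(b + c)"
  have h1: "2 * m1\<^sup>2 = a1*b + b*c + c*a1"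
    using cone_step[OF cone, of "UA j"] by (simp add: a1_def m1_def)
  have "\<exists>k. p dvd (b + 4*m1*k + 2*(a1 + c)*k\<^sup>2) - n"
  proof (cases "p dvd a1 + c")
    \<comment> \<open>The quadratic degenerates to a linear equation with coefficient 4m1; the cone
      relation makes m1 a unit, since c^2 = (b+c)(a1+c) - 2m1^2.\<close>
    case True
    then obtain g where g: "a1 + c = p * g" by blast
    have "\<not> p dvd m1"
    proof
      assume "p dvd m1"
      then have "p dvd b * (a1 + c) - 2 * m1\<^sup>2 + c * (a1 + c)" using True by (simp add: power2_eq_square)
      also have "\<dots> = c * c" unfolding h1 by (simp add: algebra_simps)
      finally show False using assms(4) mult by blast
    qed
    then have "\<not> p dvd 4 * m1" using p2 mult[of "2 * 2" m1] mult[of 2 2] by simp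
    then obtain k where "p dvd 4*m1*k - (n - b)" using prime_linear_solvable[OF p(1)] by blast
    then have "p dvd (4*m1*k - (n - b)) + p * (2*g*k\<^sup>2)" by simp
    also have "\<dots> = (b + 4*m1*k + 2*(a1 + c)*k\<^sup>2) - n" unfolding g by (simp add: algebra_simps)
    finally show ?thesis by blast
  next
    case False
    then have g2: "\<not> p dvd 2 * (a1 + c)" using p2 False mult by blast
    then obtain k where k: "p dvd 2*(a1 + c)*k - (X - 2*m1)" using prime_linear_solvable[OF p(1)] by blast
    obtain r where "2*(b + c)*j - (Y - 2*m) = p * r" using j by (elim dvdE)
    then have m1: "2*m1 = Y + p * r" by (simp add: m1_def algebra_simps)
    obtain s where "(b + c) * X\<^sup>2 - (c + n) * Y\<^sup>2 - 2*c\<^sup>2*(n - b) = p * s"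
      using XY by (elim dvdE)
    then have s: "(b + c) * X\<^sup>2 = (c + n) * Y\<^sup>2 + 2*c\<^sup>2*(n - b) + p * s" by linarith
    obtain t where "2*(a1 + c)*k - (X - 2*m1) = p * t" using k by (elim dvdE)
    then have t: "2*(a1 + c)*k + 2*m1 = X + p * t" by linarith
    define D where "D = (b + 4*m1*k + 2*(a1 + c)*k\<^sup>2) - n"
    have "2*(a1 + c) * D = (2*(a1 + c)*k + 2*m1)\<^sup>2 - 2*(2*m1\<^sup>2) + 2*(a1 + c)*(b - n)"
      unfolding D_def by (simp add: power2_eq_square algebra_simps)
    also have "\<dots> = (X + p*t)\<^sup>2 - 2*(a1*(c + n) + c*n)"
      unfolding t h1 by (simp add: algebra_simps)
    finally have D: "2*(a1 + c) * D = (X + p*t)\<^sup>2 - 2*(a1*(c + n) + c*n)" .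
    have "2*(b + c)*a1 = (2*m1)\<^sup>2 - 2*b*c" using h1 by (simp add: power2_eq_square algebra_simps)
    then have a1: "2*(b + c)*a1 = (Y + p*r)\<^sup>2 - 2*b*c" unfolding m1 .
    have "(b + c) * (2*(a1 + c)) * D = (b + c) * (2*(a1 + c) * D)" by simp
    also have "\<dots> = (b + c) * X\<^sup>2 + p * ((b + c) * (2*X*t + p*t\<^sup>2)) - (2*(b + c)*a1)*(c + n) - 2*c*n*(b + c)"
      unfolding D by (simp add: power2_eq_square algebra_simps)
    also have "\<dots> = p * (s + (b + c) * (2*X*t + p*t\<^sup>2) - (2*Y*r + p*r\<^sup>2)*(c + n))"
      unfolding s a1 by (simp add: power2_eq_square algebra_simps)
    finally have "p dvd (b + c) * (2*(a1 + c)) * D" by simp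
    then have "p dvd D"
      using g2 assms(6) mult by blast
    then show ?thesis unfolding D_def by blast
  qed
  then obtain k where "p dvd (b + 4*m1*k + 2*(a1 + c)*k\<^sup>2) - n" by blast
  then show ?thesis
    by (intro exI[of _ "[UA j, UB k]"]) (simp add: a1_def m1_def)
qed

text \<open>If p divides b+c, then c^2 = (a+c)(b+c) - 2m^2 makes m a unit. The values of b after
  \<open>UB 1\<close> and \<open>UB (-1)\<close> differ by 8m, so at least one of them leads back to
  the case where b+c is a unit.\<close>

lemma reach_mod_prime_third:
  assumes p: "prime p" "odd p" and cone: "cone (a, b, c, m)"
    and c: "\<not> p dvd c" "\<not> p dvd c + n"
  shows "\<exists>w a' b' m'. act w (a, b, c, m) = (a', b', c, m') \<and> p dvd b' - n"
proof (cases "p dvd b + c")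
  case False
  then show ?thesis using reach_mod_prime_aux[OF p cone c] by blast
next
  case True
  note p2 = odd_prime_not_dvd_2[OF p]
  note mult = prime_dvd_mult_iff[OF p(1)]
  have h: "2 * m\<^sup>2 = a*b + b*c + c*a" using cone by simp
  have "\<not> p dvd m"
  proof
    assume "p dvd m"
    then have "p dvd (a + c) * (b + c) - 2 * m\<^sup>2" using True by (simp add: power2_eq_square)
    also have "\<dots> = c * c" unfolding h by (simp add: algebra_simps)
    finally show False using c(1) mult by blast
  qed
  then have m8: "\<not> p dvd 2 * (2 * (2 * m))" using p2 mult by blast
  have "\<exists>k. \<not> p dvd (b + 4*m*k + 2*(a + c)*k\<^sup>2) + c"
  proof (rule ccontr)
    assume "\<not> ?thesis"
    then have "p dvd (b + 4*m*1 + 2*(a + c)*1\<^sup>2) + c" "p dvd (b + 4*m*(-1) + 2*(a + c)*(-1)\<^sup>2) + c"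
      by blast+
    then have "p dvd ((b + 4*m*1 + 2*(a + c)*1\<^sup>2) + c) - ((b + 4*m*(-1) + 2*(a + c)*(-1)\<^sup>2) + c)"
      by (rule dvd_diff)
    then show False using m8 by simp
  qed
  then obtain k where k: "\<not> p dvd (b + 4*m*k + 2*(a + c)*k\<^sup>2) + c" by blast
  have "cone (a, b + 4*m*k + 2*(a + c)*k\<^sup>2, c, m + k*(a + c))"
    using cone_step[OF cone, of "UB k"] by simp
  from reach_mod_prime_aux[OF p this c k]
  obtain w a' b' m' where "act w (step (UB k) (a, b, c, m)) = (a', b', c, m') \<and> p dvd b' - n"
    by auto
  then have "act (UB k # w) (a, b, c, m) = (a', b', c, m') \<and> p dvd b' - n" by simp
  then show ?thesis by blast
qed

section \<open>Permuting the three curvatures\<close>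

fun rotate_state :: "state \<Rightarrow> state" where
  "rotate_state (a, b, c, m) = (b, c, a, m)"

fun rotate_move :: "move \<Rightarrow> move" where
  "rotate_move (UA k) = UB k"
| "rotate_move (UB k) = UC k"
| "rotate_move (UC k) = UA k"

fun flip_state :: "state \<Rightarrow> state" where
  "flip_state (a, b, c, m) = (c, b, a, m)"

fun flip_move :: "move \<Rightarrow> move" where
  "flip_move (UA k) = UC k"
| "flip_move (UB k) = UB k"
| "flip_move (UC k) = UA k"

text \<open>Relabelling coordinates conjugates the moves, so a word found for the relabelled state
  can be pulled back. \<open>UA\<close> on the rotated state acts on the old b, hence becomes
  \<open>UB\<close>.\<close>

lemma rotate_state_act: "rotate_state (act (map rotate_move w) s) = act w (rotate_state s)"
proof (induction w arbitrary: s)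
  case (Cons x w)
  have "rotate_state (step (rotate_move x) s) = step x (rotate_state s)"
    by (cases s; cases x) (simp_all add: algebra_simps)
  then show ?case using Cons.IH by simp
qed simp

lemma flip_state_act: "flip_state (act (map flip_move w) s) = act w (flip_state s)"
proof (induction w arbitrary: s)
  case (Cons x w)
  have "flip_state (step (flip_move x) s) = step x (flip_state s)"
    by (cases s; cases x) (simp_all add: algebra_simps)
  then show ?case using Cons.IH by simp
qed simp

lemma reach_mod_prime_rotated:
  assumes p: "prime p" "odd p" and cone: "cone (a, b, c, m)"
    and a: "\<not> p dvd a" "\<not> p dvd a + n"
  shows "\<exists>w b' c' m'. act w (a, b, c, m) = (a, b', c', m') \<and> p dvd c' - n"
proof -
  have "cone (b, c, a, m)" using cone by simp
  from reach_mod_prime_third[OF p this a]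
  obtain w b' c' m' where w: "act w (b, c, a, m) = (b', c', a, m')" "p dvd c' - n" by blast
  then have "rotate_state (act (map rotate_move w) (a, b, c, m)) = (b', c', a, m')"
    by (simp add: rotate_state_act)
  then have "act (map rotate_move w) (a, b, c, m) = (a, b', c', m')"
    by (cases "act (map rotate_move w) (a, b, c, m)") auto
  then show ?thesis using w(2) by blast
qed

text \<open>With a fixed, c is first brought to an auxiliary residue t; then c is kept and b is
  brought to n. This needs t, a+t and t+n to be units. The choice t = a works unless n = -a, then t
  = 2a works unless p = 3, and that last case is treated by hand.\<close>

lemma reach_mod_prime_first:
  assumes p: "prime p" "odd p" and cone: "cone (a, b, c, m)" and a: "\<not> p dvd a"
  shows "\<exists>w. p dvd snd4 (act w (a, b, c, m)) - n"
proof -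
  note p2 = odd_prime_not_dvd_2[OF p]
  note mult = prime_dvd_mult_iff[OF p(1)]
  show ?thesis
  proof (cases "p dvd n + a \<and> p = 3")
    case False
    have "\<exists>t. \<not> p dvd t \<and> \<not> p dvd a + t \<and> \<not> p dvd t + n"
    proof (cases "p dvd n + a")
      case True
      then have "p \<noteq> 3" using False by blast
      have "\<not> p dvd 3"
      proof
        assume "p dvd 3"
        then have "p \<le> 3" by (simp add: zdvd_imp_le)
        then show False using p prime_gt_1_int[of p] \<open>p \<noteq> 3\<close> by (cases "p = 2") auto
      qed
      then have "\<not> p dvd 2 * a" "\<not> p dvd 3 * a" using a p2 mult by blast+
      moreover have "\<not> p dvd 2 * a + n"
      proof
        assume "p dvd 2 * a + n"
        then have "p dvd (2 * a + n) - (n + a)" using True by (rule dvd_diff)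
        then show False using a by simp
      qed
      ultimately show ?thesis by (intro exI[of _ "2 * a"]) simp
    next
      case False
      moreover have "\<not> p dvd 2 * a" using a p2 mult by blast
      ultimately show ?thesis using a by (intro exI[of _ a]) (simp add: add.commute)
    qed
    then obtain t where t: "\<not> p dvd t" "\<not> p dvd a + t" "\<not> p dvd t + n" by blast
    obtain v b' c' m' where v: "act v (a, b, c, m) = (a, b', c', m')" "p dvd c' - t"
      using reach_mod_prime_rotated[OF p cone a t(2)] by blast
    have c': "[c' = t] (mod p)" using v(2) by (simp add: cong_iff_dvd_diff)
    then have "\<not> p dvd c'" "\<not> p dvd c' + n"
      using t cong_dvd_iff cong_add[OF c' cong_refl[of n]] by blast+
    moreover have "cone (a, b', c', m')" using cone_act[OF cone, of v] v(1) by simp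
    ultimately obtain w a'' b'' m'' where "act w (a, b', c', m') = (a'', b'', c', m'')" "p dvd b'' - n"
      using reach_mod_prime_third[OF p] by blast
    then show ?thesis using v(1) by (intro exI[of _ "v @ w"]) simp
  next
    case True
    \<comment> \<open>For p = 3 and n = -a, c is brought to 0, which reduces the cone relation to
      2m'^2 = ab' modulo 3.\<close>
    obtain v b' c' m' where v: "act v (a, b, c, m) = (a, b', c', m')" "p dvd c'"
      using reach_mod_prime_rotated[OF p cone a, of 0] a by auto
    have "2 * m'\<^sup>2 = a*b' + b'*c' + c'*a" using cone_act[OF cone, of v] v(1) by simp
    moreover have "p dvd b'*c' + c'*a" using v(2) by simp
    ultimately have h: "p dvd 2 * m'\<^sup>2 - a*b'" by simp
    show ?thesis
    proof (cases "p dvd b'")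
      case b': True
      then have "p dvd 2 * m'\<^sup>2 - a*b' + a*b'" using h by (intro dvd_add) auto
      then have "p dvd m'" using p2 mult by (simp add: power2_eq_square)
      \<comment> \<open>\<open>UB 1\<close> produces 2a modulo 3, which is -a and hence n; the term
        p*a = 3a turns -a into 2a.\<close>
      then have "p dvd b' + 4*m' + 2*c' + p*a" using b' v(2) by simp
      moreover have "p dvd n + a" using True by blast
      ultimately have "p dvd b' + 4*m' + 2*c' + p*a - (n + a)" by (rule dvd_diff)
      also have "b' + 4*m' + 2*c' + p*a - (n + a) = b' + 4*m' + 2*(a + c') - n" using True by simp
      finally show ?thesis using v(1) by (intro exI[of _ "v @ [UB 1]"]) simp
    next
      case False
      have "p dvd b' - n"
      proof -
        have *: "3 dvd n + a" "3 dvd 2 * m'\<^sup>2 - a*b'" "\<not> 3 dvd a" "\<not> 3 dvd b'" using True h a False by auto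
        \<comment> \<open>Otherwise b' = a, and 2m'^2 = a^2 = 1 modulo 3 would make 2 a square
          modulo 3.\<close>
        have "3 dvd b' + a"
        proof (rule ccontr)
          assume "\<not> 3 dvd b' + a"
          then have "3 dvd b' - a" using *(3,4) by presburger
          then have "3 dvd a * (b' - a)" by simp
          with *(2) have "3 dvd (2 * m'\<^sup>2 - a*b') + a * (b' - a)" by (rule dvd_add)
          then have d: "3 dvd 2 * m'\<^sup>2 - a\<^sup>2" by (simp add: power2_eq_square algebra_simps)
          define A M where "A = a\<^sup>2" and "M = m'\<^sup>2"
          have sq: "x\<^sup>2 mod 3 = (x mod 3)\<^sup>2 mod 3" for x :: int by (simp add: power_mod)
          have "a mod 3 = 1 \<or> a mod 3 = 2" using *(3) by presburger
          then have "A mod 3 = 1" unfolding A_def sq[of a] by auto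
          moreover have "m' mod 3 = 0 \<or> m' mod 3 = 1 \<or> m' mod 3 = 2" by presburger
          then have "M mod 3 = 0 \<or> M mod 3 = 1" unfolding M_def sq[of m'] by auto
          ultimately show False using d unfolding A_def[symmetric] M_def[symmetric] by presburger
        qed
        then have "3 dvd (b' + a) - (n + a)" using *(1) by (rule dvd_diff)
        then show ?thesis using True by simp
      qed
      then show ?thesis using v(1) by (intro exI[of _ v]) simp
    qed
  qed
qed

text \<open>If only b is a unit, the cone relation gives p | m, and \<open>UA 1\<close> turns a into
  2b modulo p, a unit. If c is a unit, a and c are exchanged.\<close>

lemma reach_mod_prime:
  assumes p: "prime p" "odd p" and cone: "cone s" and prim: "primitive_at p s"
  shows "\<exists>w. p dvd snd4 (act w s) - n"
proof -
  obtain a b c m where s: "s = (a, b, c, m)" by (cases s)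
  consider "\<not> p dvd a" | "p dvd a" "\<not> p dvd c" | "p dvd a" "p dvd c" "\<not> p dvd b" 
    using prim s by auto
  then show ?thesis
  proof cases
    case 1
    then show ?thesis using reach_mod_prime_first[OF p] cone s by blast
  next
    case 2
    have "cone (c, b, a, m)" using cone s by simp
    from reach_mod_prime_first[OF p this 2(2)]
    obtain w where w: "p dvd snd4 (act w (flip_state s)) - n" unfolding s by auto
    have "snd4 (flip_state t) = snd4 t" for t by (cases t) simp
    then show ?thesis using w flip_state_act[of w s] by metis
  next
    case 3
    note p2 = odd_prime_not_dvd_2[OF p]
    note mult = prime_dvd_mult_iff[OF p(1)]
    have "2 * m\<^sup>2 = a*b + b*c + c*a" using cone s by simp
    then have "p dvd 2 * m\<^sup>2" using 3 by simp
    then have m: "p dvd m" using p2 mult by (simp add: power2_eq_square)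
    have "\<not> p dvd a + 4*m + 2*(b + c)"
    proof
      assume "p dvd a + 4*m + 2*(b + c)"
      then have "p dvd (a + 4*m + 2*(b + c)) - (a + 4*m + 2*c)" using 3 m by (intro dvd_diff) auto
      then have "p dvd 2 * b" by simp
      then show False using 3 p2 mult by blast
    qed
    moreover have "cone (a + 4*m + 2*(b + c), b, c, m + (b + c))"
      using cone_step[OF cone, of "UA 1"] s by simp
    ultimately obtain w where "p dvd snd4 (act w (step (UA 1) s)) - n" 
      using reach_mod_prime_first[OF p] s by fastforce
    then show ?thesis by (intro exI[of _ "UA 1 # w"]) simp
  qed
qed

section \<open>Lifting to prime powers\<close>

lemma move_m_off_prime:
  assumes p: "prime p" "odd p" and cone: "cone (a, b, c, m)" and prim: "primitive_at p (a, b, c, m)"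
  shows "\<exists>w a' c' m'. act w (a, b, c, m) = (a', b, c', m') \<and> \<not> p dvd m'"
proof -
  note mult = prime_dvd_mult_iff[OF p(1)]
  consider "\<not> p dvd m" | "p dvd m" "\<not> p dvd b + c" | "p dvd m" "\<not> p dvd a + b"
    | "p dvd m" "p dvd b + c" "p dvd a + b" by blast
  then show ?thesis
  proof cases
    case 1
    then show ?thesis by (intro exI[of _ "[]"]) simp
  next
    case 2
    then show ?thesis by (intro exI[of _ "[UA 1]"]) (simp add: dvd_add_right_iff)
  next
    case 3
    then show ?thesis by (intro exI[of _ "[UC 1]"]) (simp add: dvd_add_right_iff)
  next
    \<comment> \<open>Neither \<open>UA 1\<close> nor \<open>UC 1\<close> changes m modulo p here;
      but b^2 = (a+b)(b+c) - 2m^2 then forces p to divide b, and with it a and c.\<close>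
    case 4
    have h: "2 * m\<^sup>2 = a*b + b*c + c*a" using cone by simp
    have "p dvd (a + b) * (b + c) - 2 * m\<^sup>2" using 4 by (simp add: power2_eq_square)
    also have "\<dots> = b * b" unfolding h by (simp add: algebra_simps)
    finally have "p dvd b" using mult by blast
    then have "p dvd a" "p dvd c" using 4 by (simp_all add: dvd_add_left_iff dvd_add_right_iff)
    then show ?thesis using \<open>p dvd b\<close> prim by simp
  qed
qed

text \<open>Hensel step: after m' has been made a unit without touching b,
  \<open>UB (p ^ Suc e * t)\<close> changes b by 4m't * p^(e+1) modulo p^(e+2). Starting at exponent
  1 keeps the quadratic term, divisible by p^(2e+2), out of the way.\<close>

lemma reach_mod_odd_prime_power:
  assumes p: "prime p" "odd p" and cone: "cone s" and prim: "primitive_at p s"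
  shows "\<exists>w. p ^ e dvd snd4 (act w s) - n"
proof -
  have "\<exists>w. p ^ Suc e dvd snd4 (act w s) - n"
  proof (induction e)
    case 0
    then show ?case using reach_mod_prime[OF assms] by simp
  next
    case (Suc e)
    then obtain w where w: "p ^ Suc e dvd snd4 (act w s) - n" by blast
    obtain a b c m where s': "act w s = (a, b, c, m)" by (cases "act w s")
    obtain v a' c' m' where v: "act v (act w s) = (a', b, c', m')" "\<not> p dvd m'"
      using move_m_off_prime[OF p, of a b c m] cone_act[OF cone, of w] primitive_at_act[OF p(1) cone prim, of w]
      unfolding s' by blast
    obtain r where r: "b - n = p ^ Suc e * r" using w s' by auto
    have "\<not> p dvd 2 * (2 * m')" using odd_prime_not_dvd_2[OF p] v(2) prime_dvd_mult_iff[OF p(1)] by blast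
    then obtain t where "p dvd 2 * (2 * m') * t - (- r)" using prime_linear_solvable[OF p(1)] by blast
    then have "p dvd r + 4 * m' * t" by (simp add: algebra_simps)
    then obtain y where y: "r + 4 * m' * t = p * y" by (elim dvdE)
    have "b + 4*m'*(p ^ Suc e * t) + 2*(a' + c')*(p ^ Suc e * t)\<^sup>2 - n
        = p ^ Suc e * (r + 4 * m' * t) + p ^ Suc e * p * (p ^ e * 2*(a' + c')*t\<^sup>2)"
      using r by (simp add: algebra_simps power2_eq_square)
    also have "\<dots> = p ^ Suc (Suc e) * (y + p ^ e * 2*(a' + c')*t\<^sup>2)"
      unfolding y by (simp add: algebra_simps)
    finally have "p ^ Suc (Suc e) dvd b + 4*m'*(p ^ Suc e * t) + 2*(a' + c')*(p ^ Suc e * t)\<^sup>2 - n"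
      by simp
    then show ?case using v(1) by (intro exI[of _ "w @ v @ [UB (p ^ Suc e * t)]"]) simp
  qed
  then obtain w where "p ^ Suc e dvd snd4 (act w s) - n" by blast
  then show ?thesis using power_le_dvd[of p "Suc e" _ e] by auto
qed

text \<open>The sum ab + bc + ca is odd as soon as two entries are odd, so exactly one of them
  is.\<close>

lemma cone_odd_sum:
  assumes "cone (a, b, c, m)" "primitive_at 2 (a, b, c, m)"
  shows "odd (a + b + c)"
proof -
  have "even (a*b + b*c + c*a)" using assms(1) by (metis cone.simps dvd_triv_left)
  then show ?thesis using assms(2) by auto
qed

text \<open>Since exactly one of a, b, c is odd, b+c or a+b is odd, and \<open>UA 1\<close> or
  \<open>UC 1\<close> flips the parity of m while fixing b.\<close>

lemma adjust_parity:
  assumes cone: "cone (a, b, c, m)" and prim: "primitive_at 2 (a, b, c, m)"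
  shows "\<exists>w a' c' m'. act w (a, b, c, m) = (a', b, c', m') \<and> (even m' \<longleftrightarrow> P)"
proof -
  have e: "even (a*b + b*c + c*a)" using cone by (metis cone.simps dvd_triv_left)
  consider "even m \<longleftrightarrow> P" | "even m \<noteq> P" "odd (b + c)" | "even m \<noteq> P" "odd (a + b)"
    using cone_odd_sum[OF assms] e by auto
  then show ?thesis
  proof cases
    case 1
    then show ?thesis by (intro exI[of _ "[]"]) simp
  next
    case 2
    then show ?thesis by (intro exI[of _ "[UA 1]"]) auto
  next
    case 3
    then show ?thesis by (intro exI[of _ "[UC 1]"]) auto
  qed
qed

lemma reach_mod_power_2:
  assumes cone: "cone s" and prim: "primitive_at 2 s" and n: "8 dvd snd4 s - n"
  shows "\<exists>w. 2 ^ e dvd snd4 (act w s) - n"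
proof -
  have "\<exists>w. 2 ^ (e + 3) dvd snd4 (act w s) - n"
  proof (induction e)
    case 0
    then show ?case using n by (intro exI[of _ "[]"]) simp
  next
    case (Suc e)
    then obtain w where w: "2 ^ (e + 3) dvd snd4 (act w s) - n" by blast
    obtain a b c m where s': "act w s = (a, b, c, m)" by (cases "act w s")
    have "prime (2::int)" by simp
    note ok = cone_act[OF cone, of w] primitive_at_act[OF this cone prim, of w]
    obtain v a' c' m' where v: "act v (act w s) = (a', b, c', m')" "even m' \<longleftrightarrow> even b \<and> e = 0"
      \<comment> \<open>The factor m' + 2^e * (a'+c') must be odd. For e > 0 this asks for m' odd;
        for e = 0 the parity of a'+c' is opposite to that of b, so m' must have the parity of
        b.\<close>
      using adjust_parity[of a b c m "even b \<and> e = 0"] ok unfolding s' by blast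
    have odd: "odd (a' + b + c')"
      using cone_odd_sum[of a' b c' m'] cone_act[OF cone, of "w @ v"]
        primitive_at_act[OF \<open>prime 2\<close> cone prim, of "w @ v"] v(1) by simp
    obtain r where r: "b - n = 2 ^ (e + 3) * r" using w s' by auto
    show ?case
    proof (cases "even r")
      case True
      then obtain k where "r = 2 * k" by (elim evenE)
      then have "b - n = 2 ^ (Suc e + 3) * k" unfolding r by (simp add: power_add)
      then have "2 ^ (Suc e + 3) dvd b - n" by simp
      then show ?thesis using s' by (intro exI[of _ w]) simp
    next
      case False
      have "even (r + (m' + 2 ^ e * (a' + c')))"
        using False v(2) odd by (cases "e = 0") auto
      then obtain k where k: "r + (m' + 2 ^ e * (a' + c')) = 2 * k" by (elim evenE)
      have "2 ^ (Suc e + 3) dvd 2 ^ (e + 3) * (r + (m' + 2 ^ e * (a' + c')))"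
        unfolding k by (simp add: power_add)
      also have "\<dots> = b + 4*m'*2 ^ (e + 1) + 2*(a' + c')*(2 ^ (e + 1))\<^sup>2 - n"
        using r by (simp add: algebra_simps power2_eq_square power_add)
      finally show ?thesis using v(1) by (intro exI[of _ "w @ v @ [UB (2 ^ (e + 1))]"]) simp
    qed
  qed
  then obtain w where "2 ^ (e + 3) dvd snd4 (act w s) - n" by blast
  then show ?thesis using power_le_dvd[of 2 "e + 3" _ e] by auto
qed

text \<open>Induction that splits off the full power of one prime from \<open>q\<close>; the
  hypothesis modulo 8 enters through the prime 2.\<close>

lemma reach_mod:
  assumes cone: "cone s" and prim: "\<And>p. prime p \<Longrightarrow> primitive_at p s" and n: "8 dvd snd4 s - n"
    and "q > 0"
  shows "\<exists>w. [snd4 (act w s) = n] (mod int q)"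
  using \<open>q > 0\<close>
proof (induction q rule: less_induct)
  case (less q)
  show ?case
  proof (cases "q = 1")
    case True
    then show ?thesis by simp
  next
    case False
    then obtain p where p: "prime p" "p dvd q" using prime_factor_nat by blast
    obtain r where r: "q = p ^ multiplicity p q * r" "\<not> p dvd r"
      using multiplicity_decompose'[of q p] less.prems p by (metis neq0_conv not_prime_unit)
    let ?e = "multiplicity p q"
    have "?e > 0" using p less.prems by (simp add: prime_multiplicity_gt_zero_iff)
    then have "p ^ ?e > 1" using p(1) prime_gt_1_nat by (metis one_less_power)
    moreover have "r > 0" using r(1) less.prems by (metis mult_0_right neq0_conv)
    ultimately have "1 * r < p ^ ?e * r" by (intro mult_strict_right_mono)
    then have "r < q" unfolding r(1)[symmetric] by simp
    then obtain w where w: "[snd4 (act w s) = n] (mod int r)" using less.IH \<open>r > 0\<close> by blast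
    have "\<exists>v. int p ^ ?e dvd snd4 (act v s) - n"
    proof (cases "p = 2")
      case True
      then show ?thesis using reach_mod_power_2[OF cone prim n] by simp
    next
      case False
      then have "odd (int p)" using p(1) by (metis even_of_nat primes_dvd_imp_eq two_is_prime_nat)
      then show ?thesis using reach_mod_odd_prime_power[OF _ _ cone prim] p(1) by simp
    qed
    then obtain v where v: "[snd4 (act v s) = n] (mod int p ^ ?e)" by (auto simp: cong_iff_dvd_diff)
    have "coprime (p ^ ?e) r" using p(1) r(2) by (simp add: prime_imp_coprime)
    then have "coprime (int p ^ ?e) (int r)" by (metis coprime_int_iff of_nat_power)
    moreover have "int p ^ ?e * int r = int q"
      unfolding of_nat_power[symmetric] of_nat_mult[symmetric] r(1)[symmetric] ..
    ultimately show ?thesis using reach_coprime[OF _ v w] by simp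
  qed
qed

section \<open>Lorentz geometry of circles\<close>

text \<open>\<open>(k, u, l)\<close> stands for the generalized circle \<open>k |z|\<^sup>2 - 2 u \<bullet> z + l = 0\<close> whose inner side is where
  the left-hand side is negative.\<close>

type_synonym cvec = "real \<times> complex \<times> real"

text \<open>Polarization of |u|^2 - k*l. For circles of radii r, s and centre distance d it equals
  (r^2 + s^2 - d^2)/(2rs): it is -1 at external tangency and below -1 for separate discs.\<close>

definition lor :: "cvec \<Rightarrow> cvec \<Rightarrow> real" where
  "lor V W = fst (snd V) \<bullet> fst (snd W) - (fst V * snd (snd W) + snd (snd V) * fst W) / 2"

lemma lor_commute: "lor V W = lor W V"
  by (simp add: lor_def inner_commute)

lemma lor_add_left: "lor (U + V) W = lor U W + lor V W"
  by (simp add: lor_def inner_add_left field_simps)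

lemma lor_add_right: "lor W (U + V) = lor W U + lor W V"
  by (simp add: lor_def inner_add_right field_simps)

lemma lor_scaleR_left: "lor (c *\<^sub>R V) W = c * lor V W"
  by (simp add: lor_def field_simps)

lemma lor_scaleR_right: "lor W (c *\<^sub>R V) = c * lor W V"
  by (simp add: lor_def field_simps)

lemma lor_minus_left: "lor (- V) W = - lor V W"
  by (simp add: lor_def field_simps)

lemma lor_minus_right: "lor W (- V) = - lor W V"
  by (simp add: lor_def field_simps)

lemma lor_diff_left: "lor (U - V) W = lor U W - lor V W"
  by (simp add: lor_def inner_diff_left field_simps)

lemma lor_diff_right: "lor W (U - V) = lor W U - lor W V"
  by (simp add: lor_def inner_diff_right field_simps)

lemmas lor_simps = lor_add_left lor_add_right lor_scaleR_left lor_scaleR_right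
  lor_minus_left lor_minus_right lor_diff_left lor_diff_right

lemma lor_self: "lor V V = (norm (fst (snd V)))\<^sup>2 - fst V * snd (snd V)"
  by (simp add: lor_def power2_norm_eq_inner)

text \<open>If \<open>lor V V\<close> <= 0, the outer entries cannot have opposite signs; this
  selects the half of the cone that contains the vectors (1, z, |z|^2) of points. A future sum of
  two circle vectors expresses that the inner sides do not overlap.\<close>

definition future :: "cvec \<Rightarrow> bool" where
  "future V \<longleftrightarrow> fst V \<ge> 0 \<and> snd (snd V) \<ge> 0"

text \<open>Reversed Cauchy-Schwarz inequality: |v||w| is at most the geometric mean of v0*w1 and
  v1*w0, hence at most their arithmetic mean.\<close>

lemma lor_nonpos:
  assumes V: "lor V V \<le> 0" "future V" and W: "lor W W \<le> 0" "future W"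
  shows "lor V W \<le> 0"
proof -
  obtain v0 v v1 w0 w w1 where [simp]: "V = (v0, v, v1)" "W = (w0, w, w1)" by (cases V; cases W)
  have v: "(norm v)\<^sup>2 \<le> v0 * v1" "v0 \<ge> 0" "v1 \<ge> 0" using V by (auto simp: lor_self future_def)
  have w: "(norm w)\<^sup>2 \<le> w0 * w1" "w0 \<ge> 0" "w1 \<ge> 0" using W by (auto simp: lor_self future_def)
  have "(norm v * norm w)\<^sup>2 \<le> (v0 * v1) * (w0 * w1)"
    unfolding power_mult_distrib using v w by (intro mult_mono) auto
  also have "\<dots> = ((v0 * w1 + v1 * w0) / 2)\<^sup>2 - ((v0 * w1 - v1 * w0) / 2)\<^sup>2"
    by (simp add: power2_eq_square field_simps)
  also have "\<dots> \<le> ((v0 * w1 + v1 * w0) / 2)\<^sup>2" by simp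
  finally have "norm v * norm w \<le> (v0 * w1 + v1 * w0) / 2"
    by (rule power2_le_imp_le) (use v w in auto)
  then show ?thesis using norm_cauchy_schwarz[of v w] by (simp add: lor_def)
qed

lemma futureI:
  assumes V: "lor V V \<le> 0" and W: "lor W W \<le> 0" "future W" and VW: "lor V W < 0"
  shows "future V"
proof (rule ccontr)
  assume n: "\<not> future V"
  have "fst V * snd (snd V) \<ge> 0" using V lor_self[of V] by (smt (verit) zero_le_power2)
  then have "future (- V)" using n by (auto simp: future_def zero_le_mult_iff)
  then show False using lor_nonpos[of "- V" W] V W VW by (simp add: lor_simps)
qed

text \<open>In signature (3,1) the complement of a timelike vector is positive definite. Multiplying
  by u0^2 exhibits the value as a sum of two nonnegative terms.\<close>

lemma lor_timelike_complement:
  assumes U: "lor U U < 0" and UV: "lor U V = 0" and "V \<noteq> 0"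
  shows "lor V V > 0"
proof -
  obtain u0 u u1 v0 v v1 where [simp]: "U = (u0, u, u1)" "V = (v0, v, v1)" by (cases U; cases V)
  have u: "(norm u)\<^sup>2 < u0 * u1" using U by (simp add: lor_self)
  then have u0: "u0 \<noteq> 0" by auto
  have uv: "u0 * v1 = 2 * (u \<bullet> v) - u1 * v0" using UV by (simp add: lor_def)
  have norm: "(norm (u0 *\<^sub>R v - v0 *\<^sub>R u))\<^sup>2
      = u0\<^sup>2 * (norm v)\<^sup>2 - 2 * u0 * v0 * (u \<bullet> v) + v0\<^sup>2 * (norm u)\<^sup>2"
    unfolding power2_norm_eq_inner
    by (simp add: inner_diff_left inner_diff_right inner_commute power2_eq_square algebra_simps)
  have "u0\<^sup>2 * lor V V = u0\<^sup>2 * (norm v)\<^sup>2 - u0 * v0 * (u0 * v1)"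
    by (simp add: lor_self power2_eq_square algebra_simps)
  also have "\<dots> = (norm (u0 *\<^sub>R v - v0 *\<^sub>R u))\<^sup>2 + v0\<^sup>2 * (u0 * u1 - (norm u)\<^sup>2)"
    unfolding uv norm by (simp add: power2_eq_square algebra_simps)
  finally have eq: "u0\<^sup>2 * lor V V = (norm (u0 *\<^sub>R v - v0 *\<^sub>R u))\<^sup>2 + v0\<^sup>2 * (u0 * u1 - (norm u)\<^sup>2)" .
  show ?thesis
  proof (rule ccontr)
    assume "\<not> ?thesis"
    then have "u0\<^sup>2 * lor V V \<le> 0" by (simp add: mult_nonneg_nonpos)
    moreover have "v0\<^sup>2 * (u0 * u1 - (norm u)\<^sup>2) \<ge> 0" using u by simp
    ultimately have "(norm (u0 *\<^sub>R v - v0 *\<^sub>R u))\<^sup>2 = 0" "v0\<^sup>2 * (u0 * u1 - (norm u)\<^sup>2) = 0"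
      using eq zero_le_power2[of "norm (u0 *\<^sub>R v - v0 *\<^sub>R u)"] by linarith+
    then have "v0 = 0" "v = 0" using u u0 by auto
    moreover then have "v1 = 0" using uv u0 by simp
    ultimately show False using \<open>V \<noteq> 0\<close> by (simp add: zero_prod_def)
  qed
qed

text \<open>The left-hand side of the circle equation, written as a pairing with the null vector of
  the point \<open>z\<close>, so that signs on the plane follow from Lorentz inequalities.\<close>

definition ev :: "cvec \<Rightarrow> complex \<Rightarrow> real" where
  "ev V z = - 2 * lor V (1, z, (norm z)\<^sup>2)"

lemma ev_eq: "ev V z = fst V * (norm z)\<^sup>2 - 2 * (fst (snd V) \<bullet> z) + snd (snd V)"
  by (simp add: ev_def lor_def)

lemma ev_add: "ev (V + W) z = ev V z + ev W z"
  by (simp add: ev_def lor_simps)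

lemma ev_nonneg: "lor V V \<le> 0 \<Longrightarrow> future V \<Longrightarrow> ev V z \<ge> 0"
  using lor_nonpos[of V "(1, z, (norm z)\<^sup>2)"] by (simp add: ev_def lor_self future_def)

lemma ev_pos:
  assumes "lor V V < 0" "future V"
  shows "ev V z > 0"
proof (rule ccontr)
  assume "\<not> ?thesis"
  then have "lor V (1, z, (norm z)\<^sup>2) = 0" using ev_nonneg[of V z] assms by (simp add: ev_def)
  from lor_timelike_complement[OF assms(1) this] show False by (simp add: lor_self zero_prod_def)
qed

text \<open>The value 1/2 for \<open>lor M M\<close> makes the inscribed circles integer
  combinations of the frame and gives the cone relation its factor 2. The \<open>future\<close>
  conditions exclude the triple with all orientations reversed, which has the same products.\<close>

definition frame :: "cvec \<Rightarrow> cvec \<Rightarrow> cvec \<Rightarrow> cvec \<Rightarrow> bool" where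
  "frame P Q R M \<longleftrightarrow> lor P P = 1 \<and> lor Q Q = 1 \<and> lor R R = 1 \<and>
     lor P Q = -1 \<and> lor Q R = -1 \<and> lor R P = -1 \<and>
     future (P + Q) \<and> future (Q + R) \<and> future (R + P) \<and>
     lor M P = 0 \<and> lor M Q = 0 \<and> lor M R = 0 \<and> lor M M = 1 / 2"

lemma frame_rotate: "frame P Q R M \<Longrightarrow> frame Q R P M"
  by (auto simp: frame_def)

lemma frame_swap: "frame P Q R M \<Longrightarrow> frame Q P R M"
  by (auto simp: frame_def lor_commute add.commute)

lemma frame_minus: "frame P Q R M \<Longrightarrow> frame P Q R (- M)"
  by (auto simp: frame_def lor_simps)

lemma frame_products:
  assumes "frame P Q R M"
  shows "lor P P = 1" "lor Q Q = 1" "lor R R = 1" "lor P Q = -1" "lor Q P = -1"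
    "lor Q R = -1" "lor R Q = -1" "lor R P = -1" "lor P R = -1"
    "lor M P = 0" "lor M Q = 0" "lor M R = 0" "lor P M = 0" "lor Q M = 0" "lor R M = 0" "lor M M = 1 / 2"
  using assms by (auto simp: frame_def lor_commute)

text \<open>The four products are packed into a \<open>cvec\<close> to obtain an endomorphism of a
  finite-dimensional space, where injectivity and surjectivity are equivalent.\<close>

lemma linear_products: "linear (\<lambda>V. (lor V P, Complex (lor V Q) (lor V R), lor V M) :: cvec)"
  by (rule linearI) (auto simp: lor_simps complex_eq_iff)

text \<open>The coefficients come from the inverse of the Gram matrix \<open>2I - J\<close> of \<open>P, Q, R\<close>, which is
  \<open>(I - J)/2\<close>.\<close>

lemma frame_expand:
  assumes F: "frame P Q R M"
  shows "V = (- (lor V Q + lor V R) / 2) *\<^sub>R P + (- (lor V P + lor V R) / 2) *\<^sub>R Q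
           + (- (lor V P + lor V Q) / 2) *\<^sub>R R + (2 * lor V M) *\<^sub>R M" (is "V = ?E V")
proof -
  let ?f = "\<lambda>V. (lor V P, Complex (lor V Q) (lor V R), lor V M) :: cvec"
  have pr: "lor (x *\<^sub>R P + y *\<^sub>R Q + z *\<^sub>R R + w *\<^sub>R M) P = x - y - z"
    "lor (x *\<^sub>R P + y *\<^sub>R Q + z *\<^sub>R R + w *\<^sub>R M) Q = y - x - z"
    "lor (x *\<^sub>R P + y *\<^sub>R Q + z *\<^sub>R R + w *\<^sub>R M) R = z - x - y"
    "lor (x *\<^sub>R P + y *\<^sub>R Q + z *\<^sub>R R + w *\<^sub>R M) M = w / 2" for x y z w
    using frame_products[OF F] by (simp_all add: lor_simps)
  have "surj ?f"
  proof (rule surjI)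
    fix U :: cvec
    obtain x c w where U: "U = (x, c, w)" by (cases U)
    let ?V = "(- (Re c + Im c) / 2) *\<^sub>R P + (- (x + Im c) / 2) *\<^sub>R Q + (- (x + Re c) / 2) *\<^sub>R R + (2 * w) *\<^sub>R M"
    show "?f ((\<lambda>U. (- (Re (fst (snd U)) + Im (fst (snd U))) / 2) *\<^sub>R P + (- (fst U + Im (fst (snd U))) / 2) *\<^sub>R Q
      + (- (fst U + Re (fst (snd U))) / 2) *\<^sub>R R + (2 * snd (snd U)) *\<^sub>R M) U) = U"
      unfolding pr U by (simp add: complex_eq_iff field_simps)
  qed
  then have "inj ?f"
    by (rule linear_surj_imp_inj[OF linear_products])
  moreover have "?f V = ?f (?E V)"
    unfolding pr by (simp add: field_simps)
  ultimately show ?thesis by (rule injD)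
qed

lemma frame_lor:
  assumes F: "frame P Q R M"
  shows "lor V W = 2 * lor V M * lor W M - ((lor V Q + lor V R) * lor W P
           + (lor V P + lor V R) * lor W Q + (lor V P + lor V Q) * lor W R) / 2"
proof -
  have "lor V W = lor ((- (lor V Q + lor V R) / 2) *\<^sub>R P + (- (lor V P + lor V R) / 2) *\<^sub>R Q
           + (- (lor V P + lor V Q) / 2) *\<^sub>R R + (2 * lor V M) *\<^sub>R M) W"
    by (rule arg_cong[OF frame_expand[OF F]])
  then show ?thesis by (simp add: lor_simps lor_commute field_simps)
qed

text \<open>The common source of the quadratic relations: for the null vector of infinity it is the
  cone relation of curvatures, for that of a point it is \<open>frame_ev\<close>, for a unit vector
  it bounds or determines the height over the frame.\<close>

lemma frame_lor_self:
  assumes "frame P Q R M"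
  shows "lor V V = 2 * (lor V M)\<^sup>2 - (lor V P * lor V Q + lor V Q * lor V R + lor V R * lor V P)"
  using frame_lor[OF assms, of V V] by (simp add: power2_eq_square field_simps)

text \<open>The complement of the span is a line; the two normals belong to the two gaps of the
  triple.\<close>

lemma frame_normal_unique:
  assumes F: "frame P Q R M" and G: "frame P Q R N"
  shows "N = M \<or> N = - M"
proof -
  have 0: "lor N P = 0" "lor N Q = 0" "lor N R = 0" "lor N N = 1 / 2"
    using frame_products[OF G] by auto
  define c where c: "c = 2 * lor N M"
  have "N = c *\<^sub>R M" using frame_expand[OF F, of N] unfolding c 0 by simp
  moreover have "c\<^sup>2 = 1\<^sup>2"
    using frame_lor_self[OF F, of N] 0 by (simp add: c power2_eq_square)
  then have "c = 1 \<or> c = - 1" by (simp only: power2_eq_iff)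
  ultimately show ?thesis by auto
qed

text \<open>With 0 in place of \<open>M\<close> the product map is not surjective, hence has a
  kernel vector, orthogonal to P, Q, R. It is orthogonal to the timelike P+Q+R, so it is spacelike
  and can be scaled to 1/2.\<close>

lemma frame_exists:
  assumes "lor P P = 1" "lor Q Q = 1" "lor R R = 1" "lor P Q = -1" "lor Q R = -1" "lor R P = -1"
    "future (P + Q)" "future (Q + R)" "future (R + P)"
  shows "\<exists>M. frame P Q R M"
proof -
  let ?f = "\<lambda>V. (lor V P, Complex (lor V Q) (lor V R), lor V 0) :: cvec"
  have z: "lor V 0 = 0" for V by (simp add: lor_def)
  have "\<not> surj ?f"
  proof
    assume "surj ?f"
    then obtain V where "(0, 0, 1) = ?f V" by (rule surjE)
    then show False by (simp add: z)
  qed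
  then have "\<not> inj ?f" using linear_inj_imp_surj[OF linear_products] by blast
  then obtain U V where UV: "U \<noteq> V" "?f U = ?f V" unfolding inj_def by blast
  let ?N = "U - V"
  have N: "lor ?N P = 0" "lor ?N Q = 0" "lor ?N R = 0" "?N \<noteq> 0"
    using UV by (auto simp: lor_simps)
  have "lor (P + Q + R) (P + Q + R) < 0"
    using assms by (simp add: lor_simps lor_commute)
  moreover have "lor (P + Q + R) ?N = 0"
    
    using N(1-3) lor_add_right[of ?N "P + Q" R] lor_add_right[of ?N P Q] lor_commute[of "P + Q + R" ?N] by linarith
  ultimately have pos: "lor ?N ?N > 0" using lor_timelike_complement N by blast
  let ?c = "1 / sqrt (2 * lor ?N ?N)"
  have "lor (?c *\<^sub>R ?N) (?c *\<^sub>R ?N) = ?c\<^sup>2 * lor ?N ?N"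
    by (simp add: lor_scaleR_left lor_scaleR_right power2_eq_square)
  also have "\<dots> = 1 / 2" using pos by (simp add: power_divide)
  finally have "frame P Q R (?c *\<^sub>R ?N)"
    using assms N by (simp add: frame_def lor_scaleR_left)
  then show ?thesis ..
qed

definition opp :: "cvec \<Rightarrow> cvec \<Rightarrow> cvec \<Rightarrow> cvec \<Rightarrow> cvec" where
  "opp P Q R M = P + 2 *\<^sub>R (Q + R) + 4 *\<^sub>R M"

definition sext :: "cvec \<Rightarrow> cvec \<Rightarrow> cvec \<Rightarrow> cvec \<Rightarrow> cvec set" where
  "sext P Q R M = {P, Q, R, opp P Q R M, opp Q R P M, opp R P Q M}"

lemma opp_swap: "opp P R Q M = opp P Q R M"
  by (simp add: opp_def add.commute)

lemma sext_rotate: "sext Q R P M = sext P Q R M"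
  by (auto simp: sext_def)

lemma sext_swap: "sext Q P R M = sext P Q R M"
  by (auto simp: sext_def opp_swap)

lemma lor_opp: "lor V (opp P Q R M) = lor V P + 2 * (lor V Q + lor V R) + 4 * lor V M"
  by (simp add: opp_def lor_simps)

lemma lor_opp_left: "lor (opp P Q R M) V = lor P V + 2 * (lor Q V + lor R V) + 4 * lor M V"
  by (simp add: opp_def lor_simps)

lemma opp_products:
  assumes "frame P Q R M"
  shows "lor (opp P Q R M) (opp P Q R M) = 1" "lor (opp P Q R M) P = -3"
    "lor (opp P Q R M) Q = -1" "lor (opp P Q R M) R = -1" "lor (opp P Q R M) M = 2"
    "lor (opp P Q R M) (opp Q R P M) = -1" "lor (opp P Q R M) (opp R P Q M) = -1"
  using frame_products[OF assms] by (simp_all add: lor_opp lor_opp_left)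

lemma sext_products:
  assumes F: "frame P Q R M" and "X \<in> sext P Q R M" "Y \<in> sext P Q R M"
  shows "lor X Y \<in> {1, -1, -3}" "lor X Y = 1 \<Longrightarrow> X = Y"
  using assms(2,3) frame_products[OF F] opp_products[OF F]
    opp_products[OF frame_rotate[OF F]] opp_products[OF frame_rotate[OF frame_rotate[OF F]]]
  by (auto simp: sext_def lor_commute)

section \<open>Growth of a configuration\<close>

text \<open>The circles inscribed in the gap of the frame have positive product with \<open>M\<close>, so all circles
  of \<open>S\<close> except \<open>P, Q, R\<close> lie on the other side of the circle \<open>M\<close> through the tangency points.\<close>

definition vacant :: "cvec set \<Rightarrow> cvec \<Rightarrow> cvec \<Rightarrow> cvec \<Rightarrow> cvec \<Rightarrow> bool" where
  "vacant S P Q R M \<longleftrightarrow> P \<in> S \<and> Q \<in> S \<and> R \<in> S \<and> frame P Q R M \<and> (\<forall>X\<in>S - {P, Q, R}. lor X M < 0)"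

text \<open>Algebraic counterpart of one stage of the packing, with all vacant sides filled at once;
  \<open>stage_Suc_grow\<close> proves the agreement.\<close>

definition grow :: "cvec set \<Rightarrow> cvec set" where
  "grow S = S \<union> {E. \<exists>P Q R M. vacant S P Q R M \<and> E \<in> sext P Q R M}"

lemma vacantD:
  assumes "vacant S P Q R M"
  shows "frame P Q R M" "P \<in> S" "Q \<in> S" "R \<in> S"
    "\<And>X. X \<in> S \<Longrightarrow> X \<noteq> P \<Longrightarrow> X \<noteq> Q \<Longrightarrow> X \<noteq> R \<Longrightarrow> lor X M < 0"
  using assms unfolding vacant_def by blast+

lemma vacant_rotate: "vacant S P Q R M \<Longrightarrow> vacant S Q R P M"
  unfolding vacant_def using frame_rotate by blast

lemma sext_subset_grow: "vacant S P Q R M \<Longrightarrow> sext P Q R M \<subseteq> grow S"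
  unfolding grow_def by blast

lemma growE:
  assumes "X \<in> grow S"
  obtains "X \<in> S" | P Q R M where "vacant S P Q R M" "X \<in> sext P Q R M"
  using assms unfolding grow_def by blast

lemma sextE:
  assumes "X \<in> sext P Q R M"
  obtains "X = P" | "X = Q" | "X = R" | "X = opp P Q R M" | "X = opp Q R P M" | "X = opp R P Q M"
  using assms unfolding sext_def by blast

lemma not_sextD:
  assumes "X \<notin> sext P Q R M"
  shows "X \<noteq> P" "X \<noteq> Q" "X \<noteq> R"
  using assms unfolding sext_def by blast+

lemma triple_perm:
  assumes "{P, Q, R} = {A, B, C}" "P \<noteq> Q" "Q \<noteq> R" "P \<noteq> R"
  shows "P = A \<and> Q = B \<and> R = C \<or> P = A \<and> Q = C \<and> R = B \<or> P = B \<and> Q = A \<and> R = C \<or>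
    P = B \<and> Q = C \<and> R = A \<or> P = C \<and> Q = A \<and> R = B \<or> P = C \<and> Q = B \<and> R = A"
proof -
  have "P \<in> {A, B, C}" "Q \<in> {A, B, C}" "R \<in> {A, B, C}" using assms(1) by blast+
  then show ?thesis using assms by simp blast
qed

lemma frame_distinct:
  assumes "frame P Q R M"
  shows "P \<noteq> Q" "Q \<noteq> R" "P \<noteq> R"
  using frame_products[OF assms] by (metis one_neq_neg_one)+

lemma scaleR_4: "4 *\<^sub>R (V :: 'a :: real_vector) = V + V + V + V"
proof -
  have "4 *\<^sub>R V = 2 *\<^sub>R (2 *\<^sub>R V)" by simp
  then show ?thesis by (simp only: scaleR_2 add.assoc)
qed

text \<open>What every stage satisfies: inner sides do not overlap (\<open>sep\<close>,
  \<open>fut\<close>), and each side of each tangent triple is either filled or empty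
  (\<open>dichotomy\<close>). A half-filled side would break the correspondence with topological
  gaps.\<close>

locale config =
  fixes S :: "cvec set"
  assumes unit: "X \<in> S \<Longrightarrow> lor X X = 1"
    and sep: "X \<in> S \<Longrightarrow> Y \<in> S \<Longrightarrow> X \<noteq> Y \<Longrightarrow> lor X Y \<le> -1"
    and fut: "X \<in> S \<Longrightarrow> Y \<in> S \<Longrightarrow> X \<noteq> Y \<Longrightarrow> future (X + Y)"
    and dichotomy: "P \<in> S \<Longrightarrow> Q \<in> S \<Longrightarrow> R \<in> S \<Longrightarrow> frame P Q R M \<Longrightarrow>
      sext P Q R M \<subseteq> S \<or> vacant S P Q R M"
begin

lemma vacant_nonneg:
  assumes "vacant S P Q R M" "X \<in> S"
  shows "lor X M \<le> 0"
proof (cases "X = P \<or> X = Q \<or> X = R")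
  case True
  then show ?thesis using frame_products(13-15)[OF vacantD(1)[OF assms(1)]] by (elim disjE) simp_all
next
  case False
  then show ?thesis using vacantD(5)[OF assms] by simp
qed

lemma vacant_same_triple:
  assumes "{P, Q, R} = {A, B, C}" "frame P Q R M" "frame A B C N"
  shows "N = M \<or> N = - M"
proof -
  have "frame P Q R N"
    using triple_perm[OF assms(1) frame_distinct[OF assms(2)]] assms(3) frame_rotate frame_swap by metis
  then show ?thesis using frame_normal_unique[OF assms(2)] by blast
qed

text \<open>Expanding the normal \<open>M\<close> in the frame \<open>A, B, C, N\<close>: if \<open>lor M N\<close> were positive, pairing with a
  vertex of the first triple outside the second would give a nonzero value.\<close>

lemma vacant_normals:
  assumes V: "vacant S P Q R M" and W: "vacant S A B C N" and ne: "{P, Q, R} \<noteq> {A, B, C}"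
  shows "lor M N \<le> - 1 / 2"
proof -
  note F = vacantD(1)[OF V] and G = vacantD(1)[OF W]
  have M: "lor M A \<le> 0" "lor M B \<le> 0" "lor M C \<le> 0"
    using vacant_nonneg[OF V] vacantD[OF W] lor_commute[of M] by metis+
  have "card {P, Q, R} = 3" "card {A, B, C} = 3"
    using frame_distinct[OF F] frame_distinct[OF G] by simp_all
  then have "\<not> {P, Q, R} \<subseteq> {A, B, C}"
    using ne card_seteq[of "{A, B, C}" "{P, Q, R}"] by fastforce
  then obtain X where X: "X \<in> {P, Q, R}" "X \<notin> {A, B, C}" by blast
  have XS: "X \<in> S" and X0: "lor M X = 0" 
    using X(1) vacantD(2-4)[OF V] frame_products(10-12)[OF F] by blast+
  have x: "lor X A \<le> -1" "lor X B \<le> -1" "lor X C \<le> -1" "lor X N < 0"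
    using sep[OF XS] vacantD(2-4)[OF W] vacantD(5)[OF W XS] X(2) by blast+
  have "(lor M N)\<^sup>2 = 1 / 4 + (lor M A * lor M B + lor M B * lor M C + lor M C * lor M A) / 2"
    using frame_lor_self[OF G, of M] frame_products(16)[OF F] by argo
  moreover have "lor M A * lor M B \<ge> 0" "lor M B * lor M C \<ge> 0" "lor M C * lor M A \<ge> 0"
    using M by (auto intro: mult_nonpos_nonpos)
  ultimately have sq: "(lor M N)\<^sup>2 \<ge> (1 / 2)\<^sup>2" by (simp add: power2_eq_square)
  have "\<not> lor M N > 0"
  proof
    assume pos: "lor M N > 0"
    have "2 * lor M N * lor X N < 0" using pos x(4) by (simp add: mult_pos_neg)
    moreover have "(lor M B + lor M C) * lor X A \<ge> 0" "(lor M A + lor M C) * lor X B \<ge> 0"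
      "(lor M A + lor M B) * lor X C \<ge> 0"
      using M x by (auto intro!: mult_nonpos_nonpos)
    ultimately show False using frame_lor[OF G, of M X] X0 by argo
  qed
  then show ?thesis using power2_le_imp_le[of "1/2" "- lor M N"] sq by simp
qed

text \<open>A new circle is a combination of A, B, C and N with positive coefficients; A, B, C pair
  nonpositively with M, and \<open>lor N M\<close> <= -1/2 makes the result negative. For the same
  triple, N = M would put Y into the excluded octahedron, so N = -M.\<close>

lemma grow_side:
  assumes V: "vacant S P Q R M" and Y: "Y \<in> grow S" "Y \<notin> sext P Q R M"
  shows "lor Y M < 0"
proof (cases "Y \<in> S")
  case True
  then show ?thesis using vacantD(5)[OF V] not_sextD[OF Y(2)] by blast
next
  case False
  then obtain A B C N where W: "vacant S A B C N" "Y \<in> sext A B C N" using Y(1) by (elim growE) blast+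
  note F = vacantD(1)[OF V] and G = vacantD(1)[OF W(1)]
  have N: "lor N M \<le> - 1 / 2"
  proof (cases "{P, Q, R} = {A, B, C}")
    case True
    have "N \<noteq> M"
    proof
      assume "N = M"
      then have "sext P Q R M = sext A B C N"
        using triple_perm[OF True frame_distinct[OF F]] sext_rotate sext_swap by metis
      then show False using W(2) Y(2) by simp
    qed
    then have "N = - M" using vacant_same_triple[OF True F G] by blast
    then show ?thesis using frame_products[OF F] by (simp add: lor_simps)
  next
    case False
    then show ?thesis using vacant_normals[OF V W(1)] by (simp add: lor_commute)
  qed
  have abc: "lor A M \<le> 0" "lor B M \<le> 0" "lor C M \<le> 0"
    using vacant_nonneg[OF V] vacantD(2-4)[OF W(1)] by blast+
  from W(2) show ?thesis
    by (rule sextE) (use abc N False vacantD(2-4)[OF W(1)] in \<open>simp_all add: lor_opp_left\<close>)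
qed

lemma opp_old:
  assumes V: "vacant S P Q R M" and X: "X \<in> S"
  shows "lor (opp P Q R M) X \<le> -1"
proof (cases "X = P \<or> X = Q \<or> X = R")
  case True
  then show ?thesis using opp_products(2-4)[OF vacantD(1)[OF V]] by (elim disjE) simp_all
next
  case False
  then have "lor X P \<le> -1" "lor X Q \<le> -1" "lor X R \<le> -1" "lor X M < 0"

    using sep[OF X] vacantD[OF V] X by blast+
  then show ?thesis unfolding lor_commute[of "opp P Q R M" X] lor_opp by argo
qed

lemma sext_old:
  assumes V: "vacant S P Q R M" and E: "E \<in> sext P Q R M" and X: "X \<in> S" and "X \<noteq> E"
  shows "lor E X \<le> -1"
  using E
  by (rule sextE) (use opp_old[OF V X] opp_old[OF vacant_rotate[OF V] X]
    opp_old[OF vacant_rotate[OF vacant_rotate[OF V]] X] sep[OF _ X] \<open>X \<noteq> E\<close> vacantD(2-4)[OF V]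
    in blast)+

lemma grow_old:
  assumes "E \<in> grow S" "X \<in> S" "X \<noteq> E"
  shows "lor E X \<le> -1"
  using assms(1) by (rule growE) (use assms sep[of E X] sext_old in blast)+

text \<open>The strictness matters: a new circle has no tangency outside its own octahedron, which
  is how \<open>grow_frame_new\<close> locates the other two vertices of a new triple.\<close>

lemma opp_far:
  assumes V: "vacant S P Q R M" and Y: "Y \<in> grow S" "Y \<notin> sext P Q R M"
  shows "lor (opp P Q R M) Y < -1"
proof -
  have "lor Y P \<le> -1" "lor Y Q \<le> -1" "lor Y R \<le> -1"

    using grow_old[OF Y(1)] vacantD(2-4)[OF V] not_sextD[OF Y(2)] by metis+
  then show ?thesis
    using grow_side[OF assms] unfolding lor_commute[of "opp P Q R M" Y] lor_opp by argo
qed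

lemma sext_new_far:
  assumes V: "vacant S P Q R M" and E: "E \<in> sext P Q R M" "E \<notin> S"
    and Y: "Y \<in> grow S" "Y \<notin> sext P Q R M"
  shows "lor E Y < -1"
proof -
  have V2: "vacant S Q R P M" and V3: "vacant S R P Q M"
    using V vacant_rotate by blast+
  have *: "lor (opp P Q R M) Y < -1" "lor (opp Q R P M) Y < -1" "lor (opp R P Q M) Y < -1"
    using opp_far[OF V Y] opp_far[OF V2 Y(1)] opp_far[OF V3 Y(1)] Y(2) sext_rotate by blast+
  from E(1) show ?thesis by (rule sextE) (use * E(2) vacantD(2-4)[OF V] in blast)+
qed

lemma grow_unit:
  assumes "X \<in> grow S"
  shows "lor X X = 1"
proof (cases "X \<in> S")
  case True
  then show ?thesis by (rule unit)
next
  case False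
  then obtain P Q R M where W: "vacant S P Q R M" "X \<in> sext P Q R M" using assms by (elim growE) blast+
  note F = vacantD(1)[OF W(1)]
  show ?thesis using W(2)
    by (rule sextE) (use frame_products(1-3)[OF F] opp_products(1)[OF F] opp_products(1)[OF frame_rotate[OF F]]
      opp_products(1)[OF frame_rotate[OF frame_rotate[OF F]]] in simp_all)
qed

lemma grow_sep:
  assumes X: "X \<in> grow S" and Y: "Y \<in> grow S" and "X \<noteq> Y"
  shows "lor X Y \<le> -1"
proof (cases "X \<in> S")
  case True
  then show ?thesis using grow_old[OF Y True] \<open>X \<noteq> Y\<close> by (simp add: lor_commute)
next
  case False
  then obtain P Q R M where W: "vacant S P Q R M" "X \<in> sext P Q R M" using X by (elim growE) blast+
  note F = vacantD(1)[OF W(1)]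
  show ?thesis
  proof (cases "Y \<in> sext P Q R M")
    case True
    then show ?thesis using sext_products[OF F W(2) True] \<open>X \<noteq> Y\<close> by force
  next
    case no: False
    then show ?thesis using sext_new_far[OF W False Y no] by simp
  qed
qed

lemma grow_future:
  assumes X: "X \<in> grow S" and Y: "Y \<in> grow S" and "X \<noteq> Y"
  shows "future (X + Y)"
proof -
  have new: "future (X + Y)" if X: "X \<in> grow S" "X \<notin> S" and Y: "Y \<in> grow S" "X \<noteq> Y" for X Y
  proof -
    obtain P Q R M where V: "vacant S P Q R M" using X by (elim growE) blast+
    note F = vacantD(1)[OF V]
    have "lor X P \<le> -1" "lor X Q \<le> -1"
      using grow_old[OF X(1)] vacantD(2-3)[OF V] X(2) by blast+
    moreover have "lor Y P + lor Y Q \<le> 0"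
    proof (cases "Y = P \<or> Y = Q")
      case True
      then show ?thesis using frame_products(1-5)[OF F] by (elim disjE) simp_all
    next
      case False
      then show ?thesis using grow_old[OF Y(1), of P] grow_old[OF Y(1), of Q] vacantD(2-3)[OF V] by force
    qed
    \<comment> \<open>P+Q serves as a future test vector: X contributes at most -2, and Y at most 0,
      with value 0 when Y is P or Q.\<close>
    ultimately have neg: "lor (X + Y) (P + Q) < 0" by (simp add: lor_simps)
    have "lor (P + Q) (P + Q) \<le> 0" using frame_products(1-5)[OF F] by (simp add: lor_simps)
    moreover have "future (P + Q)" using F unfolding frame_def by blast
    moreover have "lor (X + Y) (X + Y) \<le> 0"
      using grow_unit[OF X(1)] grow_unit[OF Y(1)] grow_sep[OF X(1) Y] 
      by (simp add: lor_simps lor_commute[of Y X])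
    ultimately show ?thesis using futureI neg by blast
  qed
  show ?thesis
  proof (cases "X \<in> S")
    case True
    then show ?thesis using new[of Y X] fut[of X Y] assms by (cases "Y \<in> S") (auto simp: add.commute)
  next
    case False
    then show ?thesis using new assms by blast
  qed
qed

text \<open>A triangle with a new vertex \<open>P\<close> is a face of the octahedron that \<open>P\<close> belongs to; the
  barycentre \<open>W\<close> of an octahedron does not depend on the face. The reflected octahedron at such
  a face is still missing.\<close>

lemma grow_frame_new:
  assumes in_grow: "P \<in> grow S" "Q \<in> grow S" "R \<in> grow S" and G: "frame P Q R N" and "P \<notin> S"
  shows "\<exists>A B C M M'. vacant S A B C M \<and> frame P Q R M' \<and> sext P Q R M' = sext A B C M \<and>
    vacant (grow S) P Q R (- M')"
proof -
  obtain A0 B0 C0 M where V0: "vacant S A0 B0 C0 M" "P \<in> sext A0 B0 C0 M"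
    using in_grow(1) \<open>P \<notin> S\<close> by (elim growE) blast+
  have "\<exists>A B C. vacant S A B C M \<and> P = opp A B C M"
    using V0(2) by (rule sextE)
      (use V0(1) vacantD(2-4)[OF V0(1)] \<open>P \<notin> S\<close> vacant_rotate[of S] in blast)+
  then obtain A B C where V: "vacant S A B C M" and P: "P = opp A B C M" by blast
  note F = vacantD(1)[OF V]
  define W where "W = A + B + C + 2 *\<^sub>R M"
  have opp: "opp A B C M = 2 *\<^sub>R W - A" "opp B C A M = 2 *\<^sub>R W - B" "opp C A B M = 2 *\<^sub>R W - C"
    unfolding opp_def W_def by (simp_all add: algebra_simps scaleR_2 scaleR_4)
  have PS: "P \<in> sext A B C M" unfolding P sext_def by blast
  have near: "X \<in> sext A B C M" if "X \<in> grow S" "lor P X = -1" for X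
  proof (rule ccontr)
    assume "X \<notin> sext A B C M"
    from sext_new_far[OF V PS \<open>P \<notin> S\<close> that(1) this] show False using that(2) by simp
  qed
  note mem = near[OF in_grow(2) frame_products(4)[OF G]] near[OF in_grow(3) frame_products(9)[OF G]]
  have "lor P A = -3" using opp_products(2)[OF F] unfolding P .
  then have "Q \<noteq> A" "R \<noteq> A" using frame_products(4,9)[OF G] by auto
  then have Q: "Q \<in> {B, 2 *\<^sub>R W - B} \<union> {C, 2 *\<^sub>R W - C}" and R: "R \<in> {B, 2 *\<^sub>R W - B} \<union> {C, 2 *\<^sub>R W - C}"
    using mem frame_distinct(1,3)[OF G] unfolding sext_def P opp by blast+
  have ww: "lor W W = -1" "lor W A = -1" "lor W B = -1" "lor W C = -1"
    using frame_products[OF F] by (simp_all add: W_def lor_simps)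
  have wx: "lor W Y = -1" if "lor W X = -1" "Y \<in> {X, 2 *\<^sub>R W - X}" for X Y
    using that(2) by (elim insertE) (simp_all add: that(1) ww(1) lor_simps)
  have wp: "lor W P = -1" "lor W Q = -1" "lor W R = -1"
    using Q R wx[OF ww(2), of P] wx[OF ww(3)] wx[OF ww(4)] unfolding P opp by blast+
  \<comment> \<open>Q and R cannot lie in one antipodal pair, where products are only 1 and -3; so
    they come from the two pairs other than that of P.\<close>
  have same: False if "lor X X = 1" "lor W X = -1" "Q \<in> {X, 2 *\<^sub>R W - X}" "R \<in> {X, 2 *\<^sub>R W - X}" for X
  proof -
    have "lor Q R \<noteq> -1" using that(3,4)
      by (elim insertE) (simp_all add: that(1,2) ww(1) lor_simps lor_commute[of X W])
    then show False using frame_products(6)[OF G] by blast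
  qed
  have QR: "(Q \<in> {B, 2 *\<^sub>R W - B} \<and> R \<in> {C, 2 *\<^sub>R W - C}) \<or> (Q \<in> {C, 2 *\<^sub>R W - C} \<and> R \<in> {B, 2 *\<^sub>R W - B})"
    using Q R same[OF frame_products(2)[OF F] ww(3)] same[OF frame_products(3)[OF F] ww(4)] by blast
  \<comment> \<open>The solution of W = P + Q + R + 2M', i.e. the normal for which the face P, Q, R
    yields the same octahedron.\<close>
  define M' where "M' = (1 / 2) *\<^sub>R (W - P - Q - R)"
  have oppM': "opp P Q R M' = 2 *\<^sub>R W - P" "opp Q R P M' = 2 *\<^sub>R W - Q" "opp R P Q M' = 2 *\<^sub>R W - R"
    unfolding opp_def M'_def by (simp_all add: algebra_simps scaleR_2)
  have S1: "sext A B C M = {A, 2 *\<^sub>R W - A} \<union> {B, 2 *\<^sub>R W - B} \<union> {C, 2 *\<^sub>R W - C}"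
    unfolding sext_def opp by blast
  have S2: "sext P Q R M' = {P, 2 *\<^sub>R W - P} \<union> {Q, 2 *\<^sub>R W - Q} \<union> {R, 2 *\<^sub>R W - R}"
    unfolding sext_def oppM' by blast
  have pair: "{X, 2 *\<^sub>R W - X} = {Y, 2 *\<^sub>R W - Y}" if "X \<in> {Y, 2 *\<^sub>R W - Y}" for X Y
    using that by (elim insertE) (simp_all add: insert_commute)
  have "{P, 2 *\<^sub>R W - P} = {A, 2 *\<^sub>R W - A}" unfolding P opp by (simp add: insert_commute)
  moreover have "{Q, 2 *\<^sub>R W - Q} \<union> {R, 2 *\<^sub>R W - R} = {B, 2 *\<^sub>R W - B} \<union> {C, 2 *\<^sub>R W - C}"
    using QR pair[of Q B] pair[of Q C] pair[of R B] pair[of R C] by (metis Un_commute)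
  ultimately have sext: "sext P Q R M' = sext A B C M" unfolding S1 S2 by (metis Un_assoc)
  have F': "frame P Q R M'"
    using G wp ww(1) unfolding frame_def M'_def
    by (simp add: lor_simps lor_commute[of P W] lor_commute[of Q W] lor_commute[of R W]
        lor_commute[of Q P] lor_commute[of R Q] lor_commute[of P R])
  have pos: "lor Y M' > 0" if Y: "Y \<in> grow S" "Y \<noteq> P" "Y \<noteq> Q" "Y \<noteq> R" for Y
  proof (cases "Y \<in> sext A B C M")
    case True
    then have "Y \<in> sext P Q R M'" using sext by simp
    then show ?thesis
      by (rule sextE) (use Y opp_products(5)[OF F'] opp_products(5)[OF frame_rotate[OF F']]
          opp_products(5)[OF frame_rotate[OF frame_rotate[OF F']]] in simp_all)
  next
    case False
    have "lor Y B \<le> -1" "lor Y C \<le> -1"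
      using grow_old[OF Y(1)] vacantD(3-4)[OF V] not_sextD[OF False] by metis+
    moreover have "lor Y Q \<le> -1" "lor Y R \<le> -1" using grow_sep[OF Y(1)] in_grow Y by blast+
    moreover have "lor Y M < 0" using grow_side[OF V Y(1) False] .
    \<comment> \<open>Substituting W cancels the term with A and leaves -(YB + YC + 2YM + YQ +
      YR)/2, a sum of positive contributions.\<close>
    moreover have "lor Y M' = (lor Y A - lor Y W - lor Y Q - lor Y R) / 2"
      unfolding M'_def P opp by (simp add: lor_simps)
    moreover have "lor Y W = lor Y A + lor Y B + lor Y C + 2 * lor Y M"
      unfolding W_def by (simp add: lor_simps)
    ultimately show ?thesis by argo
  qed
  have "vacant (grow S) P Q R (- M')"
    unfolding vacant_def using in_grow frame_minus[OF F'] pos by (simp add: lor_minus_right)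
  then show ?thesis using V F' sext by blast
qed

text \<open>Of the two normals of a new face, one points to the octahedron just added, the other to
  a side that is still vacant.\<close>

lemma grow_dichotomy_new:
  assumes "P \<in> grow S" "Q \<in> grow S" "R \<in> grow S" "frame P Q R N" "P \<notin> S"
  shows "sext P Q R N \<subseteq> grow S \<or> vacant (grow S) P Q R N"
proof -
  obtain A B C M M' where *: "vacant S A B C M" "frame P Q R M'" "sext P Q R M' = sext A B C M"
    "vacant (grow S) P Q R (- M')"
    using grow_frame_new[OF assms] by blast
  then show ?thesis using frame_normal_unique[OF *(2) assms(4)] sext_subset_grow[OF *(1)] by auto
qed

lemma grow_dichotomy:
  assumes "P \<in> grow S" "Q \<in> grow S" "R \<in> grow S" "frame P Q R N"
  shows "sext P Q R N \<subseteq> grow S \<or> vacant (grow S) P Q R N"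
proof -
  note G = assms(4) frame_rotate[OF assms(4)] frame_rotate[OF frame_rotate[OF assms(4)]]
  consider "P \<in> S" "Q \<in> S" "R \<in> S" | "P \<notin> S" | "Q \<notin> S" | "R \<notin> S" by blast
  then show ?thesis
  proof cases
    case 1
    \<comment> \<open>For an old triple the first alternative always results: a filled side stays
      filled, and a vacant one has just been filled.\<close>
    then show ?thesis
      using dichotomy[OF 1 assms(4)] sext_subset_grow[of S P Q R N] unfolding grow_def by blast
  next
    case 2
    then show ?thesis using grow_dichotomy_new assms by blast
  next
    case 3
    then have "sext Q R P N \<subseteq> grow S \<or> vacant (grow S) Q R P N"
      using grow_dichotomy_new[OF _ _ _ G(2)] assms by blast
    then show ?thesis using sext_rotate vacant_rotate by metis
  next
    case 4
    then have "sext R P Q N \<subseteq> grow S \<or> vacant (grow S) R P Q N"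
      using grow_dichotomy_new[OF _ _ _ G(3)] assms by blast
    then show ?thesis using sext_rotate vacant_rotate by metis
  qed
qed

lemma config_grow: "config (grow S)"
  by unfold_locales (use grow_unit grow_sep grow_future grow_dichotomy in blast)+

text \<open>Provides the descent in \<open>frame_divisible\<close>: a tangent triple that is not old
  shares its octahedron with an old one.\<close>

lemma grow_frame_cases:
  assumes "P \<in> grow S" "Q \<in> grow S" "R \<in> grow S" "frame P Q R N"
  shows "{P, Q, R} \<subseteq> S \<or>
    (\<exists>A B C M M'. vacant S A B C M \<and> frame P Q R M' \<and> sext P Q R M' = sext A B C M)"
proof -
  note G = assms(4) frame_rotate[OF assms(4)] frame_rotate[OF frame_rotate[OF assms(4)]]
  consider "P \<in> S" "Q \<in> S" "R \<in> S" | "P \<notin> S" | "Q \<notin> S" | "R \<notin> S" by blast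
  then show ?thesis
  proof cases
    case 1
    then show ?thesis by blast
  next
    case 2
    then show ?thesis using grow_frame_new assms by blast
  next
    case 3
    then obtain A B C M M' where "vacant S A B C M" "frame Q R P M'" "sext Q R P M' = sext A B C M"
      using grow_frame_new[OF _ _ _ G(2)] assms by blast
    then show ?thesis using sext_rotate frame_rotate by metis
  next
    case 4
    then obtain A B C M M' where "vacant S A B C M" "frame R P Q M'" "sext R P Q M' = sext A B C M"
      using grow_frame_new[OF _ _ _ G(3)] assms by blast
    then show ?thesis using sext_rotate frame_rotate by metis
  qed
qed

end

section \<open>Circles as unit vectors\<close>

fun gvec :: "gcircle \<Rightarrow> cvec" where
  "gvec (Circ c r) = (1 / r, (1 / r) *\<^sub>R c, ((norm c)\<^sup>2 - r\<^sup>2) / r)"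
| "gvec (Outer c r) = - (1 / r, (1 / r) *\<^sub>R c, ((norm c)\<^sup>2 - r\<^sup>2) / r)"
| "gvec (Line u d) = (0, u, 2 * d)"

lemma ev_minus: "ev (- V) z = - ev V z"
  by (simp add: ev_def lor_simps)

lemma ev_circle:
  assumes "r > 0"
  shows "ev (1 / r, (1 / r) *\<^sub>R c, ((norm c)\<^sup>2 - r\<^sup>2) / r) z = ((dist z c)\<^sup>2 - r\<^sup>2) / r"
  using assms unfolding dist_norm power2_norm_eq_inner ev_eq
  by (simp add: inner_diff_left inner_diff_right inner_commute power2_norm_eq_inner field_simps)

lemma square_le_iff: "(x::real) \<ge> 0 \<Longrightarrow> y \<ge> 0 \<Longrightarrow> x\<^sup>2 \<le> y\<^sup>2 \<longleftrightarrow> x \<le> y"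
  by simp

lemma square_less_iff: "(x::real) \<ge> 0 \<Longrightarrow> y \<ge> 0 \<Longrightarrow> x\<^sup>2 < y\<^sup>2 \<longleftrightarrow> x < y"
  using square_le_iff[of y x] by linarith

lemma region_line: "region (Line u d) = {z. u \<bullet> z \<ge> d}"
  by (auto simp: inner_complex_def)

lemma region_ev:
  assumes "valid_gc X"
  shows "region X = {z. ev (gvec X) z \<le> 0}"
proof (cases X)
  case (Circ c r)
  then have r: "r > 0" using assms by simp
  have "ev (gvec X) z \<le> 0 \<longleftrightarrow> dist c z \<le> r" for z
  proof -
    have "ev (gvec X) z \<le> 0 \<longleftrightarrow> (dist z c)\<^sup>2 \<le> r\<^sup>2"
      using r unfolding Circ by (simp add: ev_circle divide_le_0_iff)
    also have "\<dots> \<longleftrightarrow> dist c z \<le> r"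
      unfolding dist_commute[of c z] by (rule square_le_iff) (use r in auto)
    finally show ?thesis .
  qed
  then have "{z. ev (gvec X) z \<le> 0} = cball c r" unfolding cball_def by (simp only:)
  then show ?thesis unfolding Circ by simp
next
  case (Outer c r)
  then have r: "r > 0" using assms by simp
  have "ev (gvec X) z \<le> 0 \<longleftrightarrow> r \<le> dist z c" for z
  proof -
    have "ev (gvec X) z \<le> 0 \<longleftrightarrow> r\<^sup>2 \<le> (dist z c)\<^sup>2"
      using r unfolding Outer gvec.simps ev_minus by (simp add: ev_circle zero_le_divide_iff)
    also have "\<dots> \<longleftrightarrow> r \<le> dist z c"
      unfolding dist_commute[of c z] by (rule square_le_iff) (use r in auto)
    finally show ?thesis .
  qed
  then have "{z. ev (gvec X) z \<le> 0} = {z. r \<le> dist z c}" by (simp only:)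
  then show ?thesis unfolding Outer by simp
next
  case (Line u d)
  show ?thesis unfolding Line region_line by (auto simp: ev_eq)
qed

lemma interior_region_ev:
  assumes "valid_gc X"
  shows "interior (region X) = {z. ev (gvec X) z < 0}"
proof (cases X)
  case (Circ c r)
  then have r: "r > 0" using assms by simp
  have "ev (gvec X) z < 0 \<longleftrightarrow> dist c z < r" for z
  proof -
    have "ev (gvec X) z < 0 \<longleftrightarrow> (dist z c)\<^sup>2 < r\<^sup>2"
      using r unfolding Circ by (simp add: ev_circle divide_less_0_iff)
    also have "\<dots> \<longleftrightarrow> dist c z < r"
      unfolding dist_commute[of c z] by (rule square_less_iff) (use r in auto)
    finally show ?thesis .
  qed
  then have "{z. ev (gvec X) z < 0} = ball c r" unfolding ball_def by (simp only:)
  then show ?thesis unfolding Circ by simp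
next
  case (Outer c r)
  then have r: "r > 0" using assms by simp
  have "ev (gvec X) z < 0 \<longleftrightarrow> r < dist c z" for z
  proof -
    have "ev (gvec X) z < 0 \<longleftrightarrow> r\<^sup>2 < (dist z c)\<^sup>2"
      using r unfolding Outer gvec.simps ev_minus by (simp add: ev_circle zero_less_divide_iff)
    also have "\<dots> \<longleftrightarrow> r < dist c z"
      unfolding dist_commute[of c z] by (rule square_less_iff) (use r in auto)
    finally show ?thesis .
  qed
  then have "{z. ev (gvec X) z < 0} = - cball c r" unfolding cball_def by (simp only: not_le Collect_neg_eq[symmetric])
  moreover have "{z. dist z c \<ge> r} = - ball c r"
    unfolding ball_def by (auto simp: dist_commute[of _ c])
  then have "interior (region X) = - cball c r"
    using r unfolding Outer by (simp add: interior_complement)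
  ultimately show ?thesis by simp
next
  case (Line u d)
  then have "u \<noteq> 0" using assms by auto
  have "region X = {z. u \<bullet> z \<ge> d}" unfolding Line by (rule region_line)
  then have "interior (region X) = {z. u \<bullet> z > d}" using interior_halfspace_ge[OF \<open>u \<noteq> 0\<close>, of d] by simp
  then show ?thesis unfolding Line by (simp add: ev_eq)
qed

lemma lor_gvec:
  assumes "valid_gc X"
  shows "lor (gvec X) (gvec X) = 1"
proof -
  have "lor (1 / r, (1 / r) *\<^sub>R c, ((norm c)\<^sup>2 - r\<^sup>2) / r) (1 / r, (1 / r) *\<^sub>R c, ((norm c)\<^sup>2 - r\<^sup>2) / r) = 1"
    if "r > 0" for c :: complex and r
    using that by (simp add: lor_self power_divide field_simps power2_eq_square)
  then show ?thesis using assms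
    by (cases X) (simp_all add: lor_minus_left lor_minus_right lor_self del: uminus_Pair)
qed

lemma curv_gvec: "curv X = fst (gvec X)"
  by (cases X) simp_all

lemma is_line_gvec: "valid_gc X \<Longrightarrow> is_line X \<longleftrightarrow> fst (gvec X) = 0"
  by (cases X) auto

lemma gvec_inject:
  assumes "valid_gc X" "valid_gc Y" "gvec X = gvec Y"
  shows "X = Y"
proof (cases X; cases Y)
  fix c r c' r' assume *: "X = Circ c r" "Y = Outer c' r'"
  then have "1 / r > 0" "1 / r' > 0" using assms(1,2) by auto
  moreover have "1 / r = - (1 / r')" using assms(3) * by simp
  ultimately show ?thesis by linarith
next
  fix c r c' r' assume *: "X = Outer c r" "Y = Circ c' r'"
  then have "1 / r > 0" "1 / r' > 0" using assms(1,2) by auto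
  moreover have "- (1 / r) = 1 / r'" using assms(3) * by simp
  ultimately show ?thesis by linarith
qed (use assms in auto)

lemma gvec_surj:
  assumes "lor V V = 1"
  shows "\<exists>X. valid_gc X \<and> gvec X = V"
proof -
  obtain k u l where V: "V = (k, u, l)" by (cases V)
  have n: "(norm u)\<^sup>2 = 1 + k * l" using assms by (simp add: V lor_self)
  have circ: "gvec (Circ ((1 / k) *\<^sub>R u) (1 / k)) = (k, u, l)"
    if "k \<noteq> 0" "(norm u)\<^sup>2 = 1 + k * l" for k u l
    using that by (simp add: power_divide field_simps power2_eq_square)
  consider "k > 0" | "k < 0" | "k = 0" by linarith
  then show ?thesis
  proof cases
    case 1
    then show ?thesis using circ[of k u l] n by (intro exI[of _ "Circ ((1 / k) *\<^sub>R u) (1 / k)"]) (simp add: V)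
  next
    case 2
    have "gvec (Outer ((1 / - k) *\<^sub>R - u) (1 / - k)) = - gvec (Circ ((1 / - k) *\<^sub>R - u) (1 / - k))" by simp
    also have "\<dots> = - (- k, - u, - l)" using 2 n by (subst circ[of "- k" "- u" "- l"]) auto
    finally have "gvec (Outer ((1 / - k) *\<^sub>R - u) (1 / - k)) = V" using V by simp
    then show ?thesis using 2 by (intro exI[of _ "Outer ((1 / - k) *\<^sub>R - u) (1 / - k)"]) auto
  next
    case 3
    then have "norm u = 1" using n by (simp add: power2_eq_1_iff) (smt (verit) norm_ge_zero)
    then show ?thesis using 3 by (intro exI[of _ "Line u (l / 2)"]) (simp add: V)
  qed
qed

section \<open>Tangency and disjointness in terms of Lorentz products\<close>

definition grad :: "cvec \<Rightarrow> complex \<Rightarrow> complex" where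
  "grad V t = fst V *\<^sub>R t - fst (snd V)"

lemma ev_shift: "ev V (t + w) = ev V t + 2 * (grad V t \<bullet> w) + fst V * (norm w)\<^sup>2"
  unfolding ev_eq grad_def power2_norm_eq_inner
  by (simp add: inner_add_left inner_add_right inner_diff_left inner_commute algebra_simps)

text \<open>\<open>grad\<close> is half the gradient of \<open>ev\<close>; on the circle of a unit
  vector it is therefore a unit normal.\<close>

lemma grad_norm: "(norm (grad V t))\<^sup>2 = fst V * ev V t + lor V V"
  unfolding ev_eq grad_def power2_norm_eq_inner lor_self
  by (simp add: inner_diff_left inner_diff_right inner_commute power2_norm_eq_inner algebra_simps)

lemma grad_add: "grad (V + W) t = grad V t + grad W t"
  by (simp add: grad_def algebra_simps)

lemma ev_near_neg:
  assumes "ev V t < 0 \<or> (ev V t = 0 \<and> grad V t \<bullet> d < 0)"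
  shows "\<forall>\<^sub>F s in at_right 0. ev V (t + s *\<^sub>R d) < 0"
proof -
  have eq: "ev V (t + s *\<^sub>R d) = ev V t + s * (2 * (grad V t \<bullet> d) + s * (fst V * (norm d)\<^sup>2))" for s
    by (simp add: ev_shift power_mult_distrib power2_eq_square algebra_simps)
  show ?thesis
  proof (cases "ev V t < 0")
    case True
    have "((\<lambda>s. ev V (t + s *\<^sub>R d)) \<longlongrightarrow> ev V t + 0 * (2 * (grad V t \<bullet> d) + 0 * (fst V * (norm d)\<^sup>2))) (at_right 0)"
      unfolding eq by (intro tendsto_intros)
    then show ?thesis using order_tendstoD(2)[of _ "ev V t" _ 0] True by simp
  next
    case False
    have "((\<lambda>s. 2 * (grad V t \<bullet> d) + s * (fst V * (norm d)\<^sup>2)) \<longlongrightarrow> 2 * (grad V t \<bullet> d) + 0 * (fst V * (norm d)\<^sup>2)) (at_right 0)"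
      by (intro tendsto_intros)
    then have "\<forall>\<^sub>F s in at_right 0. 2 * (grad V t \<bullet> d) + s * (fst V * (norm d)\<^sup>2) < 0"
      using order_tendstoD(2)[of _ "2 * (grad V t \<bullet> d)" _ 0] assms False by simp
    moreover have "\<forall>\<^sub>F s::real in at_right 0. s > 0" by (simp add: eventually_at_right_less)
    ultimately show ?thesis
      by eventually_elim (use assms False in \<open>auto simp: eq mult_pos_neg\<close>)
  qed
qed

text \<open>If one of the conclusions failed, some direction would lead from t into both interiors:
  minus the gradient of the circle on which t lies, or minus the sum of the two unit gradients,
  which makes an obtuse angle with both when it is nonzero.\<close>

lemma touching_gradients:
  assumes U: "lor U U = 1" "lor V V = 1" and d: "\<And>z. \<not> (ev U z < 0 \<and> ev V z < 0)"
    and t: "ev U t \<le> 0" "ev V t \<le> 0"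
  shows "ev U t = 0" "ev V t = 0" "grad U t + grad V t = 0"
proof -
  have both: False if "\<forall>\<^sub>F s in at_right 0. ev U (t + s *\<^sub>R w) < 0" "\<forall>\<^sub>F s in at_right 0. ev V (t + s *\<^sub>R w) < 0" for w
  proof -
    have "\<forall>\<^sub>F s in at_right (0::real). ev U (t + s *\<^sub>R w) < 0 \<and> ev V (t + s *\<^sub>R w) < 0"
      using that by (rule eventually_conj)
    then have "\<forall>\<^sub>F s in at_right (0::real). False" by (rule eventually_mono) (use d in blast)
    then show False by (simp add: trivial_limit_at_right_real)
  qed
  have unit: "(norm (grad W t))\<^sup>2 = 1" if "lor W W = 1" "ev W t = 0" for W
    using grad_norm[of W t] that by simp
  have neg: "grad W t \<bullet> (- grad W t) < 0" if "lor W W = 1" "ev W t = 0" for W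
    using unit[OF that] by (simp add: power2_norm_eq_inner)
  show eU: "ev U t = 0"
  proof (rule ccontr)
    assume "ev U t \<noteq> 0"
    then have "ev U t < 0" using t by simp
    moreover have "ev V t < 0 \<or> (ev V t = 0 \<and> grad V t \<bullet> (- grad V t) < 0)"
      using t(2) neg[OF U(2)] by argo
    ultimately show False using both[OF ev_near_neg ev_near_neg] by blast
  qed
  show eV: "ev V t = 0"
  proof (rule ccontr)
    assume "ev V t \<noteq> 0"
    then have "ev V t < 0" using t by simp
    moreover have "ev U t < 0 \<or> (ev U t = 0 \<and> grad U t \<bullet> (- grad U t) < 0)"
      using t(1) neg[OF U(1)] by argo
    ultimately show False using both[OF ev_near_neg ev_near_neg] by blast
  qed
  let ?g = "grad U t + grad V t"
  have n: "grad U t \<bullet> grad U t = 1" "grad V t \<bullet> grad V t = 1"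
    using unit U eU eV by (simp_all add: power2_norm_eq_inner)
  have "grad U t \<bullet> (- ?g) = - (?g \<bullet> ?g) / 2" "grad V t \<bullet> (- ?g) = - (?g \<bullet> ?g) / 2"
    using n by (simp_all add: inner_add_left inner_diff_right inner_add_right inner_commute field_simps)
  moreover have "?g \<bullet> ?g > 0" if "?g \<noteq> 0" using that by (simp only: inner_gt_zero_iff not_False_eq_True)
  ultimately have "grad U t \<bullet> (- ?g) < 0 \<and> grad V t \<bullet> (- ?g) < 0" if "?g \<noteq> 0" using that by linarith
  then show "?g = 0" using both[OF ev_near_neg ev_near_neg, of "- ?g"] eU eV by blast
qed

lemma other_zero:
  assumes "ev V t = 0" "lor V V = 1"
  shows "\<exists>w. w \<noteq> 0 \<and> ev V (t + w) = 0"
proof -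
  have n: "grad V t \<bullet> grad V t = 1" using grad_norm[of V t] assms by (simp add: power2_norm_eq_inner)
  then have g: "grad V t \<noteq> 0" by auto
  show ?thesis
  proof (cases "fst V = 0")
    case True
    then show ?thesis using g assms(1)
      \<comment> \<open>For a line, a step along its direction; for a circle, below, the step to the
        antipodal point.\<close>
      by (intro exI[of _ "\<i> * grad V t"]) (simp add: ev_shift inner_complex_def)
  next
    case False
    have "ev V (t + (- 2 / fst V) *\<^sub>R grad V t) = 2 * (- 2 / fst V) + fst V * (- 2 / fst V)\<^sup>2"
      unfolding ev_shift power2_norm_eq_inner using assms(1) n by (simp add: power2_eq_square)
    also have "\<dots> = 0" using False by (simp add: power2_eq_square field_simps)
    finally have "ev V (t + (- 2 / fst V) *\<^sub>R grad V t) = 0" .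
    then show ?thesis using False g by (intro exI[of _ "(- 2 / fst V) *\<^sub>R grad V t"]) simp
  qed
qed

text \<open>\<open>U + V\<close> = 0 is the same circle with both orientations; it also has product
  -1 and a sum that counts as future.\<close>

definition tang :: "cvec \<Rightarrow> cvec \<Rightarrow> bool" where
  "tang U V \<longleftrightarrow> lor U V = -1 \<and> future (U + V) \<and> U + V \<noteq> 0"

text \<open>At the touching point U+V has value and gradient 0, so it is null by
  \<open>grad_norm\<close>, which means product -1. Its curvature is positive, since otherwise a
  second point of the circle U would lie in both regions.\<close>

lemma tangent_imp_tang:
  assumes X: "valid_gc X" and Y: "valid_gc Y" and T: "tangent X Y"
  shows "tang (gvec X) (gvec Y)"
proof -
  let ?U = "gvec X" and ?V = "gvec Y"
  have U: "lor ?U ?U = 1" "lor ?V ?V = 1" using X Y by (simp_all add: lor_gvec)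
  have d: "\<not> (ev ?U z < 0 \<and> ev ?V z < 0)" for z
    using T interior_region_ev X Y unfolding tangent_def by blast
  have "(\<exists>z. region X \<inter> region Y = {z}) \<or> (is_line X \<and> is_line Y \<and> region X \<inter> region Y = {})"
    using T unfolding tangent_def by blast
  then show ?thesis
  proof (elim disjE exE conjE)
    fix t assume t: "region X \<inter> region Y = {t}"
    then have mem: "ev ?U z \<le> 0 \<and> ev ?V z \<le> 0 \<longleftrightarrow> z = t" for z
      unfolding region_ev[OF X] region_ev[OF Y] by (auto simp: set_eq_iff)
    then have t0: "ev ?U t \<le> 0" "ev ?V t \<le> 0" by blast+
    note touch = touching_gradients[OF U d t0]
    let ?S = "?U + ?V"
    have S: "ev ?S t = 0" "grad ?S t = 0" using touch by (simp_all add: ev_add grad_add)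
    have pos: "fst ?S > 0"
    proof (rule ccontr)
      assume "\<not> ?thesis"
      then have np: "fst ?S \<le> 0" by simp
      obtain w where w: "w \<noteq> 0" "ev ?U (t + w) = 0" using other_zero[OF touch(1) U(1)] by blast
      have "ev ?S (t + w) \<le> 0" using S np by (simp add: ev_shift mult_nonpos_nonneg)
      then have "ev ?V (t + w) \<le> 0" using w by (simp add: ev_add)
      then show False using mem[of "t + w"] w by simp
    qed
    have SS: "lor ?S ?S = 0" using grad_norm[of ?S t] S by simp
    then have "lor ?U ?V = -1" using U by (simp add: lor_simps lor_commute[of ?V ?U])
    moreover have "fst ?S * snd (snd ?S) \<ge> 0" using SS lor_self[of ?S] zero_le_power2[of "norm (fst (snd ?S))"] by argo
    then have "future ?S" using pos unfolding future_def by (simp only: zero_le_mult_iff) linarith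
    moreover have "?S \<noteq> 0"
    proof
      assume "?S = 0"
      then show False using pos by (simp only: fst_zero less_irrefl)
    qed
    ultimately show ?thesis unfolding tang_def by blast
  next
    assume lines: "is_line X" "is_line Y" and empty: "region X \<inter> region Y = {}"
    obtain u a v b where L: "X = Line u a" "Y = Line v b" using lines by (cases X; cases Y) auto
    have n: "u \<bullet> u = 1" "v \<bullet> v = 1" using X Y L by (simp_all add: norm_eq_1)
    have reg: "\<not> (u \<bullet> z \<ge> a \<and> v \<bullet> z \<ge> b)" for z
      using empty unfolding L region_line by blast
    have "u + v = 0"
    proof (rule ccontr)
      assume ne: "u + v \<noteq> 0"
      define e where "e = 1 + u \<bullet> v"
      have "(u + v) \<bullet> (u + v) = 2 * e" using n by (simp add: e_def inner_add_left inner_add_right inner_commute)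
      then have "e > 0" using ne inner_gt_zero_iff[of "u + v"] by simp
      \<comment> \<open>Unless the normals cancel, a point far out along their sum lies in both half
        planes.\<close>
      let ?z = "((\<bar>a\<bar> + \<bar>b\<bar>) / e) *\<^sub>R (u + v)"
      have "u \<bullet> (u + v) = e" "v \<bullet> (u + v) = e" using n by (simp_all add: e_def inner_add_right inner_commute)
      then have "u \<bullet> ?z = \<bar>a\<bar> + \<bar>b\<bar>" "v \<bullet> ?z = \<bar>a\<bar> + \<bar>b\<bar>" using \<open>e > 0\<close> by simp_all
      then show False using reg[of ?z] by linarith
    qed
    then have v: "v = - u" by (simp add: eq_neg_iff_add_eq_0 add.commute)
    have "a + b > 0" using reg[of "a *\<^sub>R u"] n by (simp add: v)
    then show ?thesis unfolding tang_def L future_def v using n by (simp add: lor_def zero_prod_def)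
  qed
qed

text \<open>Such a vector is a multiple of (1, t, |t|^2) with t = u/k: the touching point of two
  circles whose vectors add up to it.\<close>

lemma null_point:
  assumes "lor S S = 0" "future S" "fst S \<noteq> 0"
  shows "ev S z = fst S * (dist z ((1 / fst S) *\<^sub>R fst (snd S)))\<^sup>2"
    "ev V ((1 / fst S) *\<^sub>R fst (snd S)) = - 2 * lor V S / fst S"
proof -
  obtain k u l where S: "S = (k, u, l)" by (cases S)
  have n: "u \<bullet> u = k * l" "k \<noteq> 0" using assms by (simp_all add: S lor_self power2_norm_eq_inner)
  show "ev S z = fst S * (dist z ((1 / fst S) *\<^sub>R fst (snd S)))\<^sup>2"
    unfolding S ev_eq dist_norm power2_norm_eq_inner using n
    by (simp add: inner_diff_left inner_diff_right inner_commute field_simps)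
  show "ev V ((1 / fst S) *\<^sub>R fst (snd S)) = - 2 * lor V S / fst S"
    unfolding S ev_eq power2_norm_eq_inner using n
    by (simp add: lor_def field_simps)
qed

text \<open>The sum is null and future. If it has nonzero curvature k, the two values at z add up to
  k|z-t|^2, so only t is common; if k = 0, both circles are lines touching at infinity.\<close>

lemma tang_imp_tangent:
  assumes X: "valid_gc X" and Y: "valid_gc Y" and T: "tang (gvec X) (gvec Y)"
  shows "tangent X Y"
proof -
  let ?U = "gvec X" and ?V = "gvec Y"
  let ?S = "?U + ?V"
  have U: "lor ?U ?U = 1" "lor ?V ?V = 1" "lor ?U ?V = -1" using X Y T by (simp_all add: lor_gvec tang_def)
  have S: "lor ?S ?S = 0" "future ?S" "?S \<noteq> 0" using T U by (auto simp: lor_simps lor_commute[of ?V ?U] tang_def)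
  have ev: "ev ?U z + ev ?V z \<ge> 0" for z using ev_nonneg[of ?S z] S by (simp add: ev_add)
  have "X \<noteq> Y" using U by auto
  moreover have "interior (region X) \<inter> interior (region Y) = {}"
    unfolding interior_region_ev[OF X] interior_region_ev[OF Y] disjoint_iff mem_Collect_eq
    using ev by (meson add_neg_neg not_less)
  moreover have "(\<exists>z. region X \<inter> region Y = {z}) \<or> (is_line X \<and> is_line Y \<and> region X \<inter> region Y = {})"
  proof (cases "fst ?S = 0")
    case False
    then have pos: "fst ?S > 0" using S(2) unfolding future_def by linarith
    let ?t = "(1 / fst ?S) *\<^sub>R fst (snd ?S)"
    have "ev ?U z \<le> 0 \<and> ev ?V z \<le> 0 \<longleftrightarrow> z = ?t" for z
    proof
      assume "ev ?U z \<le> 0 \<and> ev ?V z \<le> 0"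
      then have "fst ?S * (dist z ?t)\<^sup>2 \<le> 0" using null_point(1)[OF S(1,2) False, of z] by (simp only: ev_add) argo
      then have "(dist z ?t)\<^sup>2 \<le> 0" using pos by (simp only: mult_le_0_iff) linarith
      then show "z = ?t" by simp
    next
      assume "z = ?t"
      moreover have "ev ?U ?t = 0" "ev ?V ?t = 0"
        unfolding null_point(2)[OF S(1,2) False] using U by (simp_all add: lor_simps lor_commute[of ?V ?U])
      ultimately show "ev ?U z \<le> 0 \<and> ev ?V z \<le> 0" by simp
    qed
    then have "region X \<inter> region Y = {?t}" unfolding region_ev[OF X] region_ev[OF Y] by blast
    then show ?thesis by blast
  next
    case True
    then have z: "fst (snd ?S) = 0" using S(1) unfolding lor_self by simp
    then have l: "snd (snd ?S) > 0" using S(2,3) True unfolding future_def by (auto simp: prod_eq_iff)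
    have "lor ?U ?S = 0" "lor ?V ?S = 0" using U by (simp_all add: lor_simps lor_commute[of ?V ?U])
    then have "fst ?U * snd (snd ?S) = 0" "fst ?V * snd (snd ?S) = 0"
      unfolding lor_def z True by simp_all
    then have "fst ?U = 0" "fst ?V = 0" using l by (simp_all only: mult_eq_0_iff) linarith+
    then have "is_line X" "is_line Y" using is_line_gvec X Y by blast+
    moreover have "ev ?S z > 0" for z unfolding ev_eq True using z l by simp
    then have "\<not> (ev ?U z \<le> 0 \<and> ev ?V z \<le> 0)" for z unfolding ev_add by (meson add_nonpos_nonpos not_less)
    then have "region X \<inter> region Y = {}" unfolding region_ev[OF X] region_ev[OF Y] by blast
    ultimately show ?thesis by blast
  qed
  ultimately show ?thesis unfolding tangent_def by blast
qed

text \<open>The sum is timelike, so the two values have positive sum everywhere. Two lines are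
  excluded because their product is that of unit normals.\<close>

lemma disjoint_gcI:
  assumes X: "valid_gc X" and Y: "valid_gc Y"
    and T: "lor (gvec X) (gvec Y) < -1" "future (gvec X + gvec Y)"
  shows "disjoint_gc X Y"
proof -
  let ?S = "gvec X + gvec Y"
  have "lor ?S ?S < 0" using T lor_gvec[OF X] lor_gvec[OF Y] by (simp add: lor_simps lor_commute[of "gvec Y" "gvec X"])
  then have "ev (gvec X) z + ev (gvec Y) z > 0" for z using ev_pos[of ?S z] T(2) by (simp add: ev_add)
  then have "region X \<inter> region Y = {}" 
    unfolding region_ev[OF X] region_ev[OF Y] disjoint_iff mem_Collect_eq by (meson add_nonpos_nonpos not_less)
  moreover have "\<not> (is_line X \<and> is_line Y)"
  proof
    assume "is_line X \<and> is_line Y"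
    then obtain u a v b where L: "X = Line u a" "Y = Line v b" by (cases X; cases Y) auto
    then have "norm u = 1" "norm v = 1" using X Y by simp_all
    then have "\<bar>u \<bullet> v\<bar> \<le> 1" using Cauchy_Schwarz_ineq2[of u v] by simp
    then show False using T(1) by (simp add: L lor_def)
  qed
  ultimately show ?thesis unfolding disjoint_gc_def by blast
qed

section \<open>Fillings are octahedra\<close>

lemma tangent_sym: "tangent X Y \<Longrightarrow> tangent Y X"
  unfolding tangent_def by (metis Int_commute)

lemma disjoint_gc_sym: "disjoint_gc X Y \<Longrightarrow> disjoint_gc Y X"
  unfolding disjoint_gc_def by (metis Int_commute)

lemma tangent_not_disjoint: "tangent X Y \<Longrightarrow> \<not> disjoint_gc X Y"
  unfolding tangent_def disjoint_gc_def by (metis insert_not_empty)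

text \<open>Since 4 + 1 = 5, any two of the six circles are tangent or disjoint, and disjointness is
  a perfect matching. It cannot pair A, B, C among themselves, so it pairs them with the three new
  circles, which are relabelled accordingly.\<close>

lemma fills_opposites:
  assumes T: "mutually_tangent A B C" and F: "fills G A B C E1 E2 E3"
  obtains a b c where "{a, b, c} = {E1, E2, E3}"
    "tangent a B" "tangent a C" "tangent b C" "tangent b A" "tangent c A" "tangent c B"
    "tangent a b" "tangent b c" "tangent c a" "a \<noteq> A" "b \<noteq> B" "c \<noteq> C"
proof -
  define S where "S = {A, B, C, E1, E2, E3}"
  define D where "D X = {Y \<in> S - {X}. disjoint_gc X Y}" for X
  have cS: "card S = 6" and cT: "\<And>X. X \<in> S \<Longrightarrow> card {Y \<in> S - {X}. tangent X Y} = 4"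
    and cD: "\<And>X. X \<in> S \<Longrightarrow> card (D X) = 1"
    using F unfolding fills_def Let_def S_def[symmetric] D_def by blast+
  have fin: "finite S" unfolding S_def by simp
  have part: "tangent X Y \<or> disjoint_gc X Y" if "X \<in> S" "Y \<in> S" "Y \<noteq> X" for X Y
  proof -
    let ?T = "{Y \<in> S - {X}. tangent X Y}"
    have "?T \<inter> D X = {}" unfolding D_def using tangent_not_disjoint by blast
    moreover have f: "finite ?T" "finite (D X)" unfolding D_def using fin by simp_all
    ultimately have "card (?T \<union> D X) = 5" using card_Un_disjoint[OF f] cT cD that(1) by simp
    moreover have "card (S - {X}) = 5" using cS that(1) fin by simp
    ultimately have "?T \<union> D X = S - {X}"
      using fin by (intro card_subset_eq) (auto simp: D_def)
    then show ?thesis using that unfolding D_def by blast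
  qed
  have uniq: "X = Y" if "Z \<in> S" "X \<in> S" "Y \<in> S" "X \<noteq> Z" "Y \<noteq> Z" "disjoint_gc X Z" "disjoint_gc Y Z" for X Y Z
  proof -
    have mem: "X \<in> D Z" "Y \<in> D Z" unfolding D_def using that disjoint_gc_sym by blast+
    have "card (D Z) = 1" using cD[OF that(1)] .
    then obtain u where "D Z = {u}" by (rule card_1_singletonE)
    then show ?thesis using mem by simp
  qed
  have ABC: "A \<in> S" "B \<in> S" "C \<in> S" unfolding S_def by blast+
  have d: "A \<noteq> B" "B \<noteq> C" "A \<noteq> C" using T unfolding mutually_tangent_def tangent_def by blast+
  have T': "tangent A B" "tangent B A" "tangent B C" "tangent C B" "tangent A C" "tangent C A"
    using T tangent_sym unfolding mutually_tangent_def by blast+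
  have c3: "card {A, B, C} = 3" using d by simp
  have c3': "card (S - {A, B, C}) = 3" using cS c3 ABC fin by (subst card_Diff_subset) auto
  have SE: "S - {A, B, C} \<subseteq> {E1, E2, E3}" unfolding S_def by blast
  have "card {E1, E2, E3} \<le> 3" by (simp add: card_insert_if)
  then have E: "S - {A, B, C} = {E1, E2, E3}" using card_seteq[OF _ SE] c3' by simp
  have opposite: "\<exists>a. a \<in> S - {A, B, C} \<and> disjoint_gc X a" if "X \<in> S" "\<And>Y. Y \<in> {A, B, C} \<Longrightarrow> Y \<noteq> X \<Longrightarrow> tangent X Y" for X
  proof -
    have "card (D X) = 1" using cD[OF that(1)] .
    then obtain a where "D X = {a}" by (rule card_1_singletonE)
    then have "a \<in> D X" by simp
    then have "a \<in> S" "a \<noteq> X" "disjoint_gc X a" unfolding D_def by blast+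
    then show ?thesis using that(2)[of a] tangent_not_disjoint by blast
  qed
  obtain a where a: "a \<in> S - {A, B, C}" "disjoint_gc A a" using opposite[OF ABC(1)] T' by blast
  obtain b where b: "b \<in> S - {A, B, C}" "disjoint_gc B b" using opposite[OF ABC(2)] T' by blast
  obtain c where c: "c \<in> S - {A, B, C}" "disjoint_gc C c" using opposite[OF ABC(3)] T' by blast
  have mem: "a \<in> S" "b \<in> S" "c \<in> S"
    and ne: "a \<noteq> A" "a \<noteq> B" "a \<noteq> C" "b \<noteq> A" "b \<noteq> B" "b \<noteq> C" "c \<noteq> A" "c \<noteq> B" "c \<noteq> C"
    using a(1) b(1) c(1) by blast+
  have ab: "a \<noteq> b" "b \<noteq> c" "c \<noteq> a"
    using uniq[of a A B] uniq[of b B C] uniq[of a A C] mem ne ABC a(2) b(2) c(2) d by metis+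
  have sub: "{a, b, c} \<subseteq> S - {A, B, C}" using a(1) b(1) c(1) by blast
  have "card {a, b, c} = 3" using ab by simp
  then have set: "{a, b, c} = {E1, E2, E3}"
    using card_seteq[OF _ sub] c3' fin unfolding E[symmetric] by simp
  have t: "tangent X Y" if "X \<in> S" "Y \<in> S" "Z \<in> S" "Y \<noteq> X" "Z \<noteq> Y" "Z \<noteq> X" "disjoint_gc Z X" for X Y Z
    using part[OF that(1,2,4)] uniq[OF that(1) that(2,3)] disjoint_gc_sym that(4-7) by blast
  show thesis
  proof (rule that[OF set])
    show "tangent a B" "tangent a C" "tangent a b"
      using t[OF mem(1) _ ABC(1)] mem ABC ne ab d a(2) by metis+
    show "tangent b C" "tangent b A" "tangent b c"
      using t[OF mem(2) _ ABC(2)] mem ABC ne ab d b(2) by metis+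
    show "tangent c A" "tangent c B" "tangent c a"
      using t[OF mem(3) _ ABC(3)] mem ABC ne ab d c(2) by metis+
  qed (use ne in blast)+
qed

lemma tang_products:
  assumes "tang U V"
  shows "lor U V = -1" "lor V U = -1" "future (U + V)"
  using assms unfolding tang_def by (simp_all add: lor_commute)

lemma inscribed_products:
  assumes F: "frame P Q R M" and E: "lor E E = 1" "lor E Q = -1" "lor E R = -1" and "E \<noteq> P"
  shows "(lor E M)\<^sup>2 = 1 - lor E P" "lor E M \<noteq> 0"
proof -
  show 1: "(lor E M)\<^sup>2 = 1 - lor E P" using frame_lor_self[OF F, of E] unfolding E by argo
  show "lor E M \<noteq> 0"
  proof
    assume 0: "lor E M = 0"
    then have "lor E P = 1" using 1 by simp
    then have "E = P" using frame_expand[OF F, of E] unfolding E 0 by simp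
    then show False using \<open>E \<noteq> P\<close> by blast
  qed
qed

text \<open>Two inscribed circles opposite to \<open>P\<close> and \<open>Q\<close>, with heights \<open>m, n\<close> over the plane of
  the frame, satisfy \<open>m\<^sup>2n\<^sup>2 = 4mn\<close>; three such circles have the same height \<open>2\<close> or \<open>-2\<close>.\<close>

lemma inscribed_pair:
  assumes F: "frame P Q R M"
    and D: "lor D D = 1" "lor D Q = -1" "lor D R = -1" "D \<noteq> P"
    and E: "lor E E = 1" "lor E R = -1" "lor E P = -1" "E \<noteq> Q" and DE: "lor D E = -1"
  shows "lor D M * lor E M = 4"
proof -
  note d = inscribed_products[OF F D] and e = inscribed_products[OF frame_rotate[OF F] E]
  have "(1 - lor D P) * (1 - lor E Q) = 4 * (lor D M * lor E M)"
    using frame_lor[OF F, of D E] unfolding D E DE by (simp add: algebra_simps)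
  then have "(lor D M * lor E M) * (lor D M * lor E M) = 4 * (lor D M * lor E M)"
    unfolding d(1)[symmetric] e(1)[symmetric] by (simp add: power2_eq_square ac_simps)
  then show ?thesis using d(2) e(2) by simp
qed

lemma inscribed_opp:
  assumes F: "frame P Q R M" and D: "lor D Q = -1" "lor D R = -1" "lor D M = 2 * s" "(lor D M)\<^sup>2 = 1 - lor D P"
    and "s = 1 \<or> s = - 1"
  shows "D = opp P Q R (s *\<^sub>R M)"
proof -
  have "lor D P = -3" using assms by auto
  then show ?thesis using frame_expand[OF F, of D] unfolding D(1-3) opp_def by (simp add: algebra_simps)
qed

text \<open>The three heights over the frame have pairwise products 4, so all are 2 or all are -2;
  the sign is absorbed into the normal.\<close>

lemma octahedron_frame:
  assumes t: "tang P Q" "tang Q R" "tang R P" "tang D Q" "tang D R" "tang E R" "tang E P" "tang H P" "tang H Q"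
    "tang D E" "tang E H" "tang H D"
    and u: "lor P P = 1" "lor Q Q = 1" "lor R R = 1" "lor D D = 1" "lor E E = 1" "lor H H = 1"
    and ne: "D \<noteq> P" "E \<noteq> Q" "H \<noteq> R"
  shows "\<exists>M. frame P Q R M \<and> D = opp P Q R M \<and> E = opp Q R P M \<and> H = opp R P Q M"
proof -
  note l = t[THEN tang_products(1)]
  obtain M where F: "frame P Q R M"
    using frame_exists[OF u(1-3) l(1-3) t(1-3)[THEN tang_products(3)]] by blast
  note F2 = frame_rotate[OF F] and F3 = frame_rotate[OF frame_rotate[OF F]]
  note d = inscribed_products[OF F u(4) l(4,5) ne(1)] and e = inscribed_products[OF F2 u(5) l(6,7) ne(2)]
    and h = inscribed_products[OF F3 u(6) l(8,9) ne(3)]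
  have m: "lor D M * lor E M = 4" "lor E M * lor H M = 4" "lor H M * lor D M = 4"
    using inscribed_pair[OF F u(4) l(4,5) ne(1) u(5) l(6,7) ne(2) l(10)]
      inscribed_pair[OF F2 u(5) l(6,7) ne(2) u(6) l(8,9) ne(3) l(11)]
      inscribed_pair[OF F3 u(6) l(8,9) ne(3) u(4) l(4,5) ne(1) l(12)] by blast+
  then have "lor E M * (lor D M - lor H M) = 0" "lor D M * (lor E M - lor H M) = 0"
    by (simp_all add: algebra_simps)
  then have eq: "lor E M = lor D M" "lor H M = lor D M" using d(2) e(2) by simp_all
  define s where "s = lor D M / 2"
  have s: "lor D M = 2 * s" "lor E M = 2 * s" "lor H M = 2 * s" unfolding s_def eq by simp_all
  have "s\<^sup>2 = 1\<^sup>2" using m(1) unfolding s by (simp add: power2_eq_square)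
  then have s1: "s = 1 \<or> s = -1" by (simp only: power2_eq_iff)
  have "D = opp P Q R (s *\<^sub>R M)" "E = opp Q R P (s *\<^sub>R M)" "H = opp R P Q (s *\<^sub>R M)"
    using inscribed_opp[OF F l(4,5) s(1) d(1) s1] inscribed_opp[OF F2 l(6,7) s(2) e(1) s1]
      inscribed_opp[OF F3 l(8,9) s(3) h(1) s1] by blast+
  moreover have "frame P Q R (s *\<^sub>R M)" using s1 F frame_minus[OF F] by auto
  ultimately show ?thesis by blast
qed

lemma fills_frame:
  assumes v: "valid_gc A" "valid_gc B" "valid_gc C" and T: "mutually_tangent A B C"
    and F: "fills G A B C E1 E2 E3"
  shows "\<exists>M. frame (gvec A) (gvec B) (gvec C) M \<and>
    gvec ` {A, B, C, E1, E2, E3} = sext (gvec A) (gvec B) (gvec C) M"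
proof -
  obtain a b c where set: "{a, b, c} = {E1, E2, E3}" and
    t: "tangent a B" "tangent a C" "tangent b C" "tangent b A" "tangent c A" "tangent c B"
    "tangent a b" "tangent b c" "tangent c a" and ne: "a \<noteq> A" "b \<noteq> B" "c \<noteq> C"
    using fills_opposites[OF T F] by metis
  have "\<forall>E\<in>{E1, E2, E3}. valid_gc E" using F unfolding fills_def Let_def by blast
  then have w: "valid_gc a" "valid_gc b" "valid_gc c" unfolding set[symmetric] by blast+
  have T': "tangent A B" "tangent B C" "tangent C A"
    using T tangent_sym unfolding mutually_tangent_def by blast+
  have ne': "gvec a \<noteq> gvec A" "gvec b \<noteq> gvec B" "gvec c \<noteq> gvec C"
    using ne gvec_inject v w by blast+
  obtain M where M: "frame (gvec A) (gvec B) (gvec C) M" "gvec a = opp (gvec A) (gvec B) (gvec C) M"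
    "gvec b = opp (gvec B) (gvec C) (gvec A) M" "gvec c = opp (gvec C) (gvec A) (gvec B) M"
    using octahedron_frame[of "gvec A" "gvec B" "gvec C" "gvec a" "gvec b" "gvec c"]
      T' t v w ne' tangent_imp_tang lor_gvec by blast
  have "{A, B, C, E1, E2, E3} = {A, B, C} \<union> {a, b, c}" unfolding set by blast
  then have "gvec ` {A, B, C, E1, E2, E3} = sext (gvec A) (gvec B) (gvec C) M"
    unfolding sext_def M(2-4)[symmetric] by auto
  then show ?thesis using M(1) by blast
qed

section \<open>Vacant gaps are filled\<close>

lemma connected_interior_region:
  assumes "valid_gc X"
  shows "connected (interior (region X))"
proof (cases X)
  case (Circ c r)
  then show ?thesis by (simp add: convex_connected)
next
  case (Outer c r)
  have "{z. dist z c \<ge> r} = - ball c r"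
    unfolding ball_def by (auto simp: dist_commute[of _ c])
  moreover have "r > 0" using assms Outer by simp
  ultimately have "interior (region X) = - cball c r"
    unfolding Outer by (simp add: interior_complement)
  moreover have "connected (- cball c r)"
    by (rule connected_complement_bounded_convex) auto
  ultimately show ?thesis by simp
next
  case (Line u d)
  then show ?thesis
    unfolding Line region_line by (intro convex_connected convex_interior convex_halfspace_ge)
qed

text \<open>From a boundary point, moving against the unit gradient enters the interior.\<close>

lemma region_subset_closure:
  assumes X: "valid_gc X"
  shows "region X \<subseteq> closure (interior (region X))"
proof
  fix t assume "t \<in> region X"
  then have t: "ev (gvec X) t \<le> 0" using region_ev[OF X] by blast
  show "t \<in> closure (interior (region X))"
  proof (cases "ev (gvec X) t < 0")
    case True
    then have "t \<in> interior (region X)" using interior_region_ev[OF X] by blast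
    then show ?thesis using closure_subset by blast
  next
    case False
    then have 0: "ev (gvec X) t = 0" using t by simp
    let ?d = "- grad (gvec X) t"
    have "grad (gvec X) t \<bullet> ?d < 0"
      using grad_norm[of "gvec X" t] 0 lor_gvec[OF X] by (simp add: power2_norm_eq_inner)
    then have "\<forall>\<^sub>F s in at_right 0. ev (gvec X) (t + s *\<^sub>R ?d) < 0" using 0 by (intro ev_near_neg) blast
    then have "\<forall>\<^sub>F s in at_right 0. t + s *\<^sub>R ?d \<in> closure (interior (region X))"
      by (rule eventually_mono) (use closure_subset interior_region_ev[OF X] in blast)
    moreover have "((\<lambda>s. t + s *\<^sub>R ?d) \<longlongrightarrow> t + 0 *\<^sub>R ?d) (at_right 0)" by (intro tendsto_intros)
    ultimately show ?thesis
      using Lim_in_closed_set[OF closed_closure, of "\<lambda>s. t + s *\<^sub>R ?d" "interior (region X)" "at_right 0"]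
      by (simp add: trivial_limit_at_right_real)
  qed
qed

lemma interior_region_nonempty:
  assumes "valid_gc X"
  shows "interior (region X) \<noteq> {}"
proof (cases X)
  case (Outer c r)
  have "\<exists>z. z \<in> interior (region X)"
  proof -
    have "r > 0" using assms Outer by simp
    moreover have "dist (c + of_real (2 * r)) c = 2 * \<bar>r\<bar>"
      unfolding dist_norm add_diff_cancel_left' norm_of_real by simp
    ultimately have "ev (gvec X) (c + of_real (2 * r)) < 0"
      unfolding Outer gvec.simps ev_minus ev_circle[OF \<open>r > 0\<close>] by (simp add: power2_eq_square)
    then show ?thesis using interior_region_ev[OF assms] by blast
  qed
  then show ?thesis by blast
next
  case (Line u d)
  have n: "u \<bullet> u = 1" using assms Line by (simp add: norm_eq_1)
  have "ev (gvec X) ((d + 1) *\<^sub>R u) < 0" unfolding Line by (simp add: ev_eq n)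
  then show ?thesis using interior_region_ev[OF assms] by blast
qed (use assms in simp)

lemma continuous_on_ev: "continuous_on A (ev V)"
  unfolding ev_eq by (intro continuous_intros)

text \<open>Consequence used for gaps: where P, Q, R are all positive, M cannot vanish, so the
  circle M separates the two kinds of gaps.\<close>

lemma frame_ev:
  assumes "frame P Q R M"
  shows "2 * (ev M z)\<^sup>2 = ev P z * ev Q z + ev Q z * ev R z + ev R z * ev P z"
proof -
  define v :: cvec where "v = (1, z, (norm z)\<^sup>2)"
  have "lor v v = 0" by (simp add: v_def lor_self)
  then show ?thesis
    using frame_lor_self[OF assms, of v] unfolding ev_def v_def[symmetric]
      lor_commute[of M v] lor_commute[of P v] lor_commute[of Q v] lor_commute[of R v]
    by (simp add: power2_eq_square algebra_simps)
qed

lemma ev_sum_nonneg: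
  assumes "lor U U = 1" "lor V V = 1" "lor U V \<le> -1" "future (U + V)"
  shows "ev U z + ev V z \<ge> 0"
  using ev_nonneg[of "U + V" z] assms by (simp add: ev_add lor_simps lor_commute[of V U])

text \<open>\<open>fst (U + V) = 0\<close> means that the tangent circles \<open>U\<close> and \<open>V\<close> touch at infinity.\<close>

lemma three_tang_finite:
  assumes "lor D D = 1" "lor E E = 1" and DE: "tang D E" and EH: "tang E H" and HD: "tang H D"
    and "fst (D + E) = 0"
  shows "fst (E + H) \<noteq> 0" "fst (H + D) \<noteq> 0"
proof -
  have null: "fst U = 0 \<and> fst (snd V) = - fst (snd U)"
    if "lor U U = 1" "lor V V = 1" "tang U V" "fst (U + V) = 0" for U V
  proof -
    let ?S = "U + V"
    have l: "lor U V = -1" "lor V U = -1" using tang_products[OF that(3)] by blast+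
    have "lor ?S ?S = 0" "lor U ?S = 0" using that l by (simp_all add: lor_simps)
    then have z: "fst (snd ?S) = 0" using that(4) unfolding lor_self by simp
    have "?S \<noteq> 0" using that(3) unfolding tang_def by blast
    then have "snd (snd ?S) \<noteq> 0" using z that(4) by (auto simp: prod_eq_iff)
    moreover have "fst U * snd (snd ?S) = 0"
      using \<open>lor U ?S = 0\<close> unfolding lor_def z that(4) by simp
    ultimately have "fst U = 0" by simp
    moreover have "fst (snd V) = - fst (snd U)" using z by (simp add: eq_neg_iff_add_eq_0 add.commute)
    ultimately show ?thesis by blast
  qed
  have d: "fst D = 0" "fst (snd E) = - fst (snd D)" using null[OF assms(1,2) DE assms(6)] by blast+
  then have e: "fst E = 0" using assms(6) by simp
  \<comment> \<open>D and E are parallel lines with opposite normals, so for a third line the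
    products with D and E would be opposite numbers, not both -1.\<close>
  have False if h: "fst H = 0"
  proof -
    have "lor D H = fst (snd D) \<bullet> fst (snd H)" "lor E H = fst (snd E) \<bullet> fst (snd H)"
      using h d(1) e by (simp_all add: lor_def)
    then show False using tang_products[OF EH] tang_products[OF HD] d(2) by simp
  qed
  then show "fst (E + H) \<noteq> 0" "fst (H + D) \<noteq> 0" using d(1) e by auto
qed

lemma octahedron_counts:
  assumes S: "S = {X, Y1, Y2, Y3, Y4, Z}" "distinct [X, Y1, Y2, Y3, Y4, Z]"
    and t: "tangent X Y1" "tangent X Y2" "tangent X Y3" "tangent X Y4" and d: "disjoint_gc X Z"
  shows "card {Y \<in> S - {X}. tangent X Y} = 4 \<and> card {Y \<in> S - {X}. disjoint_gc X Y} = 1"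
proof -
  have "\<not> tangent X Z" using d tangent_not_disjoint by blast
  then have "{Y \<in> S - {X}. tangent X Y} = {Y1, Y2, Y3, Y4}"
    unfolding S(1) using S(2) t by auto
  moreover have "{Y \<in> S - {X}. disjoint_gc X Y} = {Z}"
    unfolding S(1) using S(2) t[THEN tangent_not_disjoint] d by auto
  ultimately show ?thesis using S(2) by simp
qed

lemma tangI:
  assumes "lor U V = -1" "future (U + V)" "lor U W + lor V W \<noteq> 0"
  shows "tang U V"
proof -
  have "U + V \<noteq> 0"
  proof
    assume "U + V = 0"
    then have "lor (U + V) W = 0" by (simp add: lor_def)
    then show False using assms(3) by (simp add: lor_add_left)
  qed
  then show ?thesis using assms(1,2) unfolding tang_def by blast
qed

lemma frame_tang:
  assumes "frame P Q R M"
  shows "tang P Q" "tang Q R" "tang R P"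
  using assms frame_products[OF assms] tangI[of P Q R] tangI[of Q R P] tangI[of R P Q]
  unfolding frame_def by simp_all

text \<open>Each sum is tested by \<open>futureI\<close> against the sum of two circles of the
  triple, chosen so that the total of the products is negative.\<close>

lemma opp_future:
  assumes F: "frame P Q R M"
  shows "future (opp P Q R M + P)" "future (opp P Q R M + Q)" "future (opp P Q R M + R)"
    "future (opp P Q R M + opp Q R P M)"
proof -
  note p = frame_products[OF F] and o = opp_products[OF F] and o2 = opp_products[OF frame_rotate[OF F]]
  have W: "lor (Q + R) (Q + R) \<le> 0" "future (Q + R)" "lor (P + R) (P + R) \<le> 0" "future (P + R)"
    using F p unfolding frame_def by (simp_all add: lor_simps add.commute)
  show "future (opp P Q R M + P)" by (rule futureI[OF _ W(1,2)]) (simp_all add: lor_simps o p lor_commute[of P "opp P Q R M"])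
  show "future (opp P Q R M + Q)" by (rule futureI[OF _ W(3,4)]) (simp_all add: lor_simps o p lor_commute[of Q "opp P Q R M"])
  show "future (opp P Q R M + R)"
  proof (rule futureI)
    show "lor (P + Q) (P + Q) \<le> 0" "future (P + Q)" using F p unfolding frame_def by (simp_all add: lor_simps)
  qed (simp_all add: lor_simps o p lor_commute[of R "opp P Q R M"])
  show "future (opp P Q R M + opp Q R P M)"
    by (rule futureI[OF _ W(1,2)]) (simp_all add: lor_simps o o2 p lor_commute[of "opp Q R P M" "opp P Q R M"])
qed

lemma opp_tang:
  assumes F: "frame P Q R M"
  shows "tang (opp P Q R M) Q" "tang (opp P Q R M) R" "tang (opp P Q R M) (opp Q R P M)"
  using frame_products[OF F] opp_products[OF F] opp_products[OF frame_rotate[OF F]] opp_future[OF F]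
    tangI[of "opp P Q R M" Q R] tangI[of "opp P Q R M" R Q] tangI[of "opp P Q R M" "opp Q R P M" R]
  by simp_all

lemma opp_pos:
  assumes F: "frame P Q R M" and "ev (opp P Q R M) z \<le> 0"
  shows "ev P z \<ge> 0" "ev Q z \<ge> 0" "ev R z \<ge> 0"
    "ev (opp P Q R M) z < 0 \<Longrightarrow> ev P z > 0 \<and> ev Q z > 0 \<and> ev R z > 0"
proof -
  note p = frame_products[OF F] and o = opp_products[OF F] and fu = opp_future[OF F]
  have "ev (opp P Q R M) z + ev P z \<ge> 0" "ev (opp P Q R M) z + ev Q z \<ge> 0" "ev (opp P Q R M) z + ev R z \<ge> 0"
    using ev_sum_nonneg[OF o(1) p(1) _ fu(1)] ev_sum_nonneg[OF o(1) p(2) _ fu(2)]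
      ev_sum_nonneg[OF o(1) p(3) _ fu(3)] o by simp_all
  then show "ev P z \<ge> 0" "ev Q z \<ge> 0" "ev R z \<ge> 0"
    "ev (opp P Q R M) z < 0 \<Longrightarrow> ev P z > 0 \<and> ev Q z > 0 \<and> ev R z > 0"
    using assms(2) by linarith+
qed

text \<open>The closed disc of an inscribed circle minus its tangency points with \<open>P, Q, R\<close>.\<close>

definition pointed :: "cvec \<Rightarrow> cvec \<Rightarrow> cvec \<Rightarrow> cvec \<Rightarrow> complex set" where
  "pointed P Q R D = {z. ev D z \<le> 0 \<and> ev P z > 0 \<and> ev Q z > 0 \<and> ev R z > 0}"

lemma pointed_rotate: "pointed Q R P D = pointed P Q R D"
  unfolding pointed_def by blast

text \<open>The pointed disc lies between the connected interior and its closure.\<close>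

lemma connected_pointed:
  assumes F: "frame P Q R M" and X: "valid_gc X" "gvec X = opp P Q R M"
  shows "connected (pointed P Q R (opp P Q R M))" "interior (region X) \<subseteq> pointed P Q R (opp P Q R M)"
proof -
  show sub: "interior (region X) \<subseteq> pointed P Q R (opp P Q R M)"
  proof
    fix z assume "z \<in> interior (region X)"
    then have "ev (opp P Q R M) z < 0" using interior_region_ev[OF X(1)] X(2) by simp
    then show "z \<in> pointed P Q R (opp P Q R M)" using opp_pos(4)[OF F] unfolding pointed_def by simp
  qed
  have "pointed P Q R (opp P Q R M) \<subseteq> region X"
    unfolding region_ev[OF X(1)] X(2) pointed_def by blast
  then have "pointed P Q R (opp P Q R M) \<subseteq> closure (interior (region X))"
    using region_subset_closure[OF X(1)] by blast
  then show "connected (pointed P Q R (opp P Q R M))"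
    using connected_intermediate_closure[OF connected_interior_region[OF X(1)] sub] by blast
qed

text \<open>The touching point of two inscribed circles is the null vector S up to scale; P, Q, R
  pair negatively with S, so it lies strictly outside their regions.\<close>

lemma pointed_meet:
  assumes F: "frame P Q R M" and "fst (opp P Q R M + opp Q R P M) \<noteq> 0"
  shows "pointed P Q R (opp P Q R M) \<inter> pointed P Q R (opp Q R P M) \<noteq> {}"
proof -
  let ?D = "opp P Q R M" and ?E = "opp Q R P M"
  let ?S = "?D + ?E"
  note o = opp_products[OF F] and o2 = opp_products[OF frame_rotate[OF F]]
  have DE: "lor ?D ?E = -1" "lor ?E ?D = -1" using o(6) lor_commute[of ?D ?E] by simp_all
  have S: "lor ?S ?S = 0" "future ?S" using o(1) o2(1) DE opp_future(4)[OF F] by (simp_all add: lor_simps)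
  have pos: "fst ?S > 0" using S(2) assms(2) unfolding future_def by linarith
  let ?t = "(1 / fst ?S) *\<^sub>R fst (snd ?S)"
  note ev = null_point(2)[OF S assms(2)]
  have "ev ?D ?t = 0" "ev ?E ?t = 0"
    unfolding ev using o(1) o2(1) DE by (simp_all add: lor_simps)
  moreover have "lor V ?S < 0" if "V = P \<or> V = Q \<or> V = R" for V
    unfolding lor_commute[of V] using that o o2 by (auto simp: lor_add_left)
  then have "ev V ?t > 0" if "V = P \<or> V = Q \<or> V = R" for V
    unfolding ev using pos that by (intro divide_pos_pos) simp_all
  ultimately have "?t \<in> pointed P Q R ?D \<inter> pointed P Q R ?E" unfolding pointed_def by simp
  then show ?thesis by blast
qed

text \<open>At most one of the three pairs touches at infinity; the other two touching points chain
  the discs together.\<close>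

lemma connected_pointed_union:
  assumes F: "frame P Q R M"
    and X: "valid_gc X" "gvec X = opp P Q R M" and Y: "valid_gc Y" "gvec Y = opp Q R P M"
    and Z: "valid_gc Z" "gvec Z = opp R P Q M"
  shows "connected (pointed P Q R (opp P Q R M) \<union> pointed P Q R (opp Q R P M) \<union> pointed P Q R (opp R P Q M))"
proof -
  let ?D = "opp P Q R M" and ?E = "opp Q R P M" and ?H = "opp R P Q M"
  note F2 = frame_rotate[OF F]
  note F3 = frame_rotate[OF F2]
  note o = opp_products[OF F] and o2 = opp_products[OF F2] and o3 = opp_products[OF F3]
  note t = opp_tang(3)[OF F] opp_tang(3)[OF F2] opp_tang(3)[OF F3]
  have c: "connected (pointed P Q R ?D)" "connected (pointed P Q R ?E)" "connected (pointed P Q R ?H)"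
    using connected_pointed(1)[OF F X] connected_pointed(1)[OF F2 Y] connected_pointed(1)[OF F3 Z]
    by (simp_all add: pointed_rotate)
  have meet: "pointed P Q R ?D \<inter> pointed P Q R ?E \<noteq> {}" if "fst (?D + ?E) \<noteq> 0"
    using pointed_meet[OF F] that by blast
  have meet2: "pointed P Q R ?E \<inter> pointed P Q R ?H \<noteq> {}" if "fst (?E + ?H) \<noteq> 0"
    using pointed_meet[OF F2] that by (simp add: pointed_rotate)
  have meet3: "pointed P Q R ?H \<inter> pointed P Q R ?D \<noteq> {}" if "fst (?H + ?D) \<noteq> 0"
    using pointed_meet[OF F3] that by (simp add: pointed_rotate)
  have two: "connected (A \<union> B \<union> C)" if "connected A" "connected B" "connected C" "A \<inter> B \<noteq> {}" "B \<inter> C \<noteq> {}"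
    for A B C :: "complex set"
    using that by (intro connected_Un) auto
  consider "fst (?D + ?E) \<noteq> 0" "fst (?E + ?H) \<noteq> 0" | "fst (?D + ?E) = 0" | "fst (?E + ?H) = 0" by blast
  then show ?thesis
  proof cases
    case 1
    then show ?thesis using two[OF c meet meet2] by blast
  next
    case 2
    then have "fst (?E + ?H) \<noteq> 0" "fst (?H + ?D) \<noteq> 0"
      using three_tang_finite[OF o(1) o2(1) t] by blast+
    then have "connected (pointed P Q R ?E \<union> pointed P Q R ?H \<union> pointed P Q R ?D)"
      using two[OF c(2,3,1) meet2 meet3] by blast
    then show ?thesis by (simp add: Un_ac)
  next
    case 3
    then have "fst (?H + ?D) \<noteq> 0" "fst (?D + ?E) \<noteq> 0"
      using three_tang_finite[OF o2(1) o3(1) t(2,3,1)] by blast+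
    then have "connected (pointed P Q R ?H \<union> pointed P Q R ?D \<union> pointed P Q R ?E)"
      using two[OF c(3,1,2) meet3 meet] by blast
    then show ?thesis by (simp add: Un_ac)
  qed
qed

lemma octahedron_fills_counts:
  assumes d: "distinct [A, B, C, a, b, c]"
    and t: "tangent A B" "tangent B C" "tangent A C" "tangent a B" "tangent a C" "tangent b C" "tangent b A"
      "tangent c A" "tangent c B" "tangent a b" "tangent b c" "tangent c a"
    and dis: "disjoint_gc a A" "disjoint_gc b B" "disjoint_gc c C"
    and v: "\<forall>E\<in>{a, b, c}. valid_gc E \<and> interior (region E) \<subseteq> G"
  shows "fills G A B C a b c"
proof -
  define S where "S = {A, B, C, a, b, c}"
  note t' = t t[THEN tangent_sym] and dis' = dis dis[THEN disjoint_gc_sym]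
  have perm: "S = {A, B, C, b, c, a}" "S = {B, A, C, a, c, b}" "S = {C, A, B, a, b, c}"
    "S = {a, B, C, b, c, A}" "S = {b, A, C, a, c, B}" "S = {c, A, B, a, b, C}"
    unfolding S_def by (simp_all add: insert_commute)
  have "card {Y \<in> S - {X}. tangent X Y} = 4 \<and> card {Y \<in> S - {X}. disjoint_gc X Y} = 1" if X: "X \<in> S" for X
  proof -
    consider "X = A" | "X = B" | "X = C" | "X = a" | "X = b" | "X = c" using X unfolding S_def by blast
    then show ?thesis
    proof cases
      case 1
      show ?thesis unfolding 1 by (rule octahedron_counts[OF perm(1)]) (use d t' dis' in auto)
    next
      case 2
      show ?thesis unfolding 2 by (rule octahedron_counts[OF perm(2)]) (use d t' dis' in auto)
    next
      case 3
      show ?thesis unfolding 3 by (rule octahedron_counts[OF perm(3)]) (use d t' dis' in auto)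
    next
      case 4
      show ?thesis unfolding 4 by (rule octahedron_counts[OF perm(4)]) (use d t' dis' in auto)
    next
      case 5
      show ?thesis unfolding 5 by (rule octahedron_counts[OF perm(5)]) (use d t' dis' in auto)
    next
      case 6
      show ?thesis unfolding 6 by (rule octahedron_counts[OF perm(6)]) (use d t' dis' in auto)
    qed
  qed
  moreover have "card S = 6" unfolding S_def using distinct_card[OF d] by simp
  ultimately show ?thesis unfolding fills_def Let_def S_def[symmetric] using v by blast
qed

text \<open>After rescaling M to the unit vector N, the frame relation and the three products <= -1
  give \<open>lor X M\<close> <= -sqrt 2, hence \<open>lor X N\<close> <= -2. Then X+N is causal and
  future, so X and N are not both negative at a point.\<close>

lemma vacant_side:
  assumes F: "frame P Q R M" and X: "lor X X = 1" "lor X P \<le> -1" "lor X Q \<le> -1" "lor X R \<le> -1" "lor X M < 0"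
    and "ev X z < 0"
  shows "ev M z > 0"
proof -
  let ?N = "sqrt 2 *\<^sub>R M"
  have "1 \<le> lor X P * lor X Q" "1 \<le> lor X Q * lor X R" "1 \<le> lor X R * lor X P"
    using mult_mono[of 1 "- lor X P" 1 "- lor X Q"] mult_mono[of 1 "- lor X Q" 1 "- lor X R"]
      mult_mono[of 1 "- lor X R" 1 "- lor X P"] X by simp_all
  then have "(sqrt 2)\<^sup>2 \<le> (- lor X M)\<^sup>2" using frame_lor_self[OF F, of X] X(1) by simp
  then have "sqrt 2 \<le> - lor X M" by (rule power2_le_imp_le) (use X in simp)
  then have "sqrt 2 * sqrt 2 \<le> sqrt 2 * - lor X M" by (intro mult_left_mono) simp_all
  then have b: "sqrt 2 * lor X M \<le> - 2" by simp
  have XN: "lor (X + ?N) (X + ?N) = 3 / 2 + 1 / 2 + 2 * (sqrt 2 * lor X M)"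
    using X(1) frame_products(16)[OF F] by (simp add: lor_simps lor_commute[of M X] algebra_simps)
  have "lor (X + ?N) (X + ?N) \<le> 0" unfolding XN using b by simp
  moreover have "future (X + ?N)"
  proof (rule futureI)
    show "lor (X + ?N) (X + ?N) \<le> 0" by fact
    show "lor (P + Q) (P + Q) \<le> 0" "future (P + Q)"
      using F frame_products[OF F] unfolding frame_def by (simp_all add: lor_simps)
    show "lor (X + ?N) (P + Q) < 0" using X frame_products[OF F] by (simp add: lor_simps)
  qed
  ultimately have "ev (X + ?N) z \<ge> 0" by (rule ev_nonneg)
  moreover have "ev ?N z = sqrt 2 * ev M z" by (simp add: ev_def lor_simps)
  ultimately have "sqrt 2 * ev M z > 0" using \<open>ev X z < 0\<close> by (simp add: ev_add)
  then show ?thesis by (simp add: zero_less_mult_iff)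
qed

text \<open>The gap is the component containing the connected union H of the pointed inscribed
  discs. M has no zero outside P, Q, R, so it stays negative on this component, whereas the
  interiors of all other circles lie where M is positive.\<close>

lemma vacant_fill:
  assumes val: "\<And>X. X \<in> Cs \<Longrightarrow> valid_gc X" and cfg: "config (gvec ` Cs)"
    and A: "A \<in> Cs" "B \<in> Cs" "C \<in> Cs" and V: "vacant (gvec ` Cs) (gvec A) (gvec B) (gvec C) M"
  shows "\<exists>G E1 E2 E3. is_gap Cs A B C G \<and> fills G A B C E1 E2 E3 \<and>
    sext (gvec A) (gvec B) (gvec C) M = gvec ` {A, B, C, E1, E2, E3}"
proof -
  let ?P = "gvec A" and ?Q = "gvec B" and ?R = "gvec C"
  note vA = val[OF A(1)] val[OF A(2)] val[OF A(3)]
  note F = vacantD(1)[OF V]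
  note F2 = frame_rotate[OF F]
  note F3 = frame_rotate[OF F2]
  note p = frame_products[OF F]
  note o = opp_products[OF F] and o2 = opp_products[OF F2] and o3 = opp_products[OF F3]
  obtain a where a: "valid_gc a" "gvec a = opp ?P ?Q ?R M" using gvec_surj[OF o(1)] by blast
  obtain b where b: "valid_gc b" "gvec b = opp ?Q ?R ?P M" using gvec_surj[OF o2(1)] by blast
  obtain c where c: "valid_gc c" "gvec c = opp ?R ?P ?Q M" using gvec_surj[OF o3(1)] by blast
  define U where "U = - (region A \<union> region B \<union> region C)"
  have U: "z \<in> U \<longleftrightarrow> ev ?P z > 0 \<and> ev ?Q z > 0 \<and> ev ?R z > 0" for z
    unfolding U_def region_ev[OF vA(1)] region_ev[OF vA(2)] region_ev[OF vA(3)]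
    by (simp add: not_le)
  define H where "H = pointed ?P ?Q ?R (gvec a) \<union> pointed ?P ?Q ?R (gvec b) \<union> pointed ?P ?Q ?R (gvec c)"
  have H: "connected H" unfolding H_def a(2) b(2) c(2) by (rule connected_pointed_union[OF F a b c])
  have HU: "H \<subseteq> U" unfolding H_def pointed_def using U by blast
  have int: "interior (region a) \<subseteq> H" "interior (region b) \<subseteq> H" "interior (region c) \<subseteq> H"
    using connected_pointed(2)[OF F a] connected_pointed(2)[OF F2 b] connected_pointed(2)[OF F3 c]
    unfolding H_def a(2)[symmetric] b(2)[symmetric] c(2)[symmetric] pointed_rotate[of ?P ?Q ?R]
      pointed_rotate[of ?Q ?R ?P] by blast+
  obtain z0 where z0: "z0 \<in> interior (region a)" using interior_region_nonempty[OF a(1)] by blast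
  define G where "G = connected_component_set U z0"
  have HG: "H \<subseteq> G" unfolding G_def using connected_component_maximal[OF _ H HU] z0 int by blast
  have GU: "G \<subseteq> U" unfolding G_def by (rule connected_component_subset)
  have z0': "ev M z0 < 0"
  proof -
    have neg: "ev (opp ?P ?Q ?R M) z0 < 0" using z0 interior_region_ev[OF a(1)] a(2) by simp
    then have "ev ?P z0 > 0 \<and> ev ?Q z0 > 0 \<and> ev ?R z0 > 0" using opp_pos(4)[OF F] by simp
    moreover have "ev (opp ?P ?Q ?R M) z0 = ev ?P z0 + 2 * (ev ?Q z0 + ev ?R z0) + 4 * ev M z0"
      by (simp add: ev_def lor_opp_left algebra_simps)
    ultimately show ?thesis using neg by argo
  qed
  have side: "ev M w < 0" if w: "w \<in> G" for w
  proof (rule ccontr)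
    assume "\<not> ?thesis"
    then have "0 \<le> ev M w" by simp
    have "connected (ev M ` G)"
      unfolding G_def using continuous_on_ev by (intro connected_continuous_image connected_connected_component)
    moreover have "z0 \<in> G" using z0 int HG by blast
    ultimately have "0 \<in> ev M ` G"
      using connectedD_interval[of "ev M ` G" "ev M z0" "ev M w" 0] w z0' \<open>0 \<le> ev M w\<close> by simp
    then obtain y where y: "y \<in> G" "ev M y = 0" by auto
    then have "ev ?P y > 0" "ev ?Q y > 0" "ev ?R y > 0" using GU U by blast+
    then have "ev ?P y * ev ?Q y > 0" "ev ?Q y * ev ?R y > 0" "ev ?R y * ev ?P y > 0" by simp_all
    then show False using frame_ev[OF F, of y] y(2) by simp
  qed
  have empty: "interior (region X) \<inter> G = {}" if X: "X \<in> Cs" for X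
  proof (cases "X = A \<or> X = B \<or> X = C")
    case True
    then have "region X \<inter> U = {}" unfolding U_def by blast
    then show ?thesis using GU interior_subset by blast
  next
    case False
    then have ne: "gvec X \<noteq> ?P" "gvec X \<noteq> ?Q" "gvec X \<noteq> ?R" using gvec_inject val X A by blast+
    have XS: "gvec X \<in> gvec ` Cs" using X by blast
    have "lor (gvec X) ?P \<le> -1" "lor (gvec X) ?Q \<le> -1" "lor (gvec X) ?R \<le> -1"
      using config.sep[OF cfg XS] ne A by blast+
    moreover have "lor (gvec X) M < 0" using vacantD(5)[OF V XS ne] .
    ultimately have "ev M z > 0" if "ev (gvec X) z < 0" for z
      using vacant_side[OF F lor_gvec[OF val[OF X]]] that by blast
    then show ?thesis unfolding interior_region_ev[OF val[OF X]] using side by fastforce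
  qed
  have T: "tangent A B" "tangent B C" "tangent C A"
    using frame_tang[OF F] tang_imp_tangent vA by blast+
  have gap: "is_gap Cs A B C G"
    unfolding is_gap_def mutually_tangent_def
  proof (intro conjI ballI)
    show "\<exists>z. z \<notin> region A \<union> region B \<union> region C \<and> G = connected_component_set (- (region A \<union> region B \<union> region C)) z"
      using z0 int HU unfolding G_def U_def by blast
  qed (use A T tangent_sym empty in blast)+
  note f = opp_future[OF F] and f2 = opp_future[OF F2] and f3 = opp_future[OF F3]
  have t: "tangent a B" "tangent a C" "tangent b C" "tangent b A" "tangent c A" "tangent c B"
    "tangent a b" "tangent b c" "tangent c a"
    using opp_tang[OF F] opp_tang[OF F2] opp_tang[OF F3] tang_imp_tangent a(1) b(1) c(1) vA
    unfolding a(2)[symmetric] b(2)[symmetric] c(2)[symmetric] by blast+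
  have dis: "disjoint_gc a A" "disjoint_gc b B" "disjoint_gc c C"
    using disjoint_gcI[OF a(1) vA(1)] disjoint_gcI[OF b(1) vA(2)] disjoint_gcI[OF c(1) vA(3)]
      o(2) o2(2) o3(2) f(1) f2(1) f3(1) unfolding a(2) b(2) c(2) by simp_all
  have tne: "X \<noteq> Y" if "tangent X Y" for X Y using that unfolding tangent_def by blast
  have dne: "gvec a \<noteq> gvec A" "gvec b \<noteq> gvec B" "gvec c \<noteq> gvec C"
    unfolding a(2) b(2) c(2) using p o(2) o2(2) o3(2) by auto
  have "distinct [A, B, C, a, b, c]"
    using tne[OF T(1)] tne[OF T(2)] tne[OF T(3)] t[THEN tne] dne by auto
  then have "fills G A B C a b c"
    using octahedron_fills_counts[of A B C a b c G] T tangent_sym[OF T(3)] t dis a(1) b(1) c(1) int HG by blast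
  moreover have "sext ?P ?Q ?R M = gvec ` {A, B, C, a, b, c}" unfolding sext_def a(2)[symmetric] b(2)[symmetric] c(2)[symmetric] by simp
  ultimately show ?thesis using gap by blast
qed

section \<open>The packing\<close>

lemma stage_valid:
  assumes "initial_triple A B C"
  shows "X \<in> stage A B C k \<Longrightarrow> valid_gc X"
proof (induction k arbitrary: X)
  case 0
  then show ?case using assms unfolding initial_triple_def by auto
next
  case (Suc k)
  show ?case
  proof (cases "X \<in> stage A B C k")
    case True
    then show ?thesis by (rule Suc.IH)
  next
    case False
    then obtain P Q R G E1 E2 E3 where "fills G P Q R E1 E2 E3" "X \<in> {E1, E2, E3}"
      using Suc.prems by auto
    then show ?thesis unfolding fills_def Let_def by blast
  qed
qed

text \<open>A circle inscribed in a gap cannot be old, because its nonempty interior lies in the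
  gap; so the octahedron is not yet present and the dichotomy gives vacancy. Conversely
  \<open>vacant_fill\<close> realizes each vacant side as a filled gap.\<close>

lemma stage_Suc_grow:
  assumes I: "initial_triple A B C" and cfg: "config (gvec ` stage A B C k)"
  shows "gvec ` stage A B C (Suc k) = grow (gvec ` stage A B C k)"
proof (rule set_eqI, rule iffI)
  let ?S = "stage A B C k"
  note val = stage_valid[OF I, of _ k]
  fix V assume "V \<in> gvec ` stage A B C (Suc k)"
  then obtain X where X: "X \<in> stage A B C (Suc k)" "V = gvec X" by blast
  show "V \<in> grow (gvec ` ?S)"
  proof (cases "X \<in> ?S")
    case True
    then show ?thesis using X(2) unfolding grow_def by blast
  next
    case False
    then obtain P Q R G E1 E2 E3 where g: "is_gap ?S P Q R G" and f: "fills G P Q R E1 E2 E3"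
      and E: "X \<in> {E1, E2, E3}"
      using X(1) by auto
    have PQR: "P \<in> ?S" "Q \<in> ?S" "R \<in> ?S" and T: "mutually_tangent P Q R"
      and empty: "\<And>Y. Y \<in> ?S \<Longrightarrow> interior (region Y) \<inter> G = {}"
      using g unfolding is_gap_def by blast+
    obtain M where M: "frame (gvec P) (gvec Q) (gvec R) M"
      "gvec ` {P, Q, R, E1, E2, E3} = sext (gvec P) (gvec Q) (gvec R) M"
      using fills_frame[OF val[OF PQR(1)] val[OF PQR(2)] val[OF PQR(3)] T f] by blast
    have E1: "valid_gc E1" "interior (region E1) \<subseteq> G" using f unfolding fills_def Let_def by blast+
    have "E1 \<notin> ?S" using empty[of E1] E1(2) interior_region_nonempty[OF E1(1)] by blast
    then have "gvec E1 \<notin> gvec ` ?S" using gvec_inject[OF E1(1)] val by (metis imageE)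
    then have "\<not> sext (gvec P) (gvec Q) (gvec R) M \<subseteq> gvec ` ?S" unfolding M(2)[symmetric] by blast
    then have "vacant (gvec ` ?S) (gvec P) (gvec Q) (gvec R) M"
      using config.dichotomy[OF cfg _ _ _ M(1)] PQR by blast
    then show ?thesis using sext_subset_grow M(2) E X(2) by blast
  qed
next
  let ?S = "stage A B C k"
  note val = stage_valid[OF I, of _ k]
  fix V assume "V \<in> grow (gvec ` ?S)"
  then show "V \<in> gvec ` stage A B C (Suc k)"
  proof (rule growE)
    assume "V \<in> gvec ` ?S"
    then show ?thesis by auto
  next
    fix p q r M assume V: "vacant (gvec ` ?S) p q r M" "V \<in> sext p q r M"
    obtain P Q R where PQR: "P \<in> ?S" "Q \<in> ?S" "R \<in> ?S" "p = gvec P" "q = gvec Q" "r = gvec R"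
      using vacantD(2-4)[OF V(1)] by blast
    obtain G E1 E2 E3 where g: "is_gap ?S P Q R G" "fills G P Q R E1 E2 E3"
      and s: "sext p q r M = gvec ` {P, Q, R, E1, E2, E3}"
      using vacant_fill[OF val cfg PQR(1-3) V(1)[unfolded PQR(4-6)]] unfolding PQR(4-6) by blast
    have "E \<in> stage A B C (Suc k)" if "E \<in> {E1, E2, E3}" for E
      unfolding stage.simps using g that by blast
    moreover have "E \<in> stage A B C (Suc k)" if "E \<in> {P, Q, R}" for E
      using that PQR by auto
    ultimately show ?thesis using V(2) unfolding s by blast
  qed
qed

lemma initial_frame:
  assumes I: "initial_triple A B C"
  shows "\<exists>M. frame (gvec A) (gvec B) (gvec C) M"
proof -
  have v: "valid_gc A" "valid_gc B" "valid_gc C" and T: "tangent A B" "tangent B C" "tangent A C"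
    using I unfolding initial_triple_def mutually_tangent_def by blast+
  have "tang (gvec A) (gvec B)" "tang (gvec B) (gvec C)" "tang (gvec C) (gvec A)"
    using tangent_imp_tang v T tangent_sym[OF T(3)] by blast+
  then show ?thesis using frame_exists lor_gvec v tang_products by blast
qed

lemma config_stage_0:
  assumes I: "initial_triple A B C"
  shows "config (gvec ` stage A B C 0)"
proof -
  obtain M where F: "frame (gvec A) (gvec B) (gvec C) M" using initial_frame[OF I] by blast
  have S: "gvec ` stage A B C 0 = {gvec A, gvec B, gvec C}" by simp
  have pair: "lor X Y = -1 \<and> future (X + Y)" if "X \<in> {gvec A, gvec B, gvec C}" "Y \<in> {gvec A, gvec B, gvec C}" "X \<noteq> Y" for X Y
    using F that frame_products[OF F] unfolding frame_def by (elim insertE emptyE) (simp_all add: add.commute)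
  show ?thesis unfolding S
  proof
    fix X assume "X \<in> {gvec A, gvec B, gvec C}"
    then show "lor X X = 1" using frame_products(1-3)[OF F] by (elim insertE emptyE) simp_all
  next
    \<comment> \<open>Every frame uses all three circles, so both of its sides are vacant for want
      of a fourth circle.\<close>
    fix P Q R N assume PQR: "P \<in> {gvec A, gvec B, gvec C}" "Q \<in> {gvec A, gvec B, gvec C}"
      "R \<in> {gvec A, gvec B, gvec C}" and G: "frame P Q R N"
    have "card {P, Q, R} = 3" using frame_distinct[OF G] by simp
    moreover have "card {gvec A, gvec B, gvec C} \<le> 3" by (simp add: card_insert_if)
    ultimately have "{P, Q, R} = {gvec A, gvec B, gvec C}"
      using PQR by (intro card_seteq) auto
    then show "sext P Q R N \<subseteq> {gvec A, gvec B, gvec C} \<or> vacant {gvec A, gvec B, gvec C} P Q R N"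
      unfolding vacant_def using PQR G by blast
  qed (use pair in auto)
qed

lemma config_stage:
  assumes I: "initial_triple A B C"
  shows "config (gvec ` stage A B C k)"
proof (induction k)
  case 0
  show ?case by (rule config_stage_0[OF I])
next
  case (Suc k)
  then show ?case unfolding stage_Suc_grow[OF I Suc] by (rule config.config_grow)
qed

text \<open>\<open>frame_lor_self\<close> at (0, 0, 1), the null vector of the point at infinity,
  whose product with V is -k/2.\<close>

lemma frame_curvature:
  assumes "frame P Q R M"
  shows "2 * (fst M)\<^sup>2 = fst P * fst Q + fst Q * fst R + fst R * fst P"
proof -
  define v :: cvec where "v = (0, 0, 1)"
  have l: "lor v V = - fst V / 2" for V by (simp add: v_def lor_def)
  have "lor v v = 0" by (simp add: l) (simp add: v_def)
  then show ?thesis using frame_lor_self[OF assms, of v] unfolding l by (simp add: power2_eq_square)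
qed

text \<open>With the new normal, \<open>opp\<close> leads back to P: the same octahedron seen from
  the adjacent face through Q and R.\<close>

lemma frame_flip:
  assumes F: "frame P Q R M"
  shows "frame (opp P Q R M) Q R (- M - (Q + R))"
proof -
  let ?O = "opp P Q R M"
  note p = frame_products[OF F] and o = opp_products[OF F] and f = opp_future[OF F]
  have c: "lor Q ?O = -1" "lor R ?O = -1" "lor M ?O = 2"
    using o lor_commute[of Q ?O] lor_commute[of R ?O] lor_commute[of M ?O] by simp_all
  have "future (Q + R)" using F unfolding frame_def by blast
  moreover have "future (R + ?O)" using f(3) by (simp only: add.commute[of R ?O])
  ultimately show ?thesis
    unfolding frame_def using f(2) by (intro conjI) (simp_all add: p o c lor_simps)
qed

section \<open>Integer states realized in an integral packing\<close>

locale integral_triple =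
  fixes A B C :: gcircle
  assumes initial: "initial_triple A B C" and integral: "integral_packing A B C"
begin

abbreviation S :: "nat \<Rightarrow> cvec set" where
  "S k \<equiv> gvec ` stage A B C k"

definition circles :: "cvec set" where
  "circles = gvec ` packing A B C"

lemma S_Suc: "S (Suc k) = grow (S k)"
  using stage_Suc_grow[OF initial config_stage[OF initial]] .

lemma S_mono: "j \<le> k \<Longrightarrow> S j \<subseteq> S k"
  by (induction k rule: dec_induct) (auto simp: S_Suc grow_def)

lemma circles_eq: "circles = (\<Union>k. S k)"
  unfolding circles_def packing_def by blast

lemma circles_triple:
  assumes "P \<in> circles" "Q \<in> circles" "R \<in> circles"
  shows "\<exists>k. P \<in> S k \<and> Q \<in> S k \<and> R \<in> S k"
proof -
  obtain i j k where "P \<in> S i" "Q \<in> S j" "R \<in> S k" using assms unfolding circles_eq by blast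
  moreover have "S i \<subseteq> S (i + j + k)" "S j \<subseteq> S (i + j + k)" "S k \<subseteq> S (i + j + k)"
    by (rule S_mono, simp)+
  ultimately show ?thesis by blast
qed

lemma sext_circles:
  assumes "P \<in> circles" "Q \<in> circles" "R \<in> circles" "frame P Q R M"
  shows "sext P Q R M \<subseteq> circles"
proof -
  obtain k where k: "P \<in> S k" "Q \<in> S k" "R \<in> S k" using circles_triple[OF assms(1-3)] by blast
  have "sext P Q R M \<subseteq> S k \<or> vacant (S k) P Q R M"
    using config.dichotomy[OF config_stage[OF initial] k assms(4)] .
  then have "sext P Q R M \<subseteq> S k \<or> sext P Q R M \<subseteq> S (Suc k)"
    unfolding S_Suc using sext_subset_grow by blast
  then show ?thesis unfolding circles_eq by blast
qed

lemma circle_curvature: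
  assumes "X \<in> circles"
  shows "fst X \<in> \<int>"
  using assms integral unfolding circles_def integral_packing_def curv_gvec by blast

lemma curvatures_eq: "curvatures A B C = {k. \<exists>X\<in>circles. fst X = of_int k}"
  unfolding curvatures_def circles_def curv_gvec by blast

definition states :: "state set" where
  "states = {(a, b, c, m). \<exists>P Q R M. P \<in> circles \<and> Q \<in> circles \<and> R \<in> circles \<and> frame P Q R M \<and>
     fst P = of_int a \<and> fst Q = of_int b \<and> fst R = of_int c \<and> fst M = of_int m}"

lemma statesI:
  assumes "P \<in> circles" "Q \<in> circles" "R \<in> circles" "frame P Q R M"
    "fst P = of_int a" "fst Q = of_int b" "fst R = of_int c" "fst M = of_int m"
  shows "(a, b, c, m) \<in> states"
  using assms unfolding states_def by blast

lemma statesE: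
  assumes "(a, b, c, m) \<in> states"
  obtains P Q R M where "P \<in> circles" "Q \<in> circles" "R \<in> circles" "frame P Q R M"
    "fst P = of_int a" "fst Q = of_int b" "fst R = of_int c" "fst M = of_int m"
  using assms unfolding states_def by blast

text \<open>Integrality of the opposite circle gives only that j = 4m is an integer; the cone
  relation then reads j^2 = 8(ab+bc+ca) and forces 4 | j.\<close>

lemma normal_curvature:
  assumes "P \<in> circles" "Q \<in> circles" "R \<in> circles" "frame P Q R M"
  shows "fst M \<in> \<int>"
proof -
  have "opp P Q R M \<in> circles" using sext_circles[OF assms] unfolding sext_def by blast
  then obtain a b c e where e: "fst P = of_int a" "fst Q = of_int b" "fst R = of_int c"
    "fst (opp P Q R M) = of_int e"
    using circle_curvature assms by (meson Ints_cases)
  define j where "j = e - a - 2 * (b + c)"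
  have "fst (opp P Q R M) = fst P + 2 * (fst Q + fst R) + 4 * fst M" by (simp add: opp_def)
  then have m: "4 * fst M = of_int j" unfolding e j_def by simp
  have "of_int (j\<^sup>2) = 16 * (fst M)\<^sup>2" unfolding of_int_power m[symmetric] by (simp add: power2_eq_square)
  also have "\<dots> = of_int (8 * (a*b + b*c + c*a))"
    using frame_curvature[OF assms(4)] unfolding e by simp
  finally have j: "j\<^sup>2 = 8 * (a*b + b*c + c*a)" by (simp only: of_int_eq_iff)
  then have "even (j\<^sup>2)" by simp
  then have "even j" by simp
  then obtain i where i: "j = 2 * i" by (elim evenE)
  have "i\<^sup>2 = 2 * (a*b + b*c + c*a)" using j unfolding i by (simp add: power2_eq_square)
  then have "even (i\<^sup>2)" by simp
  then have "even i" by simp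
  then obtain h where "i = 2 * h" by (elim evenE)
  then have "fst M = of_int h" using m i by simp
  then show ?thesis by simp
qed

lemma states_of_frame:
  assumes "P \<in> circles" "Q \<in> circles" "R \<in> circles" "frame P Q R M"
  shows "\<exists>a b c m. (a, b, c, m) \<in> states \<and> fst P = of_int a \<and> fst Q = of_int b \<and> fst R = of_int c \<and> fst M = of_int m"
proof -
  obtain a b c m where "fst P = of_int a" "fst Q = of_int b" "fst R = of_int c" "fst M = of_int m"
    using circle_curvature[OF assms(1)] circle_curvature[OF assms(2)] circle_curvature[OF assms(3)]
      normal_curvature[OF assms] by (auto elim!: Ints_cases)
  then show ?thesis using statesI[OF assms] by blast
qed

lemma states_cone:
  assumes "s \<in> states"
  shows "cone s"
proof -
  obtain a b c m where s: "s = (a, b, c, m)" by (cases s)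
  obtain P Q R M where F: "frame P Q R M"
    and f: "fst P = of_int a" "fst Q = of_int b" "fst R = of_int c" "fst M = of_int m"
    using assms unfolding s by (rule statesE)
  have "of_int (2 * m\<^sup>2) = (of_int (a*b + b*c + c*a) :: real)" using frame_curvature[OF F] unfolding f by simp
  then show ?thesis unfolding s cone.simps by (simp only: of_int_eq_iff)
qed

lemma states_minus: "(a, b, c, m) \<in> states \<Longrightarrow> (a, b, c, - m) \<in> states"
  by (elim statesE, rule statesI[OF _ _ _ frame_minus]) simp_all

lemma states_rotate: "(a, b, c, m) \<in> states \<Longrightarrow> (b, c, a, m) \<in> states"
  by (elim statesE, rule statesI[OF _ _ _ frame_rotate])

lemma states_flip:
  assumes "(a, b, c, m) \<in> states"
  shows "(a + 2 * (b + c) + 4 * m, b, c, - m - (b + c)) \<in> states"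
  using assms
proof (rule statesE)
  fix P Q R M assume *: "P \<in> circles" "Q \<in> circles" "R \<in> circles" "frame P Q R M"
    "fst P = of_int a" "fst Q = of_int b" "fst R = of_int c" "fst M = of_int m"
  have "opp P Q R M \<in> circles" using sext_circles[OF *(1-4)] unfolding sext_def by blast
  then show ?thesis
    by (rule statesI[OF _ *(2,3) frame_flip[OF *(4)]]) (simp_all add: opp_def *)
qed

text \<open>\<open>UA 1\<close> is the flip followed by the sign change of m, and
  \<open>UA (- 1)\<close> is the sign change followed by the flip; other exponents are
  iterates.\<close>

lemma states_UA: "s \<in> states \<Longrightarrow> step (UA k) s \<in> states"
proof (induction k arbitrary: s rule: int_induct[where k = 0])
  case base
  then show ?case by (cases s) simp
next
  case (step1 i)
  obtain a b c m where s: "step (UA i) s = (a, b, c, m)" by (cases "step (UA i) s")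
  then have "(a, b, c, m) \<in> states" using step1 by metis
  then have "(a + 2 * (b + c) + 4 * m, b, c, - (- m - (b + c))) \<in> states"
    by (intro states_minus states_flip)
  moreover have "step (UA (i + 1)) s = step (UA 1) (step (UA i) s)"
    by (cases s) (simp add: power2_eq_square algebra_simps)
  ultimately show ?case unfolding s by (simp add: algebra_simps)
next
  case (step2 i)
  obtain a b c m where s: "step (UA i) s = (a, b, c, m)" by (cases "step (UA i) s")
  then have "(a, b, c, m) \<in> states" using step2 by metis
  then have "(a + 2 * (b + c) + 4 * (- m), b, c, - (- m) - (b + c)) \<in> states"
    by (intro states_minus states_flip)
  moreover have "step (UA (i - 1)) s = step (UA (- 1)) (step (UA i) s)"
    by (cases s) (simp add: power2_eq_square algebra_simps)
  ultimately show ?case unfolding s by (simp add: algebra_simps)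
qed

lemma states_step:
  assumes "s \<in> states"
  shows "step x s \<in> states"
proof -
  obtain a b c m where s: "s = (a, b, c, m)" by (cases s)
  have s1: "(b, c, a, m) \<in> states" and s2: "(c, a, b, m) \<in> states"
    using assms states_rotate unfolding s by blast+
  show ?thesis
  proof (cases x)
    case (UA k)
    then show ?thesis using states_UA assms by blast
  next
    case (UB k)
    have "step (UA k) (b, c, a, m) \<in> states" using states_UA s1 by blast
    then have "(a, b + 4*m*k + 2*(c + a)*k\<^sup>2, c, m + k*(c + a)) \<in> states"
      using states_rotate unfolding step.simps by blast
    then show ?thesis unfolding UB s by (simp add: add.commute)
  next
    case (UC k)
    have "step (UA k) (c, a, b, m) \<in> states" using states_UA s2 by blast
    then have "(a, b, c + 4*m*k + 2*(a + b)*k\<^sup>2, m + k*(a + b)) \<in> states"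
      using states_rotate unfolding step.simps by blast
    then show ?thesis unfolding UC s by simp
  qed
qed

lemma states_act: "s \<in> states \<Longrightarrow> act w s \<in> states"
  by (induction w arbitrary: s) (simp_all del: split_paired_All add: states_step)

lemma states_curvatures:
  assumes "s \<in> states"
  shows "snd4 s \<in> curvatures A B C"
proof -
  obtain a b c m where s: "s = (a, b, c, m)" by (cases s)
  then show ?thesis using assms unfolding curvatures_eq s by (elim statesE) auto
qed

text \<open>Every curvature thus occurs as an entry of a state: a circle that is new at some stage
  replaces its opposite vertex by \<open>frame_flip\<close>.\<close>

lemma circle_frame:
  assumes "X \<in> circles"
  shows "\<exists>Q R M. Q \<in> circles \<and> R \<in> circles \<and> frame X Q R M"
proof -
  have "X \<in> S k \<Longrightarrow> \<exists>Q R M. Q \<in> circles \<and> R \<in> circles \<and> frame X Q R M" for k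
  proof (induction k)
    case 0
    have "gvec A \<in> S 0" "gvec B \<in> S 0" "gvec C \<in> S 0" by simp_all
    then have mem: "gvec A \<in> circles" "gvec B \<in> circles" "gvec C \<in> circles" unfolding circles_eq by blast+
    obtain M where "frame (gvec A) (gvec B) (gvec C) M" using initial_frame[OF initial] by blast
    then have "frame (gvec A) (gvec B) (gvec C) M" "frame (gvec B) (gvec C) (gvec A) M"
      "frame (gvec C) (gvec A) (gvec B) M"
      using frame_rotate by blast+
    moreover have "X = gvec A \<or> X = gvec B \<or> X = gvec C" using 0 by auto
    ultimately show ?case using mem by blast
  next
    case (Suc k)
    show ?case
    proof (cases "X \<in> S k")
      case True
      then show ?thesis by (rule Suc.IH)
    next
      case False
      then obtain P Q R M where V: "vacant (S k) P Q R M" "X \<in> sext P Q R M"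
        using Suc.prems unfolding S_Suc by (elim growE) blast+
      note F = vacantD(1)[OF V(1)]
      have mem: "P \<in> circles" "Q \<in> circles" "R \<in> circles" using vacantD(2-4)[OF V(1)] unfolding circles_eq by blast+
      note f = frame_flip[OF F] frame_flip[OF frame_rotate[OF F]] frame_flip[OF frame_rotate[OF frame_rotate[OF F]]]
      show ?thesis using V(2) by (rule sextE) (use mem f False vacantD(2-4)[OF V(1)] in blast)+
    qed
  qed
  then show ?thesis using assms unfolding circles_eq by blast
qed

section \<open>A prime dividing one tangent triple divides all curvatures\<close>

context
  fixes p :: int
  assumes p: "prime p"
begin

definition divisible :: "cvec \<Rightarrow> bool" where
  "divisible X \<longleftrightarrow> (\<exists>j. fst X = of_int (p * j))"

lemma divisible_iff: "fst X = of_int a \<Longrightarrow> divisible X \<longleftrightarrow> p dvd a"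
  unfolding divisible_def by (auto simp only: of_int_eq_iff dvd_def)

lemma sext_divisible:
  assumes mem: "P \<in> circles" "Q \<in> circles" "R \<in> circles" and F: "frame P Q R M"
    and d: "divisible P" "divisible Q" "divisible R" and X: "X \<in> sext P Q R M"
  shows "divisible X"
proof -
  obtain a b c m where s: "(a, b, c, m) \<in> states"
    and f: "fst P = of_int a" "fst Q = of_int b" "fst R = of_int c" "fst M = of_int m"
    using states_of_frame[OF mem F] by blast
  have abc: "p dvd a" "p dvd b" "p dvd c" using d f divisible_iff by blast+
  have "p dvd m" using cone_dvd[OF p _ abc] states_cone[OF s] by simp
  have o: "fst (opp P Q R M) = of_int (a + 2 * (b + c) + 4 * m)"
    "fst (opp Q R P M) = of_int (b + 2 * (c + a) + 4 * m)"
    "fst (opp R P Q M) = of_int (c + 2 * (a + b) + 4 * m)"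
    by (simp_all add: opp_def f)
  have "divisible (opp P Q R M)" "divisible (opp Q R P M)" "divisible (opp R P Q M)"
    unfolding divisible_iff[OF o(1)] divisible_iff[OF o(2)] divisible_iff[OF o(3)]
    using abc \<open>p dvd m\<close> by auto
  then show ?thesis using X d by (elim sextE) simp_all
qed

lemma grow_divisible:
  assumes "\<And>X. X \<in> S k \<Longrightarrow> divisible X" "X \<in> S (Suc k)"
  shows "divisible X"
  using assms(2) unfolding S_Suc
proof (rule growE)
  fix P Q R M assume V: "vacant (S k) P Q R M" "X \<in> sext P Q R M"
  have mem: "P \<in> circles" "Q \<in> circles" "R \<in> circles" using vacantD(2-4)[OF V(1)] unfolding circles_eq by blast+
  show ?thesis using sext_divisible[OF mem vacantD(1)[OF V(1)] _ _ _ V(2)] assms(1) vacantD(2-4)[OF V(1)] by blast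
qed (use assms(1) in blast)

text \<open>Descent and ascent: a divisible triple of stage k+1 makes its octahedron divisible,
  hence also a triple of stage k; at stage 0 the triple is everything. Going back up, each growth
  step preserves divisibility.\<close>

lemma frame_divisible:
  assumes "P \<in> S k" "Q \<in> S k" "R \<in> S k" "frame P Q R N" "divisible P" "divisible Q" "divisible R" "X \<in> S k"
  shows "divisible X"
  using assms
proof (induction k arbitrary: P Q R N X)
  case 0
  have "card {P, Q, R} = 3" using frame_distinct[OF 0(4)] by simp
  moreover have "card (S 0) \<le> 3" by (simp add: card_insert_if)
  moreover have "finite (S 0)" "{P, Q, R} \<subseteq> S 0" using 0(1-3) by auto
  ultimately have "{P, Q, R} = S 0" using card_seteq[of "S 0" "{P, Q, R}"] by simp
  then have "X \<in> {P, Q, R}" using 0(8) by (rule ssubst)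
  then have "X = P \<or> X = Q \<or> X = R" by blast
  then show ?case using 0(5-7) by fast
next
  case (Suc k)
  note cfg = config_stage[OF initial, of k]
  have "\<exists>P Q R M. P \<in> S k \<and> Q \<in> S k \<and> R \<in> S k \<and> frame P Q R M \<and> divisible P \<and> divisible Q \<and> divisible R"
  proof (cases "{P, Q, R} \<subseteq> S k")
    case True
    then have "P \<in> S k" "Q \<in> S k" "R \<in> S k" by (simp_all only: insert_subset)
    then show ?thesis using Suc.prems(4-7) by (intro exI conjI)
  next
    case False
    then obtain A' B' C' M M' where V: "vacant (S k) A' B' C' M" "frame P Q R M'" "sext P Q R M' = sext A' B' C' M"
      using config.grow_frame_cases[OF cfg Suc.prems(1-3)[unfolded S_Suc] Suc.prems(4)] by (elim disjE exE conjE) simp_all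
    have "P \<in> circles" "Q \<in> circles" "R \<in> circles" using Suc.prems(1-3) unfolding circles_eq by blast+
    then have "\<forall>X\<in>sext A' B' C' M. divisible X"
      using sext_divisible[OF _ _ _ V(2)] Suc.prems(5-7) unfolding V(3) by blast
    then have "divisible A'" "divisible B'" "divisible C'" unfolding sext_def by blast+
    then show ?thesis using vacantD(1-4)[OF V(1)] by (intro exI conjI)
  qed
  then obtain P' Q' R' M where PQR: "P' \<in> S k" "Q' \<in> S k" "R' \<in> S k" "frame P' Q' R' M"
    "divisible P'" "divisible Q'" "divisible R'"
    by (elim exE conjE) (rule that)
  have "divisible X" if "X \<in> S k" for X using Suc.IH[OF PQR that] .
  then show ?case using Suc.prems(8) by (rule grow_divisible)
qed

lemma state_divisible:
  assumes "(a, b, c, m) \<in> states" "p dvd a" "p dvd b" "p dvd c" "n \<in> curvatures A B C"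
  shows "p dvd n"
  using assms(1)
proof (rule statesE)
  fix P Q R M assume *: "P \<in> circles" "Q \<in> circles" "R \<in> circles" "frame P Q R M"
    "fst P = of_int a" "fst Q = of_int b" "fst R = of_int c"
  then have d: "divisible P" "divisible Q" "divisible R" using assms(2-4) divisible_iff by blast+
  obtain k where k: "P \<in> S k" "Q \<in> S k" "R \<in> S k" using circles_triple[OF *(1-3)] by blast
  obtain X j where X: "X \<in> S j" "fst X = of_int n"
    using assms(5) unfolding curvatures_eq circles_eq by blast
  let ?l = "max j k"
  have "P \<in> S ?l" "Q \<in> S ?l" "R \<in> S ?l" "X \<in> S ?l"
    using k X(1) S_mono[of k ?l] S_mono[of j ?l] by auto
  then have "divisible X" using frame_divisible *(4) d by blast
  then show ?thesis using divisible_iff[OF X(2)] by blast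
qed

end

lemma states_primitive:
  assumes prim: "primitive_packing A B C" and s: "s \<in> states" and p: "prime p"
  shows "primitive_at p s"
proof (rule ccontr)
  assume n: "\<not> primitive_at p s"
  obtain a b c m where abc: "s = (a, b, c, m)" by (cases s)
  then have "p dvd a" "p dvd b" "p dvd c" using n by auto
  then have "\<forall>n\<in>curvatures A B C. p dvd n"
    using state_divisible[OF p, of a b c m] s abc by blast
  then have "p dvd Gcd (curvatures A B C)" by (intro Gcd_greatest) blast
  then show False using prim p unfolding primitive_packing_def by (metis not_prime_unit)
qed

lemma admissible_iff_cong_8:
  assumes prim: "primitive_packing A B C"
  shows "admissible (curvatures A B C) n \<longleftrightarrow> (\<exists>\<kappa>\<in>curvatures A B C. [n = \<kappa>] (mod 8))"
proof
  assume "admissible (curvatures A B C) n"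
  then show "\<exists>\<kappa>\<in>curvatures A B C. [n = \<kappa>] (mod 8)" unfolding admissible_def by simp
next
  assume "\<exists>\<kappa>\<in>curvatures A B C. [n = \<kappa>] (mod 8)"
  then obtain \<kappa> where \<kappa>: "\<kappa> \<in> curvatures A B C" "[n = \<kappa>] (mod 8)" by blast
  obtain X where X: "X \<in> circles" "fst X = of_int \<kappa>" using \<kappa>(1) unfolding curvatures_eq by blast
  obtain Q R M where mem: "Q \<in> circles" "R \<in> circles" and F: "frame X Q R M"
    using circle_frame[OF X(1)] by blast
  \<comment> \<open>Rotation puts X in the second place, the coordinate that the moves
    steer.\<close>
  have G: "frame R X Q M" using frame_rotate[OF frame_rotate[OF F]] .
  obtain a b c m where s: "(a, b, c, m) \<in> states" and b: "fst X = of_int b"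
    using states_of_frame[OF mem(2) X(1) mem(1) G] by blast
  have "b = \<kappa>" using b X(2) by simp
  then have n8: "8 dvd snd4 (a, b, c, m) - n" using cong_sym[OF \<kappa>(2)] by (simp add: cong_iff_dvd_diff)
  show "admissible (curvatures A B C) n"
    unfolding admissible_def
  proof (intro allI impI)
    fix q :: int assume "q > 0"
    then have "nat q > 0" "int (nat q) = q" by simp_all
    then obtain w where w: "[snd4 (act w (a, b, c, m)) = n] (mod q)"
      using reach_mod[OF states_cone[OF s] states_primitive[OF prim s] n8, of "nat q"] by auto
    have "snd4 (act w (a, b, c, m)) \<in> curvatures A B C"
      using states_curvatures states_act s by blast
    then show "\<exists>\<kappa>\<in>curvatures A B C. [n = \<kappa>] (mod q)" using cong_sym[OF w] by blast
  qed
qed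

end

theorem theorem1p1:
  fixes A B C :: gcircle and n :: int
  assumes "initial_triple A B C"
    and "integral_packing A B C"
    and "primitive_packing A B C"
  shows "admissible (curvatures A B C) n \<longleftrightarrow>
           (\<exists>\<kappa>\<in>curvatures A B C. [n = \<kappa>] (mod 8))"
  by (rule integral_triple.admissible_iff_cong_8) (use assms in \<open>simp_all add: integral_triple_def\<close>)

end
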